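(* Let $k\geq 1$ be an integer. For every symmetric matrix $\boldsymbol{p}=(p_{i,j})_{i,j\in[k]}\in[0,1]^{k\times k}$ and every non-zero real vector $\boldsymbol{\alpha}\in[0,\infty)^k$, the function $J_{\boldsymbol{\alpha},\boldsymbol{p}}:\widetilde{\mathcal{W}}\to[0,\infty]$ is lower semi-continuous with respect to the metric $\delta_\Box$; that is, for every $r\in\mathbb{R}$ the level set $\{x\in\widetilde{\mathcal{W}} : J_{\boldsymbol{\alpha},\boldsymbol{p}}(x)\leq r\}$ is closed in $(\widetilde{\mathcal{W}},\delta_\Box)$.
   Context: Notation: $[k]=\{1,\dots,k\}$; $\lambda$ is Lebesgue measure on $[0,1]$ and $\lambda^{\oplus 2}$ is Lebesgue measure on $[0,1]^2$; "measurable" means Lebesgue measurable. Graphons. A graphon is a measurable function $U:[0,1]^2\to[0,1]$ with $U(x,y)=U(y,x)$ for all $x,y$. $\mathcal{W}$ is the set of all graphons. For $U,V\in\mathcal{W}$, $d_\Box(U,V):=\sup_{A,B}\left|\int_{A\times B}(U-V)\,d\lambda^{\oplus 2}\right|$, the supremum over measurable $A,B\subseteq[0,1]$. For $\phi:[0,1]\to[0,1]$, $U^\phi(x,y):=U(\phi(x),\phi(y))$. The cut-distance is $\delta_\Box(U,V):=\inf_{\phi,\psi}d_\Box(U^\phi,V^\psi)$, the infimum over all measure-preserving maps $\phi,\psi:[0,1]\to[0,1]$; it is a pseudo-metric on $\mathcal{W}$. For $U\in\mathcal{W}$ let $\widetilde{U}:=\{V\in\mathcal{W}:\delta_\Box(U,V)=0\}$,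 and let $\widetilde{\mathcal{W}}:=\{\widetilde{U}:U\in\mathcal{W}\}$ be the quotient, with the induced metric still denoted $\delta_\Box$. Relative entropy. For $p\in[0,1]$, $h_p:[0,1]\to[0,\infty]$ is $h_p(r):=r\log\left(\frac{r}{p}\right)+(1-r)\log\left(\frac{1-r}{1-p}\right)$, with conventions $0\log 0=0\log(0/0)=0$, $h_0(r)=+\infty$ for $r\neq 0$, and $h_1(r)=+\infty$ for $r\neq 1$. The function $J$. For a non-zero $\boldsymbol{\alpha}=(\alpha_1,\dots,\alpha_k)\in[0,\infty)^k$, let $\|\boldsymbol{\alpha}\|_1=\sum_i\alpha_i$ and let $(I^{(\boldsymbol{\alpha})}_1,\dots,I^{(\boldsymbol{\alpha})}_k)$ be the partition of $[0,1]$ into consecutive intervals such that $I^{(\boldsymbol{\alpha})}_i$ has length $\alpha_i/\|\boldsymbol{\alpha}\|_1$ (each dividing point being assigned to, e.g., its right interval). For $U\in\mathcal{W}$, $$J_{\boldsymbol{\alpha},\boldsymbol{p}}(\widetilde{U}):=\inf_{V\in\widetilde{U}}\ \frac12\sum_{i,j\in[k]}\int_{I^{(\boldsymbol{\alpha})}_i\times I^{(\boldsymbol{\alpha})}_j}h_{p_{i,j}}(V(x,y))\,dx\,dy .$$ *)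

theory Defs
  imports "HOL-Analysis.Analysis"
begin

section \<open>Graphons and the cut-distance\<close>

abbreviation unit_interval :: "real set" where
  "unit_interval \<equiv> {0..1}"

abbreviation unit_square :: "(real \<times> real) set" where
  "unit_square \<equiv> unit_interval \<times> unit_interval"

text \<open>
  Functions on the unit square are represented by total functions on the plane. Their values
  outside the square are arbitrary, and nothing below depends on those values.
\<close>

definition graphons :: "(real \<times> real \<Rightarrow> real) set" where
  "graphons = {U. U \<in> borel_measurable (lebesgue_on unit_square)
                \<and> (\<forall>z\<in>unit_square. U z \<in> unit_interval)
                \<and> (\<forall>x\<in>unit_interval. \<forall>y\<in>unit_interval. U (x, y) = U (y, x))}"

definition cut_metric :: "(real \<times> real \<Rightarrow> real) \<Rightarrow> (real \<times> real \<Rightarrow> real) \<Rightarrow> real" where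
  "cut_metric U V =
     (SUP (A, B) \<in> sets (lebesgue_on unit_interval) \<times> sets (lebesgue_on unit_interval).
        \<bar>LINT z:A \<times> B|lebesgue. U z - V z\<bar>)"

definition measure_preserving_maps :: "(real \<Rightarrow> real) set" where
  "measure_preserving_maps =
     {\<phi> \<in> lebesgue_on unit_interval \<rightarrow>\<^sub>M lebesgue_on unit_interval.
        \<forall>A\<in>sets (lebesgue_on unit_interval).
          emeasure lebesgue (\<phi> -` A \<inter> unit_interval) = emeasure lebesgue A}"

definition pullback :: "(real \<times> real \<Rightarrow> real) \<Rightarrow> (real \<Rightarrow> real) \<Rightarrow> real \<times> real \<Rightarrow> real" where
  "pullback U \<phi> = (\<lambda>(x, y). U (\<phi> x, \<phi> y))"

definition cut_dist :: "(real \<times> real \<Rightarrow> real) \<Rightarrow> (real \<times> real \<Rightarrow> real) \<Rightarrow> real" where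
  "cut_dist U V =
     (INF (\<phi>, \<psi>) \<in> measure_preserving_maps \<times> measure_preserving_maps.
        cut_metric (pullback U \<phi>) (pullback V \<psi>))"

definition unlabelled :: "(real \<times> real \<Rightarrow> real) \<Rightarrow> (real \<times> real \<Rightarrow> real) set" where
  "unlabelled U = {V \<in> graphons. cut_dist U V = 0}"

definition unlabelled_graphons :: "(real \<times> real \<Rightarrow> real) set set" where
  "unlabelled_graphons = unlabelled ` graphons"

text \<open>
  The metric induced on the quotient: the common value of the cut-distance over all choices of
  representatives. The value 0 off the carrier is a dummy; the library's \<open>Metric_space\<close> requires
  nonnegativity and symmetry there too.
\<close>

definition unlabelled_dist ::
    "(real \<times> real \<Rightarrow> real) set \<Rightarrow> (real \<times> real \<Rightarrow> real) set \<Rightarrow> real" where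
  "unlabelled_dist X Y =
     (if X \<in> unlabelled_graphons \<and> Y \<in> unlabelled_graphons
      then the_elem {cut_dist U V | U V. U \<in> X \<and> V \<in> Y} else 0)"

section \<open>Relative entropy and the rate function\<close>

text \<open>
  The conventions for zero arguments come for free from \<open>ln 0 = 0\<close> and \<open>x / 0 = 0\<close>. The
  embedding \<open>ennreal\<close>, which maps negative reals to 0, truncates nothing here, as
  \<open>rel_entropy_nonneg\<close> shows.
\<close>

definition rel_entropy :: "real \<Rightarrow> real \<Rightarrow> ennreal" where
  "rel_entropy p r =
     (if (p = 0 \<and> r \<noteq> 0) \<or> (p = 1 \<and> r \<noteq> 1) then \<infinity>
      else ennreal (r * ln (r / p) + (1 - r) * ln ((1 - r) / (1 - p))))"

lemma rel_entropy_nonneg: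
  fixes p r :: real
  assumes "p \<in> {0..1}" and "r \<in> {0..1}" and "p = 0 \<longrightarrow> r = 0" and "p = 1 \<longrightarrow> r = 1"
  shows "0 \<le> r * ln (r / p) + (1 - r) * ln ((1 - r) / (1 - p))"
proof -
  have key: "a - b \<le> a * ln (a / b)" if "0 \<le> a" "0 \<le> b" "b = 0 \<longrightarrow> a = 0" for a b :: real
  proof (cases "a = 0")
    case True
    then show ?thesis using that by simp
  next
    case False
    then have "0 < a" "0 < b" using that by auto
    then have "ln (b / a) \<le> b / a - 1"
      by (intro ln_le_minus_one) simp
    then have "a * ln (b / a) \<le> a * (b / a - 1)"
      using \<open>0 < a\<close> by (intro mult_left_mono) auto
    also have "\<dots> = b - a"
      using \<open>0 < a\<close> by (simp add: field_simps)
    finally show ?thesis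
      using \<open>0 < a\<close> \<open>0 < b\<close> by (simp add: ln_div algebra_simps)
  qed
  show ?thesis
    using key[of r p] key[of "1 - r" "1 - p"] assms by auto
qed

text \<open>
  A vector \<open>\<alpha>\<close> in \<open>[0,\<infinity>)\<^sup>k\<close> is a function of which only the entries with index in \<open>{1..k}\<close> are
  used, and likewise for \<open>k \<times> k\<close> matrices. Dividing points belong to the interval on their right,
  and the point 1 to the last interval.
\<close>

definition breakpoint :: "nat \<Rightarrow> (nat \<Rightarrow> real) \<Rightarrow> nat \<Rightarrow> real" where
  "breakpoint k \<alpha> i = (\<Sum>j\<in>{1..i}. \<alpha> j) / (\<Sum>j\<in>{1..k}. \<alpha> j)"

definition block :: "nat \<Rightarrow> (nat \<Rightarrow> real) \<Rightarrow> nat \<Rightarrow> real set" where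
  "block k \<alpha> i =
     (if i = k then {breakpoint k \<alpha> (i - 1)..breakpoint k \<alpha> i}
      else {breakpoint k \<alpha> (i - 1)..<breakpoint k \<alpha> i})"

definition rate_fun ::
    "nat \<Rightarrow> (nat \<Rightarrow> real) \<Rightarrow> (nat \<Rightarrow> nat \<Rightarrow> real) \<Rightarrow> (real \<times> real \<Rightarrow> real) set \<Rightarrow> ennreal" where
  "rate_fun k \<alpha> p X =
     (INF V\<in>X. (1 / 2) * (\<Sum>i\<in>{1..k}. \<Sum>j\<in>{1..k}.
        \<integral>\<^sup>+z\<in>block k \<alpha> i \<times> block k \<alpha> j. rel_entropy (p i j) (V z) \<partial>lebesgue))"

end

theory Submission
  imports Defs "HOL-Probability.Probability_Measure" "HOL-Complex_Analysis.Great_Picard"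
begin

text \<open>
  Let \<open>V\<^sub>n\<close> be near-minimisers for a sequence of classes converging to the class of \<open>U\<close>, and choose
  measure-preserving maps with \<open>V\<^sub>n\<^sup>\<phi>\<close> and \<open>U\<^sup>\<psi>\<close> close in cut norm (\<open>\<phi>\<close>, \<open>\<psi>\<close> depending on \<open>n\<close>). The law of
  \<open>\<psi>\<close> restricted to \<open>\<phi>\<^sup>-\<^sup>1(I\<^sub>i)\<close> has a 1-Lipschitz distribution function, so along a subsequence these
  converge to some \<open>G\<^sub>i\<close>; a quantile transform gives one measure-preserving \<open>\<theta>\<close> whose law on each
  block \<open>I\<^sub>i\<close> has distribution function \<open>G\<^sub>i\<close>. Then integrals of \<open>V\<^sub>n\<^sup>\<phi> * (f \<circ> \<psi>)\<close> over the blocks converge to those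
  of \<open>U\<^sup>\<theta> * (f \<circ> \<theta>)\<close> for all integrable \<open>f\<close>: this holds on quadrants by cut-norm convergence, and
  passes to all \<open>f\<close> by a Dynkin argument. Bounding the convex function \<open>h\<^sub>p\<close> below by its tangents at
  (truncations of) the values of \<open>U\<close>, and applying Fatou's lemma, shows that \<open>U\<^sup>\<theta>\<close> attains at most the
  limit of the entropies of \<open>V\<^sub>n\<close>, and \<open>U\<^sup>\<theta>\<close> lies in the class of \<open>U\<close>.

  The triangle inequality for the cut distance comes from the same quantile transform, which lifts
  \<open>\<psi>\<close> through \<open>\<phi>\<close> up to an arbitrarily small error. All of this is carried out for Borel functions;
  graphons and measure-preserving maps agree almost everywhere with Borel ones.
\<close>

section \<open>Lebesgue measure on the unit interval\<close>

text \<open>The blocks belong to the coordinates of the approximating graphons, the limit to those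
  of \<open>U\<close>, and the two are linked only by maps that change with n. The preimages of the
  blocks need not converge as sets: a weak limit of their indicators may take values strictly
  between 0 and 1. Hence only the law of \<psi> on each preimage is followed. A map on the block
  itself can reproduce the limit law because a block has no atoms, and the limit laws of all blocks
  sum to Lebesgue measure, so the glued map preserves measure. In two variables nothing beyond these
  one-variable laws is required: a block of the square is a product, and so is a quadrant. The test
  functions are composed with \<psi> because the coefficients of the tangents, taken at values of
  \<open>U\<close> composed with \<psi>, have this form. Truncation is forced by the infinite slopes
  of the entropy at 0 and 1 for 0 < p < 1. Borel sets replace Lebesgue sets because the Borel sets
  of the plane are the product of those of the lines, which fails for Lebesgue sets.\<close>

definition unit_leb :: "real measure" where
  "unit_leb = density lborel (indicator {0..1})"

abbreviation unit_leb2 :: "(real \<times> real) measure" where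
  "unit_leb2 \<equiv> unit_leb \<Otimes>\<^sub>M unit_leb"

lemma sets_unit_leb [simp, measurable_cong]: "sets unit_leb = sets borel"
  by (simp add: unit_leb_def)

lemma space_unit_leb [simp]: "space unit_leb = UNIV"
  by (simp add: unit_leb_def)

lemma emeasure_unit_leb:
  assumes "A \<in> sets borel"
  shows "emeasure unit_leb A = emeasure lborel (A \<inter> {0..1})"
proof -
  have "emeasure unit_leb A = (\<integral>\<^sup>+x. indicator (A \<inter> {0..1}) x \<partial>lborel)"
    using assms by (auto simp: unit_leb_def emeasure_density indicator_inter_arith mult.commute)
  then show ?thesis
    using assms by simp
qed

interpretation unit_leb: prob_space unit_leb
proof
  show "emeasure unit_leb (space unit_leb) = 1"
    by (simp add: emeasure_unit_leb)
qed

interpretation unit_leb2: pair_prob_space unit_leb unit_leb ..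

lemma sets_unit_leb2: "sets unit_leb2 = sets borel"
  using sets_pair_measure_cong[OF sets_unit_leb sets_unit_leb] borel_prod by metis

lemma space_unit_leb2 [simp]: "space unit_leb2 = UNIV"
  by (simp add: space_pair_measure)

lemma unit_leb2_eq: "unit_leb2 = density lborel (indicator ({0..1} \<times> {0..1}))"
proof -
  have "unit_leb2 = density (lborel \<Otimes>\<^sub>M lborel) (\<lambda>(x, y). indicator {0..1} x * indicator {0..1} y)"
    unfolding unit_leb_def
    by (intro pair_measure_density) 
       (auto intro!: sigma_finite_lborel unit_leb.sigma_finite_measure_axioms[unfolded unit_leb_def])
  moreover have "(\<lambda>(x, y). indicator {0..1} x * indicator {0..1} y :: ennreal)
      = indicator ({0..1::real} \<times> {0..1::real})"
    by (auto simp: indicator_def fun_eq_iff)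
  ultimately show ?thesis
    by (simp add: lborel_prod)
qed

lemma AE_unit_leb_iff: "(AE x in unit_leb. P x) \<longleftrightarrow> (AE x in lborel. x \<in> {0..1} \<longrightarrow> P x)"
  unfolding unit_leb_def by (subst AE_density) (auto simp: indicator_def)

lemma AE_unit_leb2_iff:
  "(AE z in unit_leb2. P z) \<longleftrightarrow> (AE z in lborel. z \<in> unit_square \<longrightarrow> P z)"
  unfolding unit_leb2_eq
  by (subst AE_density)
     (auto simp: indicator_def intro!: borel_measurable_indicator borel_closed closed_Times)

lemma AE_unit_leb_in: "AE x in unit_leb. x \<in> {0..1}"
  by (simp add: AE_unit_leb_iff)

lemma measure_unit_leb_atMost:
  "measure unit_leb {..x} = max 0 (min 1 x)"
proof -
  have "{..x} \<inter> {0..1} = (if x < 0 then {} else {0..min 1 x})"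
    by auto
  then have "emeasure unit_leb {..x} = ennreal (max 0 (min 1 x))"
    by (auto simp: emeasure_unit_leb)
  then show ?thesis
    by (simp add: measure_def)
qed

lemma measure_unit_leb_Ioc_le:
  assumes "x \<le> y"
  shows "measure unit_leb {x<..y} \<le> y - x"
proof -
  have "emeasure unit_leb {x<..y} = emeasure lborel ({x<..y} \<inter> {0..1})"
    by (simp add: emeasure_unit_leb)
  also have "\<dots> \<le> emeasure lborel {x<..y}"
    by (intro emeasure_mono) auto
  also have "\<dots> = ennreal (y - x)"
    using assms by simp
  finally show ?thesis
    using assms by (simp add: unit_leb.emeasure_eq_measure)
qed

text \<open>Complements turn the rays \<open>{..x}\<close> into the rays \<open>{x<..}\<close> that
  \<open>measure_eqI_lessThan\<close> works with; this is where the equality of the total masses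
  enters.\<close>

lemma measure_eqI_atMost:
  fixes M N :: "real measure"
  assumes "finite_measure M" "finite_measure N"
    and sets: "sets M = sets borel" "sets N = sets borel"
    and "measure M UNIV = measure N UNIV"
    and eq: "\<And>x. measure M {..x} = measure N {..x}"
  shows "M = N"
proof -
  interpret M: finite_measure M by fact
  interpret N: finite_measure N by fact
  have sp: "space M = UNIV" "space N = UNIV"
    using sets_eq_imp_space_eq[OF sets(1)] sets_eq_imp_space_eq[OF sets(2)] by auto
  have *: "{x<..} = UNIV - {..x}" for x :: real
    by auto
  have "measure M {x<..} = measure N {x<..}" for x
    unfolding * using assms sp
    by (simp add: M.finite_measure_Diff N.finite_measure_Diff)
  then show ?thesis
    by (intro measure_eqI_lessThan sets)
       (simp_all add: M.emeasure_eq_measure N.emeasure_eq_measure less_top[symmetric])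
qed

section \<open>Measure-preserving maps and quantile transforms\<close>

text \<open>Only the image law is prescribed, so such a map may leave the unit interval on a null
  set. Being Borel and total, these maps compose freely with one another and with Borel
  functions.\<close>

definition mp_maps :: "(real \<Rightarrow> real) set" where
  "mp_maps = {\<phi> \<in> borel_measurable borel. distr unit_leb borel \<phi> = unit_leb}"

lemma mp_maps_measurable [measurable_dest]: "\<phi> \<in> mp_maps \<Longrightarrow> \<phi> \<in> borel_measurable borel"
  by (simp add: mp_maps_def)

lemma distr_mp_maps: "\<phi> \<in> mp_maps \<Longrightarrow> distr unit_leb unit_leb \<phi> = unit_leb"
  by (simp add: mp_maps_def cong: distr_cong)

lemma id_mp_maps: "(\<lambda>x. x) \<in> mp_maps"
  by (auto simp: mp_maps_def intro!: measure_eqI simp: emeasure_distr)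

lemma comp_mp_maps:
  assumes "\<phi> \<in> mp_maps" "\<psi> \<in> mp_maps"
  shows "(\<lambda>x. \<phi> (\<psi> x)) \<in> mp_maps"
proof -
  have [measurable]: "\<phi> \<in> borel_measurable borel" "\<psi> \<in> borel_measurable borel"
    using assms by (auto simp: mp_maps_def)
  have "distr unit_leb borel (\<phi> \<circ> \<psi>) = distr (distr unit_leb borel \<psi>) borel \<phi>"
    by (intro distr_distr[symmetric]) auto
  then show ?thesis
    using assms by (auto simp: mp_maps_def comp_def)
qed

lemma measure_mp_maps:
  assumes "\<phi> \<in> mp_maps" "A \<in> sets borel"
  shows "measure unit_leb (\<phi> -` A) = measure unit_leb A"
proof -
  have [measurable]: "\<phi> \<in> borel_measurable borel"
    using assms by (auto simp: mp_maps_def)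
  have "measure unit_leb A = measure (distr unit_leb borel \<phi>) A"
    using assms by (simp add: mp_maps_def)
  also have "\<dots> = measure unit_leb (\<phi> -` A)"
    using assms by (subst measure_distr) auto
  finally show ?thesis ..
qed

lemma AE_mp_maps:
  assumes "\<phi> \<in> mp_maps" "AE x in unit_leb. P x"
  shows "AE x in unit_leb. P (\<phi> x)"
proof -
  have [measurable]: "\<phi> \<in> borel_measurable borel"
    using assms by (auto simp: mp_maps_def)
  have "AE x in distr unit_leb unit_leb \<phi>. P x"
    unfolding distr_mp_maps[OF assms(1)] by (rule assms(2))
  then show ?thesis
    by (rule AE_distrD[rotated]) auto
qed

lemma distr_mp_maps_pair:
  assumes "\<phi> \<in> mp_maps" "\<psi> \<in> mp_maps"
  shows "distr unit_leb2 unit_leb2 (\<lambda>(x, y). (\<phi> x, \<psi> y)) = unit_leb2"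
proof -
  have [measurable]: "\<phi> \<in> borel_measurable borel" "\<psi> \<in> borel_measurable borel"
    using assms by (auto simp: mp_maps_def)
  have "sigma_finite_measure (distr unit_leb unit_leb \<psi>)"
    using assms by (simp add: distr_mp_maps unit_leb.sigma_finite_measure_axioms)
  then have "distr unit_leb unit_leb \<phi> \<Otimes>\<^sub>M distr unit_leb unit_leb \<psi>
    = distr unit_leb2 unit_leb2 (\<lambda>(x, y). (\<phi> x, \<psi> y))"
    by (intro pair_measure_distr) auto
  then show ?thesis
    using assms by (simp add: distr_mp_maps)
qed

lemma AE_mp_maps_pair:
  assumes "\<phi> \<in> mp_maps" "AE z in unit_leb2. P z"
  shows "AE z in unit_leb2. P (\<phi> (fst z), \<phi> (snd z))"
proof -
  have [measurable]: "\<phi> \<in> borel_measurable borel"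
    using assms by (auto simp: mp_maps_def)
  have "AE x in distr unit_leb2 unit_leb2 (\<lambda>(x, y). (\<phi> x, \<phi> y)). P x"
    unfolding distr_mp_maps_pair[OF assms(1) assms(1)] by (rule assms(2))
  then have "AE z in unit_leb2. P ((\<lambda>(x, y). (\<phi> x, \<phi> y)) z)"
    by (rule AE_distrD[rotated]) measurable
  then show ?thesis
    by (simp add: case_prod_beta)
qed

lemma integrable_mp_maps_pair:
  fixes f :: "real \<times> real \<Rightarrow> real"
  assumes "\<phi> \<in> mp_maps" "integrable unit_leb2 f"
  shows "integrable unit_leb2 (\<lambda>z. f (\<phi> (fst z), \<phi> (snd z)))"
proof -
  have [measurable]: "\<phi> \<in> borel_measurable borel"
    using assms by (auto simp: mp_maps_def)
  have "integrable (distr unit_leb2 unit_leb2 (\<lambda>(x, y). (\<phi> x, \<phi> y))) f"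
    unfolding distr_mp_maps_pair[OF assms(1) assms(1)] by (rule assms)
  then have "integrable unit_leb2 (\<lambda>z. f ((\<lambda>(x, y). (\<phi> x, \<phi> y)) z))"
    by (rule integrable_distr[rotated]) measurable
  then show ?thesis
    by (simp add: case_prod_beta)
qed

lemma integral_mp_maps_pair:
  fixes f :: "real \<times> real \<Rightarrow> real"
  assumes "\<phi> \<in> mp_maps" "f \<in> borel_measurable borel"
  shows "(\<integral>z. f (\<phi> (fst z), \<phi> (snd z)) \<partial>unit_leb2) = (\<integral>z. f z \<partial>unit_leb2)"
proof -
  have [measurable]: "\<phi> \<in> borel_measurable borel"
    using assms by (auto simp: mp_maps_def)
  have [measurable]: "f \<in> borel_measurable unit_leb2"
    using assms(2) measurable_cong_sets[OF sets_unit_leb2 refl] by blast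
  have "(\<integral>z. f z \<partial>unit_leb2) = (\<integral>z. f z \<partial>distr unit_leb2 unit_leb2 (\<lambda>(x, y). (\<phi> x, \<phi> y)))"
    using assms by (simp add: distr_mp_maps_pair)
  also have "\<dots> = (\<integral>z. f ((\<lambda>(x, y). (\<phi> x, \<phi> y)) z) \<partial>unit_leb2)"
    by (intro integral_distr) auto
  finally show ?thesis
    by (simp add: case_prod_beta)
qed

lemma nn_integral_mp_maps_pair:
  fixes f :: "real \<times> real \<Rightarrow> ennreal"
  assumes "\<phi> \<in> mp_maps" "f \<in> borel_measurable borel"
  shows "(\<integral>\<^sup>+z. f (\<phi> (fst z), \<phi> (snd z)) \<partial>unit_leb2) = (\<integral>\<^sup>+z. f z \<partial>unit_leb2)"
proof -
  have [measurable]: "\<phi> \<in> borel_measurable borel"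
    using assms by (auto simp: mp_maps_def)
  have [measurable]: "f \<in> borel_measurable unit_leb2"
    using assms(2) measurable_cong_sets[OF sets_unit_leb2 refl] by blast
  have "(\<integral>\<^sup>+z. f z \<partial>unit_leb2) = (\<integral>\<^sup>+z. f z \<partial>distr unit_leb2 unit_leb2 (\<lambda>(x, y). (\<phi> x, \<phi> y)))"
    using assms by (simp add: distr_mp_maps_pair)
  also have "\<dots> = (\<integral>\<^sup>+z. f ((\<lambda>(x, y). (\<phi> x, \<phi> y)) z) \<partial>unit_leb2)"
    by (intro nn_integral_distr) auto
  finally show ?thesis
    by (simp add: case_prod_beta)
qed

text \<open>The increment is carried by the preimage of \<open>{x<..y}\<close>, whose measure is at
  most y - x since \<psi> preserves measure. The bound depends neither on \<open>A\<close> nor on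
  \<psi>, which later gives equicontinuity along a sequence. With the identity as \<psi> it concerns
  the distribution function of \<open>A\<close> itself.\<close>

lemma measure_Int_atMost_lipschitz:
  assumes [measurable]: "A \<in> sets borel" and "\<psi> \<in> mp_maps" and "x \<le> y"
  shows "measure unit_leb (A \<inter> \<psi> -` {..x}) \<le> measure unit_leb (A \<inter> \<psi> -` {..y})"
    and "measure unit_leb (A \<inter> \<psi> -` {..y}) \<le> measure unit_leb (A \<inter> \<psi> -` {..x}) + (y - x)"
proof -
  have [measurable]: "\<psi> \<in> borel_measurable borel"
    using assms by (auto simp: mp_maps_def)
  have *: "\<psi> -` S \<in> sets borel" if "S \<in> sets borel" for S
    using measurable_sets[of \<psi> borel borel S] that by simp
  show "measure unit_leb (A \<inter> \<psi> -` {..x}) \<le> measure unit_leb (A \<inter> \<psi> -` {..y})"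
    using assms * by (intro unit_leb.finite_measure_mono) (auto simp: sets.Int)
  have "measure unit_leb (A \<inter> \<psi> -` {..y})
      \<le> measure unit_leb ((A \<inter> \<psi> -` {..x}) \<union> \<psi> -` {x<..y})"
    using assms * by (intro unit_leb.finite_measure_mono) (auto simp: sets.Int sets.Un)
  also have "\<dots> \<le> measure unit_leb (A \<inter> \<psi> -` {..x}) + measure unit_leb (\<psi> -` {x<..y})"
    using assms * by (intro measure_Un_le) (auto simp: sets.Int sets.Un)
  also have "measure unit_leb (\<psi> -` {x<..y}) \<le> y - x"
    using measure_mp_maps[OF assms(2), of "{x<..y}"] measure_unit_leb_Ioc_le[OF assms(3)] by simp
  finally show "measure unit_leb (A \<inter> \<psi> -` {..y}) \<le> measure unit_leb (A \<inter> \<psi> -` {..x}) + (y - x)"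
    by simp
qed

section \<open>Distribution functions and quantiles\<close>

lemma continuous_on_lipschitz_mono:
  fixes G :: "real \<Rightarrow> real"
  assumes "\<And>x y. x \<le> y \<Longrightarrow> G x \<le> G y" "\<And>x y. x \<le> y \<Longrightarrow> G y \<le> G x + (y - x)"
  shows "continuous_on UNIV G"
proof (rule continuous_on_subset[OF lipschitz_on_continuous_on])
  show "1-lipschitz_on UNIV G"
  proof (rule lipschitz_onI)
    fix x y :: real
    show "dist (G x) (G y) \<le> 1 * dist x y"
      using assms[of x y] assms[of y x] by (cases "x \<le> y") (auto simp: dist_real_def)
  qed auto
qed auto

text \<open>The probability integral transform: the distribution function of \<open>A\<close>
  carries the measure on \<open>A\<close> to Lebesgue measure on an interval starting at 0. Within
  [0,1] the sublevel set is the ray ending at the largest point \<open>s\<close> of [0,1] with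
  \<open>F s \<le> y\<close>, and continuity forces \<open>F s = y\<close>.\<close>

lemma measure_atMost_level:
  assumes A [measurable]: "A \<in> sets borel" and y: "0 \<le> y" "y \<le> measure unit_leb A"
  shows "measure unit_leb (A \<inter> {t. measure unit_leb (A \<inter> {..t}) \<le> y}) = y"
proof -
  define F where "F t = measure unit_leb (A \<inter> {..t})" for t
  have F: "F x \<le> F y" "F y \<le> F x + (y - x)" if "x \<le> y" for x y
    using measure_Int_atMost_lipschitz[OF A id_mp_maps that] by (auto simp: F_def)
  have cont: "continuous_on S F" for S
    using continuous_on_lipschitz_mono[of F] F continuous_on_subset by blast
  have "F 0 \<le> measure unit_leb {..0}"
    unfolding F_def by (intro unit_leb.finite_measure_mono) auto
  then have F0: "F 0 = 0"
    by (simp add: measure_unit_leb_atMost F_def measure_le_0_iff)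
  have F1: "F t = measure unit_leb A" if "1 \<le> t" for t
    unfolding F_def
    using that by (intro unit_leb.finite_measure_eq_AE eventually_mono[OF AE_unit_leb_in]) auto
  have "\<exists>s\<ge>0. s \<le> 1 \<and> F s = y"
    using y F0 F1 cont by (intro IVT') auto
  then have ne: "{t \<in> {0..1}. F t \<le> y} \<noteq> {}"
    by force
  define s where "s = Sup {t \<in> {0..1}. F t \<le> y}"
  have bdd: "bdd_above {t \<in> {0..1}. F t \<le> y}"
    by (auto intro!: bdd_aboveI[of _ 1])
  have "closed {t \<in> {0..1}. F t \<le> y}"
    unfolding Collect_conj_eq Collect_mem_eq
    by (intro closed_Int closed_Collect_le cont continuous_on_const) auto
  then have "s \<in> {t \<in> {0..1}. F t \<le> y}"
    unfolding s_def by (intro closed_contains_Sup bdd ne)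
  then have s: "0 \<le> s" "s \<le> 1" "F s \<le> y"
    by auto
  have max: "t \<le> s" if "0 \<le> t" "t \<le> 1" "F t \<le> y" for t
    unfolding s_def using that by (intro cSup_upper bdd) auto
  have Fs: "F s = y"
  proof -
    from \<open>\<exists>s\<ge>0. s \<le> 1 \<and> F s = y\<close> obtain s' where "0 \<le> s'" "s' \<le> 1" "F s' = y" by auto
    then show ?thesis
      using max[of s'] F(1)[of s' s] s by auto
  qed
  have "measure unit_leb (A \<inter> {t. F t \<le> y}) = measure unit_leb (A \<inter> {..s})"
  proof (rule unit_leb.finite_measure_eq_AE)
    show "AE x in unit_leb. (x \<in> A \<inter> {t. F t \<le> y}) = (x \<in> A \<inter> {..s})"
      using AE_unit_leb_in
    proof eventually_elim
      case (elim x)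
      then show ?case
        using max[of x] F(1)[of x s] Fs by auto
    qed
    have "{t. F t \<le> y} \<in> sets borel"
      by (intro borel_closed closed_Collect_le cont continuous_on_const)
    then show "A \<inter> {t. F t \<le> y} \<in> sets unit_leb" by simp
  qed auto
  then show ?thesis
    using Fs by (simp add: F_def)
qed

text \<open>
  \<open>\<theta>\<close> is the quantile function of \<open>G\<close> composed with the distribution function of \<open>A\<close>.
\<close>

lemma quantile_transform:
  fixes G :: "real \<Rightarrow> real"
  assumes A [measurable]: "A \<in> sets borel"
    and mono: "\<And>x y. x \<le> y \<Longrightarrow> G x \<le> G y" and cont: "continuous_on UNIV G"
    and G0: "\<And>x. x \<le> 0 \<Longrightarrow> G x = 0" and G1: "\<And>x. 1 \<le> x \<Longrightarrow> G x = measure unit_leb A"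
  obtains \<theta> :: "real \<Rightarrow> real" where "\<theta> \<in> borel_measurable borel" "range \<theta> \<subseteq> {0..1}"
    and "\<And>x. measure unit_leb (A \<inter> \<theta> -` {..x}) = G x"
proof -
  define F where "F t = measure unit_leb (A \<inter> {..t})" for t
  have Fmono: "F x \<le> F y" if "x \<le> y" for x y
    using measure_Int_atMost_lipschitz[OF A id_mp_maps that] by (auto simp: F_def)
  have F1: "F t \<le> G 1" for t
    unfolding F_def G1[OF order_refl] by (intro unit_leb.finite_measure_mono) auto
  define \<theta> where "\<theta> t = Inf {x \<in> {0..1}. F t \<le> G x}" for t
  have ne: "{x \<in> {0..1}. F t \<le> G x} \<noteq> {}" for t
    using F1[of t] by force
  have bdd: "bdd_below {x \<in> {0..1}. F t \<le> G x}" for t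
    by (auto intro!: bdd_belowI[of _ 0])
  have "closed {x \<in> {0..1}. F t \<le> G x}" for t
    unfolding Collect_conj_eq Collect_mem_eq
    by (intro closed_Int closed_Collect_le cont continuous_on_const) auto
  then have "\<theta> t \<in> {x \<in> {0..1}. F t \<le> G x}" for t
    unfolding \<theta>_def by (intro closed_contains_Inf bdd ne)
  then have \<theta>: "0 \<le> \<theta> t" "\<theta> t \<le> 1" "F t \<le> G (\<theta> t)" for t
    by auto
  \<comment> \<open>The Galois connection between a distribution function and its quantile function.
    It relies on the infimum being attained, hence on the continuity of \<open>G\<close>, which
    makes the set closed.\<close>
  have \<theta>_le_iff: "\<theta> t \<le> x \<longleftrightarrow> F t \<le> G x" if "0 \<le> x" "x \<le> 1" for t x
  proof
    assume "\<theta> t \<le> x" then show "F t \<le> G x"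
      using \<theta>(3)[of t] mono[of "\<theta> t" x] by linarith
  next
    assume "F t \<le> G x" then show "\<theta> t \<le> x"
      unfolding \<theta>_def using that by (intro cInf_lower bdd) auto
  qed
  have "mono \<theta>"
  proof (rule monoI)
    fix s t :: real assume "s \<le> t"
    then have "F s \<le> G (\<theta> t)"
      using Fmono \<theta>(3)[of t] order_trans by blast
    then show "\<theta> s \<le> \<theta> t"
      using \<theta>_le_iff \<theta> by blast
  qed
  then have meas: "\<theta> \<in> borel_measurable borel"
    by (rule borel_measurable_mono)
  have "measure unit_leb (A \<inter> \<theta> -` {..x}) = G x" for x
  proof -
    consider "x < 0" | "0 \<le> x" "x \<le> 1" | "1 < x" by linarith
    then show ?thesis
    proof cases
      case 1
      then have "A \<inter> \<theta> -` {..x} = {}"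
        using \<theta>(1) by (force simp: not_le dest: order_trans)
      then show ?thesis
        using G0[of x] 1 by simp
    next
      case 2
      then have "A \<inter> \<theta> -` {..x} = A \<inter> {t. F t \<le> G x}"
        using \<theta>_le_iff by auto
      moreover have "0 \<le> G x" "G x \<le> measure unit_leb A"
        using mono[of 0 x] mono[of x 1] G0[of 0] G1[of 1] 2 by auto
      ultimately show ?thesis
        using measure_atMost_level[OF A, of "G x"] by (simp add: F_def)
    next
      case 3
      then have "A \<inter> \<theta> -` {..x} = A"
        using \<theta>(2) by (auto dest: order_trans less_imp_le)
      then show ?thesis
        using G1[of x] 3 by simp
    qed
  qed
  with meas \<theta> show ?thesis
    by (intro that[of \<theta>]) auto
qed

lemma partition_measure_sum:
  assumes K: "finite K" and A: "\<And>i. i \<in> K \<Longrightarrow> A i \<in> sets borel" and "disjoint_family_on A K"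
    and cover: "AE x in unit_leb. x \<in> (\<Union>i\<in>K. A i)" and B: "B \<in> sets borel"
  shows "(\<Sum>i\<in>K. measure unit_leb (A i \<inter> B)) = measure unit_leb B"
proof -
  have "(\<Sum>i\<in>K. measure unit_leb (A i \<inter> B)) = measure unit_leb (\<Union>i\<in>K. A i \<inter> B)"
    using assms by (intro unit_leb.finite_measure_finite_Union[symmetric])
      (auto simp: disjoint_family_on_def)
  also have "\<dots> = measure unit_leb B"
    using assms
    by (intro unit_leb.finite_measure_eq_AE)
       (auto elim!: eventually_mono intro!: sets.finite_UN)
  finally show ?thesis .
qed

text \<open>Each piece is atomless and can therefore be given any prescribed law with a continuous
  distribution function and the right mass. Since the prescribed laws sum to Lebesgue measure, the
  map glued from the pieces preserves measure.\<close>

lemma quantile_transform_partition: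
  assumes K: "finite K" and A: "\<And>i. i \<in> K \<Longrightarrow> A i \<in> sets borel" and disj: "disjoint_family_on A K"
    and cover: "AE x in unit_leb. x \<in> (\<Union>i\<in>K. A i)"
    and mono: "\<And>i x y. i \<in> K \<Longrightarrow> x \<le> y \<Longrightarrow> G i x \<le> G i y"
    and cont: "\<And>i. i \<in> K \<Longrightarrow> continuous_on UNIV (G i)"
    and G0: "\<And>i x. i \<in> K \<Longrightarrow> x \<le> 0 \<Longrightarrow> G i x = 0"
    and G1: "\<And>i x. i \<in> K \<Longrightarrow> 1 \<le> x \<Longrightarrow> G i x = measure unit_leb (A i)"
    and sum: "\<And>x. (\<Sum>i\<in>K. G i x) = measure unit_leb {..x}"
  obtains \<theta> where "\<theta> \<in> mp_maps"
    and "\<And>i x. i \<in> K \<Longrightarrow> measure unit_leb (A i \<inter> \<theta> -` {..x}) = G i x"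
proof -
  have "\<exists>\<theta>. \<theta> \<in> borel_measurable borel \<and> (\<forall>x. measure unit_leb (A i \<inter> \<theta> -` {..x}) = G i x)"
    if "i \<in> K" for i
    by (rule quantile_transform[of "A i" "G i"]) (use that A mono cont G0 G1 in auto)
  then obtain \<theta>' where \<theta>': "\<And>i. i \<in> K \<Longrightarrow> \<theta>' i \<in> borel_measurable borel"
      "\<And>i x. i \<in> K \<Longrightarrow> measure unit_leb (A i \<inter> \<theta>' i -` {..x}) = G i x"
    by metis
  \<comment> \<open>Outside all the pieces, that is on a null set, the sum takes the default value
    0.\<close>
  define \<theta> where "\<theta> x = (\<Sum>i\<in>K. indicator (A i) x * \<theta>' i x)" for x
  have meas [measurable]: "\<theta> \<in> borel_measurable borel"
    unfolding \<theta>_def using A \<theta>'(1) by measurable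
  have \<theta>_eq: "\<theta> x = \<theta>' i x" if "x \<in> A i" "i \<in> K" for x i
  proof -
    have "\<theta> x = (\<Sum>j\<in>{i}. indicator (A j) x * \<theta>' j x)"
      unfolding \<theta>_def
      using that K disj by (intro sum.mono_neutral_right) (auto simp: disjoint_family_on_def indicator_def)
    then show ?thesis
      using that by simp
  qed
  then have "A i \<inter> \<theta> -` {..x} = A i \<inter> \<theta>' i -` {..x}" if "i \<in> K" for i x
    using that by auto
  then have eq: "measure unit_leb (A i \<inter> \<theta> -` {..x}) = G i x" if "i \<in> K" for i x
    using \<theta>'(2) that by simp
  have vim: "\<theta> -` {..x} \<in> sets borel" for x
    using measurable_sets[OF meas, of "{..x}"] by simp
  have "distr unit_leb borel \<theta> = unit_leb"
  proof (rule measure_eqI_atMost)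
    interpret D: prob_space "distr unit_leb borel \<theta>"
      by (rule unit_leb.prob_space_distr) measurable
    show "finite_measure (distr unit_leb borel \<theta>)"
      by (rule D.finite_measure_axioms)
    show "measure (distr unit_leb borel \<theta>) UNIV = measure unit_leb UNIV"
      using D.prob_space unit_leb.prob_space by simp
    fix x
    have "measure (distr unit_leb borel \<theta>) {..x} = measure unit_leb (\<theta> -` {..x})"
      by (subst measure_distr) auto
    also have "\<dots> = (\<Sum>i\<in>K. measure unit_leb (A i \<inter> \<theta> -` {..x}))"
      by (rule partition_measure_sum[symmetric]) (use assms vim in auto)
    also have "\<dots> = measure unit_leb {..x}"
      using eq sum by simp
    finally show "measure (distr unit_leb borel \<theta>) {..x} = measure unit_leb {..x}" .
  qed (auto intro: unit_leb.finite_measure_axioms)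
  then show ?thesis
    by (intro that[of \<theta>]) (use eq in \<open>auto simp: mp_maps_def\<close>)
qed

section \<open>Sequences of seminorms on an L1 space\<close>

text \<open>Domination by \<open>C\<close> times the L1 norm, uniformly in \<open>n\<close>, makes
  the set of functions with vanishing limit closed in L1: an e/2 argument.\<close>

lemma seminorm_tendsto_0_closed:
  fixes \<rho> :: "nat \<Rightarrow> ('a \<Rightarrow> real) \<Rightarrow> real"
  assumes nonneg: "\<And>n f. 0 \<le> \<rho> n f"
    and add: "\<And>n f g. integrable N f \<Longrightarrow> integrable N g \<Longrightarrow> \<rho> n (\<lambda>x. f x + g x) \<le> \<rho> n f + \<rho> n g"
    and bound: "\<And>n f. integrable N f \<Longrightarrow> \<rho> n f \<le> C * (\<integral>x. \<bar>f x\<bar> \<partial>N)"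
    and f: "integrable N f" and s: "\<And>i. integrable N (s i)" "\<And>i. (\<lambda>n. \<rho> n (s i)) \<longlonglongrightarrow> 0"
    and lim: "(\<lambda>i::nat. \<integral>x. \<bar>f x - s i x\<bar> \<partial>N) \<longlonglongrightarrow> 0"
  shows "(\<lambda>n. \<rho> n f) \<longlonglongrightarrow> 0"
proof (rule LIMSEQ_I)
  fix e :: real assume "0 < e"
  have "(\<lambda>i. C * (\<integral>x. \<bar>f x - s i x\<bar> \<partial>N)) \<longlonglongrightarrow> C * 0"
    by (intro tendsto_mult tendsto_const lim)
  then have "\<forall>\<^sub>F i in sequentially. C * (\<integral>x. \<bar>f x - s i x\<bar> \<partial>N) < e / 2"
    by (rule order_tendstoD) (use \<open>0 < e\<close> in auto)
  then obtain i where i: "C * (\<integral>x. \<bar>f x - s i x\<bar> \<partial>N) < e / 2"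
    by (auto simp: eventually_sequentially)
  have "\<forall>\<^sub>F n in sequentially. \<rho> n (s i) < e / 2"
    using s(2)[of i] by (rule order_tendstoD) (use \<open>0 < e\<close> in auto)
  then obtain n0 where n0: "\<And>n. n \<ge> n0 \<Longrightarrow> \<rho> n (s i) < e / 2"
    by (auto simp: eventually_sequentially)
  have "\<rho> n f < e" if "n \<ge> n0" for n
  proof -
    have "\<rho> n f = \<rho> n (\<lambda>x. (f x - s i x) + s i x)"
      by simp
    also have "\<dots> \<le> \<rho> n (\<lambda>x. f x - s i x) + \<rho> n (s i)"
      using f s by (intro add) auto
    also have "\<rho> n (\<lambda>x. f x - s i x) \<le> C * (\<integral>x. \<bar>f x - s i x\<bar> \<partial>N)"
      using f s by (intro bound) auto
    finally show ?thesis
      using i n0[OF that] by linarith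
  qed
  then show "\<exists>n0. \<forall>n\<ge>n0. norm (\<rho> n f - 0) < e"
    using nonneg by auto
qed

text \<open>Convergence on a generating \<pi>-system spreads to all measurable sets by Dynkin's
  argument and from there to L1 by density. Seminorms are used instead of linear functionals because
  one application is the L1 distance of two pullbacks and the other is the absolute value of a
  difference of functionals.\<close>

lemma seminorm_tendsto_0:
  fixes \<rho> :: "nat \<Rightarrow> ('a \<Rightarrow> real) \<Rightarrow> real"
  assumes "finite_measure N"
    and E: "Int_stable E" "E \<subseteq> Pow (space N)" "sets N = sigma_sets (space N) E" "space N \<in> E"
    and nonneg: "\<And>n f. 0 \<le> \<rho> n f"
    and add: "\<And>n f g. integrable N f \<Longrightarrow> integrable N g \<Longrightarrow> \<rho> n (\<lambda>x. f x + g x) \<le> \<rho> n f + \<rho> n g"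
    and scale: "\<And>n f c. integrable N f \<Longrightarrow> \<rho> n (\<lambda>x. c * f x) \<le> \<bar>c\<bar> * \<rho> n f"
    and bound: "\<And>n f. integrable N f \<Longrightarrow> \<rho> n f \<le> C * (\<integral>x. \<bar>f x\<bar> \<partial>N)"
    and basic: "\<And>A. A \<in> E \<Longrightarrow> (\<lambda>n. \<rho> n (indicator A)) \<longlonglongrightarrow> 0"
    and f: "integrable N f"
  shows "(\<lambda>n. \<rho> n f) \<longlonglongrightarrow> 0"
proof -
  interpret finite_measure N by fact
  have add_lim: "(\<lambda>n. \<rho> n (\<lambda>x. f x + g x)) \<longlonglongrightarrow> 0"
    if fg: "integrable N f" "integrable N g" "(\<lambda>n. \<rho> n f) \<longlonglongrightarrow> 0" "(\<lambda>n. \<rho> n g) \<longlonglongrightarrow> 0" for f g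
  proof (rule tendsto_sandwich[OF _ _ tendsto_const])
    show "(\<lambda>n. \<rho> n f + \<rho> n g) \<longlonglongrightarrow> 0"
      using tendsto_add[OF fg(3,4)] by simp
  qed (use nonneg add fg in auto)
  have scale_lim: "(\<lambda>n. \<rho> n (\<lambda>x. c * f x)) \<longlonglongrightarrow> 0"
    if "integrable N f" "(\<lambda>n. \<rho> n f) \<longlonglongrightarrow> 0" for f c
  proof (rule tendsto_sandwich[OF _ _ tendsto_const])
    show "(\<lambda>n. \<bar>c\<bar> * \<rho> n f) \<longlonglongrightarrow> 0"
      using tendsto_mult[OF tendsto_const that(2), of "\<bar>c\<bar>"] by simp
  qed (use nonneg scale that in auto)
  have ind: "integrable N (indicator A :: 'a \<Rightarrow> real)" if "A \<in> sets N" for A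
    using that by (simp add: emeasure_eq_measure)
  have sets_lim: "(\<lambda>n. \<rho> n (indicator A)) \<longlonglongrightarrow> 0" if A: "A \<in> sets N" for A
    using E(1,2) A[unfolded E(3)]
  proof (induction rule: sigma_sets_induct_disjoint)
    case (basic A)
    then show ?case by (rule assms)
  next
    case empty
    have "\<rho> n (indicator {}) = 0" for n
      using nonneg[of n "indicator {}"] bound[of "indicator {}" n] by simp
    then show ?case by (simp only: tendsto_const)
  next
    case (compl A)
    then have A: "A \<in> sets N" "space N \<in> sets N"
      by (simp_all add: E(3)[symmetric])
    have "(\<lambda>n. \<rho> n (\<lambda>x. indicator (space N) x + (-1) * indicator A x)) \<longlonglongrightarrow> 0"
      by (intro add_lim scale_lim compl ind A basic E integrable_mult_right)
    moreover have "(\<lambda>x. indicator (space N) x + (-1) * indicator A x :: real) = indicator (space N - A)"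
      using sets.sets_into_space[OF A(1)] by (auto simp: indicator_def fun_eq_iff)
    ultimately show ?case by simp
  next
    case (union A)
    then have A: "range A \<subseteq> sets N"
      by (simp add: E(3)[symmetric])
    have fin: "(\<lambda>n. \<rho> n (indicator (\<Union>j<i. A j))) \<longlonglongrightarrow> 0" for i
    proof (induction i)
      case 0
      have "\<rho> n (indicator {}) = 0" for n
        using nonneg[of n "indicator {}"] bound[of "indicator {}" n] by simp
      then show ?case by (simp only: tendsto_const lessThan_0 UN_empty)
    next
      case (Suc i)
      have "A i \<inter> (\<Union>j<i. A j) = {}"
      proof -
        have "A i \<inter> A j = {}" if "j < i" for j
          using disjoint_family_onD[OF union(1), of i j] that by simp
        then show ?thesis by blast
      qed
      then have "(indicator (\<Union>j<Suc i. A j) :: 'a \<Rightarrow> real)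
          = (\<lambda>x. indicator (A i) x + indicator (\<Union>j<i. A j) x)"
        by (auto simp: lessThan_Suc indicator_def fun_eq_iff)
      moreover have "(\<lambda>n. \<rho> n (\<lambda>x. indicator (A i) x + indicator (\<Union>j<i. A j) x)) \<longlonglongrightarrow> 0"
        using A by (intro add_lim union Suc ind) auto
      ultimately show ?case by simp
    qed
    have meas: "(\<Union>j<i. A j) \<in> sets N" "(\<Union>j. A j) \<in> sets N" for i
      using A by auto
    have "(\<lambda>i. \<integral>x. \<bar>indicator (\<Union>j. A j) x - indicator (\<Union>j<i. A j) x\<bar> \<partial>N) \<longlonglongrightarrow> (\<integral>x. (0::real) \<partial>N)"
    proof (rule integral_dominated_convergence[where w = "\<lambda>x. 1"])
      show "AE x in N. (\<lambda>i. \<bar>indicator (\<Union>j. A j) x - indicator (\<Union>j<i. A j) x\<bar>) \<longlonglongrightarrow> (0::real)"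
      proof (rule AE_I2)
        fix x
        have "(\<lambda>i. \<bar>indicator (\<Union>j. A j) x - indicator (\<Union>j<i. A j) x\<bar>)
            \<longlonglongrightarrow> \<bar>indicator (\<Union>j. A j) x - indicator (\<Union>j. A j) x :: real\<bar>"
          by (intro tendsto_intros LIMSEQ_indicator_UN)
        then show "(\<lambda>i. \<bar>indicator (\<Union>j. A j) x - indicator (\<Union>j<i. A j) x\<bar>) \<longlonglongrightarrow> (0::real)"
          by simp
      qed
      show "AE x in N. norm \<bar>indicator (\<Union>j. A j) x - indicator (\<Union>j<i. A j) x :: real\<bar> \<le> 1" for i
        by (intro AE_I2) (simp add: indicator_def)
    qed (use meas in measurable)
    then have *: "(\<lambda>i. \<integral>x. \<bar>indicator (\<Union>j. A j) x - indicator (\<Union>j<i. A j) x\<bar> \<partial>N) \<longlonglongrightarrow> (0::real)"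
      by simp
    show ?case
      by (rule seminorm_tendsto_0_closed[where \<rho> = \<rho> and C = C and s = "\<lambda>i. indicator (\<Union>j<i. A j)",
            OF nonneg add bound ind[OF meas(2)] ind[OF meas(1)] fin *])
  qed
  show ?thesis
    using f
  proof (induct rule: integrable_induct)
    case (base A c)
    have "(\<lambda>n. \<rho> n (\<lambda>x. c * indicator A x)) \<longlonglongrightarrow> 0"
      using base by (intro scale_lim sets_lim ind)
    then show ?case
      by (simp add: mult.commute)
  next
    case (add f g)
    then show ?case by (intro add_lim)
  next
    case (lim f s)
    have "(\<lambda>i. \<integral>x. \<bar>f x - s i x\<bar> \<partial>N) \<longlonglongrightarrow> (\<integral>x. 0 \<partial>N)"
    \<comment> \<open>The approximating functions of \<open>integrable_induct\<close> are bounded by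
      twice \<open>\<bar>f x\<bar>\<close>; the third copy comes from \<open>f\<close>
      itself.\<close>
    proof (rule integral_dominated_convergence[where w = "\<lambda>x. 3 * \<bar>f x\<bar>"])
      show "AE x in N. (\<lambda>i. \<bar>f x - s i x\<bar>) \<longlonglongrightarrow> 0"
      proof (rule AE_I2)
        fix x assume "x \<in> space N"
        then have "(\<lambda>i. \<bar>f x - s i x\<bar>) \<longlonglongrightarrow> \<bar>f x - f x\<bar>"
          by (intro tendsto_intros lim(3))
        then show "(\<lambda>i. \<bar>f x - s i x\<bar>) \<longlonglongrightarrow> 0" by simp
      qed
      show "AE x in N. norm \<bar>f x - s i x\<bar> \<le> 3 * \<bar>f x\<bar>" for i
        using lim(4)[of _ i] by (intro AE_I2) fastforce
    qed (use lim(1,5) in auto)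
    then have *: "(\<lambda>i. \<integral>x. \<bar>f x - s i x\<bar> \<partial>N) \<longlonglongrightarrow> 0"
      by simp
    show ?case
      by (rule seminorm_tendsto_0_closed[where \<rho> = \<rho> and C = C and s = s,
            OF nonneg assms(7) bound lim(5) lim(1) lim(2) *])
  qed
qed

definition quadrants :: "(real \<times> real) set set" where
  "quadrants = {A \<times> B | A B. A \<in> insert UNIV (range atMost) \<and> B \<in> insert UNIV (range atMost)}"

lemma quadrants_generate:
  "Int_stable quadrants" "quadrants \<subseteq> Pow (space unit_leb2)"
  "sets unit_leb2 = sigma_sets (space unit_leb2) quadrants" "space unit_leb2 \<in> quadrants"
proof -
  have Int: "A \<inter> B \<in> insert UNIV (range atMost)"
    if "A \<in> insert UNIV (range atMost)" "B \<in> insert UNIV (range atMost)" for A B :: "real set"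
    using that by auto
  show "Int_stable quadrants"
  proof (rule Int_stableI)
    fix R S assume "R \<in> quadrants" "S \<in> quadrants"
    then obtain A B C D where *: "R = A \<times> B" "S = C \<times> D"
        "A \<in> insert UNIV (range atMost)" "B \<in> insert UNIV (range atMost)"
        "C \<in> insert UNIV (range atMost)" "D \<in> insert UNIV (range atMost)"
      unfolding quadrants_def by blast
    then have "R \<inter> S = (A \<inter> C) \<times> (B \<inter> D)"
      by auto
    then show "R \<inter> S \<in> quadrants"
      unfolding quadrants_def using Int[OF *(3,5)] Int[OF *(4,6)] by blast
  qed
  show "quadrants \<subseteq> Pow (space unit_leb2)" by auto
  show "space unit_leb2 \<in> quadrants"
    unfolding quadrants_def by (auto intro!: exI[of _ UNIV])
  let ?E = "insert UNIV (range atMost) :: real set set"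
  have "sigma_sets UNIV (range atMost) = sigma_sets UNIV ?E"
    by (intro sigma_sets_eqI) (auto intro: sigma_sets_top)
  then have gen: "sets unit_leb = sigma_sets (space unit_leb) ?E"
    by (simp add: borel_eq_atMost)
  have "sets unit_leb2 = sets (sigma (space unit_leb \<times> space unit_leb) {a \<times> b | a b. a \<in> ?E \<and> b \<in> ?E})"
    by (rule sets_pair_eq[where Ca = "{UNIV}" and Cb = "{UNIV}"]) (use gen in auto)
  also have "{a \<times> b | a b. a \<in> ?E \<and> b \<in> ?E} = quadrants"
    by (simp add: quadrants_def)
  finally show "sets unit_leb2 = sigma_sets (space unit_leb2) quadrants"
    by simp
qed

lemmas seminorm_tendsto_0_square =
  seminorm_tendsto_0[OF unit_leb2.P.finite_measure_axioms quadrants_generate]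

section \<open>The cut norm for Borel kernels\<close>

declare sets_unit_leb2 [measurable_cong]

text \<open>Borel stand-ins for graphons. The bounds hold everywhere, which spares exceptional sets
  in integrability arguments; a Borel version of a graphon may be symmetric only almost
  everywhere.\<close>

definition kernels :: "(real \<times> real \<Rightarrow> real) set" where
  "kernels = {U \<in> borel_measurable borel. \<forall>z. U z \<in> {0..1}}"

lemma kernels_measurable [measurable_dest]: "U \<in> kernels \<Longrightarrow> U \<in> borel_measurable borel"
  by (simp add: kernels_def)

lemma kernelsD: "U \<in> kernels \<Longrightarrow> 0 \<le> U z \<and> U z \<le> 1"
  by (cases z) (simp add: kernels_def)

lemma measurable_pair_map:
  fixes \<phi> \<psi> :: "real \<Rightarrow> real"
  assumes [measurable]: "\<phi> \<in> borel_measurable borel" "\<psi> \<in> borel_measurable borel"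
  shows "(\<lambda>z. (\<phi> (fst z), \<psi> (snd z))) \<in> borel_measurable borel"
  unfolding borel_prod[symmetric] by measurable

lemma pullback_eq: "pullback U \<phi> = (\<lambda>z. U (\<phi> (fst z), \<phi> (snd z)))"
  by (simp add: pullback_def case_prod_beta fun_eq_iff)

lemma pullback_measurable:
  fixes f :: "real \<times> real \<Rightarrow> 'b::topological_space"
  assumes "f \<in> borel_measurable borel" and "(\<phi> :: real \<Rightarrow> real) \<in> borel_measurable borel"
  shows "(\<lambda>z. f (\<phi> (fst z), \<phi> (snd z))) \<in> borel_measurable borel"
  using measurable_compose[OF measurable_pair_map[OF assms(2,2)] assms(1)] .

lemma pullback_kernels:
  assumes "U \<in> kernels" "\<phi> \<in> mp_maps"
  shows "pullback U \<phi> \<in> kernels"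
  using assms pullback_measurable[of U \<phi>] by (auto simp: kernels_def pullback_eq mp_maps_def)

lemma integrable_unit_leb2:
  fixes f :: "real \<times> real \<Rightarrow> real"
  assumes "f \<in> borel_measurable borel" "\<And>z. \<bar>f z\<bar> \<le> B"
  shows "integrable unit_leb2 f"
proof (rule unit_leb2.P.integrable_const_bound)
  show "f \<in> borel_measurable unit_leb2"
    using assms(1) measurable_cong_sets[OF sets_unit_leb2 refl] by blast
  show "AE x in unit_leb2. norm (f x) \<le> B"
    using assms by simp
qed

lemma borel_Times:
  fixes A B :: "real set"
  assumes "A \<in> sets borel" "B \<in> sets borel"
  shows "A \<times> B \<in> sets borel"
  using pair_measureI[OF assms] unfolding borel_prod .

lemma measure_unit_leb2_Times:
  assumes "C \<in> sets borel" "D \<in> sets borel"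
  shows "measure unit_leb2 (C \<times> D) = measure unit_leb C * measure unit_leb D"
  using unit_leb.emeasure_pair_measure_Times[of C unit_leb D] assms
  by (simp add: unit_leb2.P.emeasure_eq_measure unit_leb.emeasure_eq_measure flip: ennreal_mult)

lemma integrable_rect:
  assumes "U \<in> kernels" "V \<in> kernels" "A \<in> sets borel" "B \<in> sets borel"
  shows "integrable unit_leb2 (\<lambda>z. indicator (A \<times> B) z * (U z - V z))"
proof (rule integrable_unit_leb2[where B = 1])
  have [measurable]: "U \<in> borel_measurable borel" "V \<in> borel_measurable borel" "A \<times> B \<in> sets borel"
    using assms by (auto simp: kernels_def borel_Times)
  show "(\<lambda>z. indicator (A \<times> B) z * (U z - V z)) \<in> borel_measurable borel"
    by measurable
  show "\<bar>indicator (A \<times> B) z * (U z - V z)\<bar> \<le> 1" for z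
    using kernelsD[OF assms(1), of z] kernelsD[OF assms(2), of z] by (auto simp: indicator_def)
qed

lemma integrable_kernel_diff:
  assumes "U \<in> kernels" "V \<in> kernels"
  shows "integrable unit_leb2 (\<lambda>z. \<bar>U z - V z\<bar>)"
  using integrable_abs[OF integrable_rect[OF assms, of UNIV UNIV]] by simp

definition borel_cut_metric :: "(real \<times> real \<Rightarrow> real) \<Rightarrow> (real \<times> real \<Rightarrow> real) \<Rightarrow> real" where
  "borel_cut_metric U V =
     (SUP (A, B) \<in> sets borel \<times> sets borel. \<bar>\<integral>z. indicator (A \<times> B) z * (U z - V z) \<partial>unit_leb2\<bar>)"

lemma rect_le_L1:
  assumes "U \<in> kernels" "V \<in> kernels" "A \<in> sets borel" "B \<in> sets borel"
  shows "\<bar>\<integral>z. indicator (A \<times> B) z * (U z - V z) \<partial>unit_leb2\<bar> \<le> (\<integral>z. \<bar>U z - V z\<bar> \<partial>unit_leb2)"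
proof -
  have "\<bar>\<integral>z. indicator (A \<times> B) z * (U z - V z) \<partial>unit_leb2\<bar>
      \<le> (\<integral>z. \<bar>indicator (A \<times> B) z * (U z - V z)\<bar> \<partial>unit_leb2)"
    using integral_abs_bound by blast
  also have "\<dots> \<le> (\<integral>z. \<bar>U z - V z\<bar> \<partial>unit_leb2)"
    by (intro integral_mono integrable_abs integrable_rect integrable_kernel_diff assms)
       (auto simp: indicator_def)
  finally show ?thesis .
qed

lemma rect_le_borel_cut_metric:
  assumes "U \<in> kernels" "V \<in> kernels" "A \<in> sets borel" "B \<in> sets borel"
  shows "\<bar>\<integral>z. indicator (A \<times> B) z * (U z - V z) \<partial>unit_leb2\<bar> \<le> borel_cut_metric U V"
  unfolding borel_cut_metric_def
proof (rule cSUP_upper2[where x = "(A, B)"])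
  show "bdd_above ((\<lambda>(A, B). \<bar>\<integral>z. indicator (A \<times> B) z * (U z - V z) \<partial>unit_leb2\<bar>)
      ` (sets borel \<times> sets borel))"
    using rect_le_L1[OF assms(1,2)] by (auto intro!: bdd_aboveI)
qed (use assms in auto)

lemma borel_cut_metric_least:
  assumes "\<And>A B. A \<in> sets borel \<Longrightarrow> B \<in> sets borel
    \<Longrightarrow> \<bar>\<integral>z. indicator (A \<times> B) z * (U z - V z) \<partial>unit_leb2\<bar> \<le> c"
  shows "borel_cut_metric U V \<le> c"
  unfolding borel_cut_metric_def using assms by (intro cSUP_least) auto

lemma borel_cut_metric_nonneg:
  assumes "U \<in> kernels" "V \<in> kernels"
  shows "0 \<le> borel_cut_metric U V"
  using rect_le_borel_cut_metric[OF assms, of "{}" "{}"] by simp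

lemma borel_cut_metric_commute: "borel_cut_metric U V = borel_cut_metric V U"
proof -
  have "\<bar>\<integral>z. indicator (A \<times> B) z * (U z - V z) \<partial>unit_leb2\<bar>
      = \<bar>\<integral>z. indicator (A \<times> B) z * (V z - U z) \<partial>unit_leb2\<bar>" for A B
  proof -
    have "(\<integral>z. indicator (A \<times> B) z * (U z - V z) \<partial>unit_leb2)
        = (\<integral>z. - (indicator (A \<times> B) z * (V z - U z)) \<partial>unit_leb2)"
      by (intro Bochner_Integration.integral_cong) (auto simp: algebra_simps)
    then show ?thesis by simp
  qed
  then show ?thesis
    by (simp add: borel_cut_metric_def)
qed

lemma borel_cut_metric_triangle:
  assumes "U \<in> kernels" "V \<in> kernels" "W \<in> kernels"
  shows "borel_cut_metric U W \<le> borel_cut_metric U V + borel_cut_metric V W"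
proof (rule borel_cut_metric_least)
  fix A B :: "real set" assume AB: "A \<in> sets borel" "B \<in> sets borel"
  let ?I = "\<lambda>U V. \<integral>z. indicator (A \<times> B) z * (U z - V z) \<partial>unit_leb2"
  have "?I U W = (\<integral>z. indicator (A \<times> B) z * (U z - V z) + indicator (A \<times> B) z * (V z - W z) \<partial>unit_leb2)"
    by (intro Bochner_Integration.integral_cong) (auto simp: algebra_simps)
  also have "\<dots> = ?I U V + ?I V W"
    using assms AB by (intro Bochner_Integration.integral_add integrable_rect)
  finally show "\<bar>?I U W\<bar> \<le> borel_cut_metric U V + borel_cut_metric V W"
    using rect_le_borel_cut_metric[OF assms(1,2) AB] rect_le_borel_cut_metric[OF assms(2,3) AB]
    by linarith
qed

lemma borel_cut_metric_le_L1:
  assumes "U \<in> kernels" "V \<in> kernels"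
  shows "borel_cut_metric U V \<le> (\<integral>z. \<bar>U z - V z\<bar> \<partial>unit_leb2)"
  using rect_le_L1[OF assms] by (intro borel_cut_metric_least)

text \<open>
  With \<open>k\<close> the integral of \<open>E\<close> over the second variable, the left-hand side is at most
  \<open>\<integral>max 0 (k \<circ> \<tau>) = \<integral>max 0 k\<close>, so \<open>A' = {x. 0 < k x}\<close> works. No conditional expectation given
  \<open>\<tau>\<close> is needed.
\<close>

lemma rect_pullback_le_step:
  fixes E :: "real \<Rightarrow> real \<Rightarrow> real"
  assumes \<tau>: "\<tau> \<in> mp_maps" and A [measurable]: "A \<in> sets borel"
    and E [measurable]: "case_prod E \<in> borel_measurable (borel \<Otimes>\<^sub>M borel)" and bound: "\<And>x y. \<bar>E x y\<bar> \<le> 1"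
  obtains A' where "A' \<in> sets borel"
    "(\<integral>x. indicator A x * (\<integral>y. E (\<tau> x) y \<partial>unit_leb) \<partial>unit_leb)
      \<le> (\<integral>x. indicator A' x * (\<integral>y. E x y \<partial>unit_leb) \<partial>unit_leb)"
proof -
  define k where "k x = (\<integral>y. E x y \<partial>unit_leb)" for x
  have [measurable]: "k \<in> borel_measurable borel"
    unfolding k_def by measurable
  have [measurable]: "\<tau> \<in> borel_measurable borel"
    using \<tau> by (auto simp: mp_maps_def)
  have "integrable unit_leb (\<lambda>y. E x y)" for x
    using bound by (intro unit_leb.integrable_const_bound[where B = 1]) auto
  then have "\<bar>k x\<bar> \<le> (\<integral>y. 1 \<partial>unit_leb)" for x
    unfolding k_def using bound by (intro integral_abs_bound[THEN order_trans] integral_mono) auto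
  then have k_bound: "\<bar>k x\<bar> \<le> 1" for x
    using unit_leb.prob_space by simp
  have int: "integrable unit_leb f" if "f \<in> borel_measurable borel" "\<And>x. \<bar>f x\<bar> \<le> 1" for f :: "real \<Rightarrow> real"
    using that by (intro unit_leb.integrable_const_bound[where B = 1]) auto
  have "(\<integral>x. indicator A x * k (\<tau> x) \<partial>unit_leb) \<le> (\<integral>x. max 0 (k (\<tau> x)) \<partial>unit_leb)"
  proof (intro integral_mono int)
    show "\<bar>indicator A x * k (\<tau> x)\<bar> \<le> 1" "\<bar>max 0 (k (\<tau> x))\<bar> \<le> 1" for x
      using k_bound[of "\<tau> x"] by (auto simp: indicator_def)
  qed (auto simp: indicator_def)
  also have "\<dots> = (\<integral>x. max 0 (k x) \<partial>distr unit_leb unit_leb \<tau>)"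
    by (intro integral_distr[symmetric]) auto
  also have "\<dots> = (\<integral>x. indicator {x. 0 < k x} x * k x \<partial>unit_leb)"
    unfolding distr_mp_maps[OF \<tau>] by (intro Bochner_Integration.integral_cong) (auto simp: indicator_def)
  finally show ?thesis
    by (intro that[of "{x. 0 < k x}"]) (auto simp: k_def)
qed

text \<open>Both orders of integration are recorded because \<open>rect_pullback_le\<close> treats
  the two coordinates in turn, each as the outer variable.\<close>

lemma rect_integral_iterated:
  assumes "U \<in> kernels" "V \<in> kernels" "A \<in> sets borel" "B \<in> sets borel"
  shows "(\<integral>z. indicator (A \<times> B) z * (U z - V z) \<partial>unit_leb2)
    = (\<integral>x. indicator A x * (\<integral>y. indicator B y * (U (x, y) - V (x, y)) \<partial>unit_leb) \<partial>unit_leb)"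
    and "(\<integral>z. indicator (A \<times> B) z * (U z - V z) \<partial>unit_leb2)
    = (\<integral>y. indicator B y * (\<integral>x. indicator A x * (U (x, y) - V (x, y)) \<partial>unit_leb) \<partial>unit_leb)"
proof -
  have *: "indicator (A \<times> B) (x, y) = (indicator A x * indicator B y :: real)" for x y
    by (simp add: indicator_def)
  show "(\<integral>z. indicator (A \<times> B) z * (U z - V z) \<partial>unit_leb2)
    = (\<integral>x. indicator A x * (\<integral>y. indicator B y * (U (x, y) - V (x, y)) \<partial>unit_leb) \<partial>unit_leb)"
    using unit_leb2.integral_fst'[OF integrable_rect[OF assms], symmetric] by (simp add: * mult.assoc)
  show "(\<integral>z. indicator (A \<times> B) z * (U z - V z) \<partial>unit_leb2)
    = (\<integral>y. indicator B y * (\<integral>x. indicator A x * (U (x, y) - V (x, y)) \<partial>unit_leb) \<partial>unit_leb)"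
  proof -
    have eq: "(\<lambda>z. indicator (A \<times> B) z * (U z - V z))
        = (\<lambda>(x, y). indicator B y * (indicator A x * (U (x, y) - V (x, y))))"
      by (auto simp: indicator_def fun_eq_iff)
    have "integrable unit_leb2 (\<lambda>(x, y). indicator B y * (indicator A x * (U (x, y) - V (x, y))))"
      using integrable_rect[OF assms] unfolding eq .
    from unit_leb2.integral_snd[OF this] show ?thesis
      unfolding eq by simp
  qed
qed

text \<open>The sides \<open>A\<close> and \<open>B\<close> need not be preimages under \<tau>, so a
  change of variables is not enough. The coordinates are treated one at a time by
  \<open>rect_pullback_le_step\<close>: first \<tau> is removed from x while \<open>A\<close>
  becomes \<open>A'\<close>, then, after exchanging the integrals, from y while \<open>B\<close>
  becomes \<open>B'\<close>.\<close>

lemma rect_pullback_le: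
  assumes U: "U \<in> kernels" and V: "V \<in> kernels" and \<tau>: "\<tau> \<in> mp_maps"
    and A: "A \<in> sets borel" and B: "B \<in> sets borel"
  shows "(\<integral>z. indicator (A \<times> B) z * (pullback U \<tau> z - pullback V \<tau> z) \<partial>unit_leb2) \<le> borel_cut_metric U V"
proof -
  note [measurable] = A B
  have [measurable]: "U \<in> borel_measurable (borel \<Otimes>\<^sub>M borel)" "V \<in> borel_measurable (borel \<Otimes>\<^sub>M borel)"
      "\<tau> \<in> borel_measurable borel"
    using U V \<tau> by (auto simp: mp_maps_def kernels_def borel_prod)
  have D: "\<bar>U z - V z\<bar> \<le> 1" for z
    using kernelsD[OF U, of z] kernelsD[OF V, of z] by auto
  obtain A' where A' [measurable]: "A' \<in> sets borel" and
    le1: "(\<integral>x. indicator A x * (\<integral>y. indicator B y * (U (\<tau> x, \<tau> y) - V (\<tau> x, \<tau> y)) \<partial>unit_leb) \<partial>unit_leb)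
      \<le> (\<integral>x. indicator A' x * (\<integral>y. indicator B y * (U (x, \<tau> y) - V (x, \<tau> y)) \<partial>unit_leb) \<partial>unit_leb)"
  proof (rule rect_pullback_le_step[OF \<tau> A, of "\<lambda>x y. indicator B y * (U (x, \<tau> y) - V (x, \<tau> y))"])
    show "\<bar>indicator B y * (U (x, \<tau> y) - V (x, \<tau> y))\<bar> \<le> 1" for x y
      using D by (simp add: indicator_def)
    show "(\<lambda>(x, y). indicator B y * (U (x, \<tau> y) - V (x, \<tau> y))) \<in> borel_measurable (borel \<Otimes>\<^sub>M borel)"
      by measurable
  qed
  have int: "integrable unit_leb2 (\<lambda>(x, y). indicator A' x * (indicator B y * (U (x, \<tau> y) - V (x, \<tau> y))))"
  proof (rule integrable_unit_leb2[where B = 1])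
    show "(\<lambda>(x, y). indicator A' x * (indicator B y * (U (x, \<tau> y) - V (x, \<tau> y)))) \<in> borel_measurable borel"
      unfolding borel_prod[symmetric] by measurable
    show "\<bar>case z of (x, y) \<Rightarrow> indicator A' x * (indicator B y * (U (x, \<tau> y) - V (x, \<tau> y)))\<bar> \<le> 1" for z
      using D by (auto simp: indicator_def split: prod.split)
  qed
  have "(\<integral>x. indicator A' x * (\<integral>y. indicator B y * (U (x, \<tau> y) - V (x, \<tau> y)) \<partial>unit_leb) \<partial>unit_leb)
      = (\<integral>x. \<integral>y. indicator A' x * (indicator B y * (U (x, \<tau> y) - V (x, \<tau> y))) \<partial>unit_leb \<partial>unit_leb)"
    by (subst integral_mult_right_zero) (rule refl)
  also have "\<dots> = (\<integral>y. \<integral>x. indicator A' x * (indicator B y * (U (x, \<tau> y) - V (x, \<tau> y))) \<partial>unit_leb \<partial>unit_leb)"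
    by (rule unit_leb2.Fubini_integral[OF int, symmetric])
  also have "\<dots> = (\<integral>y. \<integral>x. indicator B y * (indicator A' x * (U (x, \<tau> y) - V (x, \<tau> y))) \<partial>unit_leb \<partial>unit_leb)"
    by (subst mult.left_commute) (rule refl)
  also have "\<dots> = (\<integral>y. indicator B y * (\<integral>x. indicator A' x * (U (x, \<tau> y) - V (x, \<tau> y)) \<partial>unit_leb) \<partial>unit_leb)"
    by (subst integral_mult_right_zero) (rule refl)
  finally have swap: "(\<integral>x. indicator A' x * (\<integral>y. indicator B y * (U (x, \<tau> y) - V (x, \<tau> y)) \<partial>unit_leb) \<partial>unit_leb)
      = (\<integral>y. indicator B y * (\<integral>x. indicator A' x * (U (x, \<tau> y) - V (x, \<tau> y)) \<partial>unit_leb) \<partial>unit_leb)" .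
  obtain B' where B': "B' \<in> sets borel" and
    le2: "(\<integral>y. indicator B y * (\<integral>x. indicator A' x * (U (x, \<tau> y) - V (x, \<tau> y)) \<partial>unit_leb) \<partial>unit_leb)
      \<le> (\<integral>y. indicator B' y * (\<integral>x. indicator A' x * (U (x, y) - V (x, y)) \<partial>unit_leb) \<partial>unit_leb)"
  proof (rule rect_pullback_le_step[OF \<tau> B, of "\<lambda>y x. indicator A' x * (U (x, y) - V (x, y))"])
    show "\<bar>indicator A' x * (U (x, y) - V (x, y))\<bar> \<le> 1" for x y
      using D by (simp add: indicator_def)
    show "(\<lambda>(y, x). indicator A' x * (U (x, y) - V (x, y))) \<in> borel_measurable (borel \<Otimes>\<^sub>M borel)"
      by measurable
  qed
  have "(\<integral>z. indicator (A \<times> B) z * (pullback U \<tau> z - pullback V \<tau> z) \<partial>unit_leb2)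
    = (\<integral>x. indicator A x * (\<integral>y. indicator B y * (U (\<tau> x, \<tau> y) - V (\<tau> x, \<tau> y)) \<partial>unit_leb) \<partial>unit_leb)"
    using rect_integral_iterated(1)[OF pullback_kernels[OF U \<tau>] pullback_kernels[OF V \<tau>] A B]
    by (simp add: pullback_def)
  also have "\<dots> \<le> (\<integral>z. indicator (A' \<times> B') z * (U z - V z) \<partial>unit_leb2)"
    using le1 le2 swap rect_integral_iterated(2)[OF U V A' B'] by simp
  also have "\<dots> \<le> borel_cut_metric U V"
    using rect_le_borel_cut_metric[OF U V A' B'] by simp
  finally show ?thesis .
qed

lemma borel_cut_metric_pullback_le:
  assumes "U \<in> kernels" "V \<in> kernels" "\<tau> \<in> mp_maps"
  shows "borel_cut_metric (pullback U \<tau>) (pullback V \<tau>) \<le> borel_cut_metric U V"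
proof (rule borel_cut_metric_least)
  fix A B :: "real set" assume AB: "A \<in> sets borel" "B \<in> sets borel"
  have "(\<integral>z. indicator (A \<times> B) z * (pullback V \<tau> z - pullback U \<tau> z) \<partial>unit_leb2)
      = (\<integral>z. - (indicator (A \<times> B) z * (pullback U \<tau> z - pullback V \<tau> z)) \<partial>unit_leb2)"
    by (intro Bochner_Integration.integral_cong) (auto simp: algebra_simps)
  then show "\<bar>\<integral>z. indicator (A \<times> B) z * (pullback U \<tau> z - pullback V \<tau> z) \<partial>unit_leb2\<bar> \<le> borel_cut_metric U V"
    using rect_pullback_le[OF assms AB] rect_pullback_le[OF assms(2,1,3) AB]
    by (simp add: borel_cut_metric_commute[of V U])
qed

section \<open>Approximate lifting of one measure-preserving map through another\<close>

lemma vimage_borel: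
  fixes \<phi> :: "real \<Rightarrow> real"
  assumes "\<phi> \<in> borel_measurable borel" "S \<in> sets borel"
  shows "\<phi> -` S \<in> sets borel"
  using measurable_sets[OF assms] by simp

text \<open>A finite law on the line is determined by its distribution function and total mass. In
  this form the prescribed distribution functions on the pieces of a partition also control sets
  that are not rays.\<close>

lemma restricted_law_eq:
  fixes \<tau> :: "real \<Rightarrow> real"
  assumes A [measurable]: "A \<in> sets borel" and B [measurable]: "B \<in> sets borel"
    and \<tau> [measurable]: "\<tau> \<in> borel_measurable borel"
    and total: "measure unit_leb A = measure unit_leb B"
    and eq: "\<And>x. measure unit_leb (A \<inter> \<tau> -` {..x}) = measure unit_leb (B \<inter> {..x})"
    and P: "P \<in> sets borel"
  shows "measure unit_leb (A \<inter> \<tau> -` P) = measure unit_leb (B \<inter> P)"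
proof -
  let ?M = "density unit_leb (indicator A)" and ?N = "density unit_leb (indicator B)"
  have fin: "finite_measure ?M" "finite_measure ?N"
    by (auto intro!: unit_leb.finite_measure_restricted)
  have M: "measure (distr ?M borel \<tau>) S = measure unit_leb (A \<inter> \<tau> -` S)" if "S \<in> sets borel" for S
    using that vimage_borel[OF \<tau> that]
    by (subst measure_distr) (auto simp: measure_restricted)
  have N: "measure ?N S = measure unit_leb (B \<inter> S)" if "S \<in> sets borel" for S
    using that by (simp add: measure_restricted)
  have "distr ?M borel \<tau> = ?N"
  proof (rule measure_eqI_atMost)
    show "finite_measure (distr ?M borel \<tau>)"
      by (rule finite_measure.finite_measure_distr[OF fin(1)]) measurable
  qed (use M N total eq fin(2) in auto)
  then show ?thesis
    using M[OF P] N[OF P] by simp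
qed

text \<open>
  An approximate fibre product: \<open>\<tau>\<close> carries each level set of \<open>\<lfloor>m * \<psi>\<rfloor>\<close> onto the
  corresponding level set of \<open>\<lfloor>m * \<phi>\<rfloor>\<close>.
\<close>

lemma approximate_lift:
  assumes \<phi>: "\<phi> \<in> mp_maps" and \<psi>: "\<psi> \<in> mp_maps" and m: "0 < (m::nat)"
  obtains \<tau> where "\<tau> \<in> mp_maps" "AE x in unit_leb. \<bar>\<phi> (\<tau> x) - \<psi> x\<bar> \<le> 1 / m"
proof -
  define D where "D a = {real a / m ..< (real a + 1) / m}" for a :: nat
  define A where "A a = \<psi> -` D a" for a
  define B where "B a = \<phi> -` D a" for a
  have [measurable]: "\<phi> \<in> borel_measurable borel" "\<psi> \<in> borel_measurable borel"
    using assms by (auto simp: mp_maps_def)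
  have D_borel [measurable]: "D a \<in> sets borel" for a
    by (simp add: D_def)
  have AB [measurable]: "A a \<in> sets borel" "B a \<in> sets borel" for a
    by (auto simp: A_def B_def intro!: vimage_borel)
  have D_iff: "y \<in> D a \<longleftrightarrow> \<lfloor>y * m\<rfloor> = int a" for y a
    using m by (auto simp: D_def floor_eq_iff field_simps)
  \<comment> \<open>There are m + 1 cells: the point y = 1 has floor m, so the last index is needed
    to cover the closed interval.\<close>
  have disj: "disjoint_family_on A {0..m}" "disjoint_family_on B {0..m}"
    by (auto simp: disjoint_family_on_def A_def B_def D_iff)
  have D_cover: "y \<in> (\<Union>a\<in>{0..m}. D a)" if "y \<in> {0..1}" for y
  proof -
    have "0 \<le> y * m" "y * m \<le> m"
      using that m by (auto simp: mult_le_cancel_right1)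
    then have "0 \<le> \<lfloor>y * m\<rfloor>" "\<lfloor>y * m\<rfloor> \<le> int m"
      by (auto simp: floor_le_iff)
    then show ?thesis
      by (intro UN_I[of "nat \<lfloor>y * m\<rfloor>"]) (auto simp: D_iff)
  qed
  have coverA: "AE x in unit_leb. x \<in> (\<Union>a\<in>{0..m}. A a)"
    using AE_mp_maps[OF \<psi> AE_unit_leb_in] by eventually_elim (use D_cover in \<open>auto simp: A_def\<close>)
  have coverB: "AE x in unit_leb. x \<in> (\<Union>a\<in>{0..m}. B a)"
    using AE_mp_maps[OF \<phi> AE_unit_leb_in] by eventually_elim (use D_cover in \<open>auto simp: B_def\<close>)
  have same: "measure unit_leb (A a) = measure unit_leb (B a)" for a
    using measure_mp_maps[OF \<phi>, of "D a"] measure_mp_maps[OF \<psi>, of "D a"] by (simp add: A_def B_def)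
  obtain \<tau> where \<tau>: "\<tau> \<in> mp_maps"
    and eq: "\<And>a x. a \<in> {0..m} \<Longrightarrow> measure unit_leb (A a \<inter> \<tau> -` {..x}) = measure unit_leb (B a \<inter> {..x})"
  proof (rule quantile_transform_partition[of "{0..m}" A "\<lambda>a x. measure unit_leb (B a \<inter> {..x})"])
    fix a and x y :: real
    note L = measure_Int_atMost_lipschitz[OF AB(2) id_mp_maps, of _ _ a]
    show "measure unit_leb (B a \<inter> {..x}) \<le> measure unit_leb (B a \<inter> {..y})" if "x \<le> y"
      using L(1)[OF that] by simp
    show "continuous_on UNIV (\<lambda>x. measure unit_leb (B a \<inter> {..x}))"
      using L by (intro continuous_on_lipschitz_mono) simp_all
    show "measure unit_leb (B a \<inter> {..x}) = 0" if "x \<le> 0"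
    proof -
      have "measure unit_leb (B a \<inter> {..x}) \<le> measure unit_leb {..x}"
        by (intro unit_leb.finite_measure_mono) auto
      then show ?thesis
        using that by (simp add: measure_unit_leb_atMost measure_le_0_iff)
    qed
    show "measure unit_leb (B a \<inter> {..x}) = measure unit_leb (A a)" if "1 \<le> x"
      unfolding same
      using that by (intro unit_leb.finite_measure_eq_AE eventually_mono[OF AE_unit_leb_in]) auto
    show "(\<Sum>a\<in>{0..m}. measure unit_leb (B a \<inter> {..x})) = measure unit_leb {..x}"
      using coverB disj by (intro partition_measure_sum) auto
  qed (use disj coverA in auto)
  have [measurable]: "\<tau> \<in> borel_measurable borel"
    using \<tau> by (auto simp: mp_maps_def)
  \<comment> \<open>The law of \<tau> on \<open>A a\<close> is Lebesgue measure restricted to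
    \<open>B a\<close>; evaluated on the complement of \<open>B a\<close> it vanishes, so almost
    every point of \<open>A a\<close> is sent into \<open>B a\<close>.\<close>
  have AE_in: "AE x in unit_leb. x \<in> A a \<longrightarrow> \<phi> (\<tau> x) \<in> D a" if "a \<in> {0..m}" for a
  proof -
    have "measure unit_leb (A a \<inter> \<tau> -` (- B a)) = measure unit_leb (B a \<inter> (- B a))"
      by (rule restricted_law_eq[OF AB \<open>\<tau> \<in> borel_measurable borel\<close> same eq[OF that]]) simp
    then have "measure unit_leb (A a \<inter> \<tau> -` (- B a)) = 0"
      by simp
    moreover have "A a \<inter> \<tau> -` (- B a) \<in> sets borel"
      by (intro sets.Int vimage_borel) simp_all
    ultimately have "A a \<inter> \<tau> -` (- B a) \<in> null_sets unit_leb"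
      by (auto simp: null_sets_def unit_leb.emeasure_eq_measure)
    from AE_not_in[OF this] show ?thesis
      by eventually_elim (auto simp: B_def)
  qed
  have "AE x in unit_leb. \<forall>a\<in>{0..m}. x \<in> A a \<longrightarrow> \<phi> (\<tau> x) \<in> D a"
    using AE_in by (intro AE_finite_allI) auto
  with coverA have "AE x in unit_leb. \<bar>\<phi> (\<tau> x) - \<psi> x\<bar> \<le> 1 / m"
  proof eventually_elim
    case (elim x)
    then obtain a where "\<psi> x \<in> D a" "\<phi> (\<tau> x) \<in> D a"
      by (auto simp: A_def)
    then show ?case
      by (auto simp: D_def add_divide_distrib abs_if)
  qed
  with \<tau> that show ?thesis by blast
qed

text \<open>Pullbacks along measure-preserving maps keep the L1 norm, which gives the constant 2 in
  the domination. On a quadrant the two pullbacks differ only where one coordinate lies on different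
  sides of a boundary point under \<open>\<eta> n\<close> and \<psi>, and closeness confines this to
  a thin strip.\<close>

lemma pullback_L1_tendsto:
  fixes f :: "real \<times> real \<Rightarrow> real"
  assumes \<eta>: "\<And>n. \<eta> n \<in> mp_maps" and \<psi>: "\<psi> \<in> mp_maps"
    and close: "\<And>n. AE x in unit_leb. \<bar>\<eta> n x - \<psi> x\<bar> \<le> \<delta> n" and \<delta>: "\<delta> \<longlonglongrightarrow> 0"
    and f: "integrable unit_leb2 f"
  shows "(\<lambda>n. \<integral>z. \<bar>f (\<eta> n (fst z), \<eta> n (snd z)) - f (\<psi> (fst z), \<psi> (snd z))\<bar> \<partial>unit_leb2) \<longlonglongrightarrow> 0"
proof -
  have [measurable]: "\<eta> n \<in> borel_measurable borel" "\<psi> \<in> borel_measurable borel" for n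
    using \<eta>[of n] \<psi> by (auto simp: mp_maps_def)
  have meas: "f \<in> borel_measurable borel" if "integrable unit_leb2 f" for f :: "real \<times> real \<Rightarrow> real"
    using borel_measurable_integrable[OF that] measurable_cong_sets[OF sets_unit_leb2 refl] by blast
  note pull_int = integrable_mp_maps_pair[rotated]
  define \<rho> where "\<rho> n f = (\<integral>z. \<bar>f (\<eta> n (fst z), \<eta> n (snd z)) - f (\<psi> (fst z), \<psi> (snd z))\<bar> \<partial>unit_leb2)"
    for n and f :: "real \<times> real \<Rightarrow> real"
  define S where "S n A = {x. (\<eta> n x \<in> A) \<noteq> (\<psi> x \<in> A)}" for n A
  have S_borel: "S n A \<in> sets borel" if "A \<in> sets borel" for n A
  proof -
    have "S n A = (\<eta> n -` A - \<psi> -` A) \<union> (\<psi> -` A - \<eta> n -` A)"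
      by (auto simp: S_def)
    then show ?thesis
      using vimage_borel that by auto
  qed
  have S_atMost: "(\<lambda>n. measure unit_leb (S n A)) \<longlonglongrightarrow> 0" if A: "A \<in> insert UNIV (range atMost)" for A
  proof (cases "A = UNIV")
    case True
    then show ?thesis by (simp add: S_def)
  next
    case False
    then obtain a where a: "A = {..a}"
      using A by auto
    have \<delta>_nonneg: "0 \<le> \<delta> n" for n
    proof -
      have "AE x in unit_leb. 0 \<le> \<delta> n"
        using close[of n] by eventually_elim (meson abs_ge_zero order_trans)
      then show ?thesis
        using unit_leb.AE_const by simp
    qed
    have "measure unit_leb (S n A) \<le> 2 * \<delta> n" for n
    proof -
      \<comment> \<open>If \<open>\<psi> x \<le> a < \<eta> n x\<close>, then \<psi> x exceeds a -
        \<delta> n strictly; if \<open>\<eta> n x \<le> a < \<psi> x\<close>, then \<psi> x is at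
        most a + \<delta> n. This accounts for the half-open interval.\<close>
      have "measure unit_leb (S n A) \<le> measure unit_leb (\<psi> -` {a - \<delta> n<..a + \<delta> n})"
      proof (rule unit_leb.finite_measure_mono_AE)
        show "AE x in unit_leb. x \<in> S n A \<longrightarrow> x \<in> \<psi> -` {a - \<delta> n<..a + \<delta> n}"
          using close[of n] by eventually_elim (auto simp: S_def a abs_le_iff)
      qed (simp add: vimage_borel)
      also have "\<dots> = measure unit_leb {a - \<delta> n<..a + \<delta> n}"
        using \<psi> by (intro measure_mp_maps) auto
      also have "\<dots> \<le> 2 * \<delta> n"
        using measure_unit_leb_Ioc_le[of "a - \<delta> n" "a + \<delta> n"] \<delta>_nonneg[of n] by simp
      finally show ?thesis .
    qed
    then show ?thesis
      by (intro tendsto_sandwich[OF _ _ tendsto_const tendsto_mult_right_zero[OF \<delta>, of 2]]) auto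
  qed
  have "(\<lambda>n. \<rho> n f) \<longlonglongrightarrow> 0"
  proof (rule seminorm_tendsto_0_square[where C = 2])
    fix n and f g :: "real \<times> real \<Rightarrow> real" and c :: real
    show "0 \<le> \<rho> n f"
      by (simp add: \<rho>_def)
    show "\<rho> n (\<lambda>x. c * f x) \<le> \<bar>c\<bar> * \<rho> n f"
      by (simp add: \<rho>_def right_diff_distrib[symmetric] abs_mult)
    assume f: "integrable unit_leb2 f"
    note fi = pull_int[OF f \<eta>[of n]] pull_int[OF f \<psi>]
    have "\<rho> n f \<le> (\<integral>z. \<bar>f (\<eta> n (fst z), \<eta> n (snd z))\<bar> + \<bar>f (\<psi> (fst z), \<psi> (snd z))\<bar> \<partial>unit_leb2)"
      unfolding \<rho>_def using fi by (intro integral_mono) auto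
    also have "\<dots> = (\<integral>z. \<bar>f (\<eta> n (fst z), \<eta> n (snd z))\<bar> \<partial>unit_leb2) + (\<integral>z. \<bar>f (\<psi> (fst z), \<psi> (snd z))\<bar> \<partial>unit_leb2)"
      using fi by (intro Bochner_Integration.integral_add) auto
    also have "\<dots> = 2 * (\<integral>z. \<bar>f z\<bar> \<partial>unit_leb2)"
      using integral_mp_maps_pair[OF \<eta>[of n], of "\<lambda>z. \<bar>f z\<bar>"]
        integral_mp_maps_pair[OF \<psi>, of "\<lambda>z. \<bar>f z\<bar>"] meas[OF f] by simp
    finally show "\<rho> n f \<le> 2 * (\<integral>z. \<bar>f z\<bar> \<partial>unit_leb2)" .
    assume g: "integrable unit_leb2 g"
    note gi = pull_int[OF g \<eta>[of n]] pull_int[OF g \<psi>]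
    have "\<rho> n (\<lambda>x. f x + g x)
      \<le> (\<integral>z. \<bar>f (\<eta> n (fst z), \<eta> n (snd z)) - f (\<psi> (fst z), \<psi> (snd z))\<bar>
          + \<bar>g (\<eta> n (fst z), \<eta> n (snd z)) - g (\<psi> (fst z), \<psi> (snd z))\<bar> \<partial>unit_leb2)"
      unfolding \<rho>_def using fi gi by (intro integral_mono) auto
    also have "\<dots> = \<rho> n f + \<rho> n g"
      unfolding \<rho>_def using fi gi by (intro Bochner_Integration.integral_add) auto
    finally show "\<rho> n (\<lambda>x. f x + g x) \<le> \<rho> n f + \<rho> n g" .
  next
    fix R assume "R \<in> quadrants"
    then obtain A B where R: "R = A \<times> B" and A: "A \<in> insert UNIV (range atMost)"
      and B: "B \<in> insert UNIV (range atMost)"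
      by (auto simp: quadrants_def)
    then have AB: "A \<in> sets borel" "B \<in> sets borel" by auto
    note SAB = S_borel[OF AB(1)] S_borel[OF AB(2)]
    have ind: "integrable unit_leb2 (indicator (C \<times> D) :: _ \<Rightarrow> real)" if "C \<in> sets borel" "D \<in> sets borel" for C D
      using borel_Times[OF that] by (intro integrable_unit_leb2[where B = 1]) (auto simp: indicator_def)
    have "\<rho> n (indicator R) \<le> measure unit_leb (S n A) + measure unit_leb (S n B)" for n
    proof -
      have "\<rho> n (indicator R)
          \<le> (\<integral>z. indicator (S n A \<times> UNIV) z + indicator (UNIV \<times> S n B) z \<partial>unit_leb2)"
        unfolding \<rho>_def
        using pull_int[OF ind[OF AB] \<eta>[of n]] pull_int[OF ind[OF AB] \<psi>] SAB
        by (intro integral_mono Bochner_Integration.integrable_add ind integrable_abs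
              Bochner_Integration.integrable_diff)
           (auto simp: R S_def indicator_def)
      also have "\<dots> = measure unit_leb2 (S n A \<times> UNIV) + measure unit_leb2 (UNIV \<times> S n B)"
        using SAB ind by (subst Bochner_Integration.integral_add) auto
      also have "\<dots> = measure unit_leb (S n A) + measure unit_leb (S n B)"
        using measure_unit_leb2_Times[OF SAB(1), of UNIV n] measure_unit_leb2_Times[OF _ SAB(2), of UNIV n] unit_leb.prob_space by simp
      finally show ?thesis .
    qed
    then have "norm (\<rho> n (indicator R)) \<le> measure unit_leb (S n A) + measure unit_leb (S n B)" for n
      by (simp add: \<rho>_def)
    moreover have "(\<lambda>n. measure unit_leb (S n A) + measure unit_leb (S n B)) \<longlonglongrightarrow> 0"
      using tendsto_add[OF S_atMost[OF A] S_atMost[OF B]] by simp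
    ultimately show "(\<lambda>n. \<rho> n (indicator R)) \<longlonglongrightarrow> 0"
      by (rule Lim_null_comparison[OF always_eventually[OF allI]])
  qed (rule f)
  then show ?thesis
    by (simp add: \<rho>_def)
qed

section \<open>The cut distance for Borel kernels\<close>

definition borel_cut_dist :: "(real \<times> real \<Rightarrow> real) \<Rightarrow> (real \<times> real \<Rightarrow> real) \<Rightarrow> real" where
  "borel_cut_dist U V =
     (INF (\<phi>, \<psi>) \<in> mp_maps \<times> mp_maps. borel_cut_metric (pullback U \<phi>) (pullback V \<psi>))"

lemma borel_cut_dist_le:
  assumes "U \<in> kernels" "V \<in> kernels" "\<phi> \<in> mp_maps" "\<psi> \<in> mp_maps"
  shows "borel_cut_dist U V \<le> borel_cut_metric (pullback U \<phi>) (pullback V \<psi>)"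
  unfolding borel_cut_dist_def
proof (rule cINF_lower2[where x = "(\<phi>, \<psi>)"])
  show "bdd_below ((\<lambda>(\<phi>, \<psi>). borel_cut_metric (pullback U \<phi>) (pullback V \<psi>)) ` (mp_maps \<times> mp_maps))"
    using borel_cut_metric_nonneg pullback_kernels assms by (auto intro!: bdd_belowI[of _ 0])
qed (use assms in auto)

lemma borel_cut_dist_nonneg:
  assumes "U \<in> kernels" "V \<in> kernels"
  shows "0 \<le> borel_cut_dist U V"
  unfolding borel_cut_dist_def
  using borel_cut_metric_nonneg pullback_kernels assms id_mp_maps by (intro cINF_greatest) auto

lemma borel_cut_dist_less:
  assumes "borel_cut_dist U V < c"
  obtains \<phi> \<psi> where "\<phi> \<in> mp_maps" "\<psi> \<in> mp_maps"
    "borel_cut_metric (pullback U \<phi>) (pullback V \<psi>) < c"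
proof -
  have "(\<lambda>(\<phi>, \<psi>). borel_cut_metric (pullback U \<phi>) (pullback V \<psi>)) ` (mp_maps \<times> mp_maps) \<noteq> {}"
    using id_mp_maps by auto
  from cInf_lessD[OF this assms[unfolded borel_cut_dist_def]] show ?thesis
    using that by auto
qed

lemma borel_cut_dist_commute: "borel_cut_dist U V = borel_cut_dist V U"
proof -
  have "(\<lambda>(\<phi>, \<psi>). borel_cut_metric (pullback U \<phi>) (pullback V \<psi>)) ` (mp_maps \<times> mp_maps)
      = (\<lambda>(\<phi>, \<psi>). borel_cut_metric (pullback V \<phi>) (pullback U \<psi>)) ` (mp_maps \<times> mp_maps)"
    using borel_cut_metric_commute by (force simp: image_iff)
  then show ?thesis
    by (simp add: borel_cut_dist_def)
qed

lemma borel_cut_dist_refl: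
  assumes "U \<in> kernels"
  shows "borel_cut_dist U U = 0"
proof -
  have "borel_cut_metric (pullback U (\<lambda>x. x)) (pullback U (\<lambda>x. x)) \<le> 0"
    by (intro borel_cut_metric_least) simp
  then show ?thesis
    using borel_cut_dist_le[OF assms assms id_mp_maps id_mp_maps] borel_cut_dist_nonneg[OF assms assms]
    by simp
qed

text \<open>Near-optimal pairs for (U, V) and (V, W) pull \<open>V\<close> back along unrelated maps
  \<open>\<psi>\<^sub>1\<close> and \<open>\<phi>\<^sub>2\<close>. Pulling the second pair back
  further along \<open>\<tau> n\<close>, with \<open>\<phi>\<^sub>2\<close> after
  \<open>\<tau> n\<close> close to \<open>\<psi>\<^sub>1\<close>, does not increase its cut metric
  and makes the two copies of \<open>V\<close> agree up to the L1 error \<open>L n\<close>.\<close>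

lemma borel_cut_dist_triangle:
  assumes U: "U \<in> kernels" and V: "V \<in> kernels" and W: "W \<in> kernels"
  shows "borel_cut_dist U W \<le> borel_cut_dist U V + borel_cut_dist V W"
proof (rule field_le_epsilon)
  fix e :: real assume "0 < e"
  then have "borel_cut_dist U V < borel_cut_dist U V + e / 2" "borel_cut_dist V W < borel_cut_dist V W + e / 2"
    by auto
  then obtain \<phi>\<^sub>1 \<psi>\<^sub>1 \<phi>\<^sub>2 \<psi>\<^sub>2
    where mp: "\<phi>\<^sub>1 \<in> mp_maps" "\<psi>\<^sub>1 \<in> mp_maps" "\<phi>\<^sub>2 \<in> mp_maps" "\<psi>\<^sub>2 \<in> mp_maps"
      and UV: "borel_cut_metric (pullback U \<phi>\<^sub>1) (pullback V \<psi>\<^sub>1) < borel_cut_dist U V + e / 2"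
      and VW: "borel_cut_metric (pullback V \<phi>\<^sub>2) (pullback W \<psi>\<^sub>2) < borel_cut_dist V W + e / 2"
    by (metis borel_cut_dist_less)
  have "\<exists>\<tau>. \<tau> \<in> mp_maps \<and> (AE x in unit_leb. \<bar>\<phi>\<^sub>2 (\<tau> x) - \<psi>\<^sub>1 x\<bar> \<le> 1 / Suc n)" for n
    using approximate_lift[OF mp(3,2), of "Suc n"] by blast
  then obtain \<tau> where \<tau>: "\<And>n. \<tau> n \<in> mp_maps"
      and close: "\<And>n. AE x in unit_leb. \<bar>\<phi>\<^sub>2 (\<tau> n x) - \<psi>\<^sub>1 x\<bar> \<le> 1 / Suc n"
    by metis
  define V' where "V' n = pullback V (\<lambda>x. \<phi>\<^sub>2 (\<tau> n x))" for n
  define W' where "W' n = pullback W (\<lambda>x. \<psi>\<^sub>2 (\<tau> n x))" for n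
  note comp = comp_mp_maps[OF mp(3) \<tau>] comp_mp_maps[OF mp(4) \<tau>]
  have ker: "V' n \<in> kernels" "W' n \<in> kernels" "pullback V \<psi>\<^sub>1 \<in> kernels" "pullback U \<phi>\<^sub>1 \<in> kernels" for n
    using pullback_kernels U V W mp comp by (auto simp: V'_def W'_def)
  define L where "L n = (\<integral>z. \<bar>V' n z - pullback V \<psi>\<^sub>1 z\<bar> \<partial>unit_leb2)" for n
  have "integrable unit_leb2 V"
    using V kernelsD[OF V] by (intro integrable_unit_leb2[where B = 1]) (auto simp: kernels_def)
  from pullback_L1_tendsto[OF comp(1) mp(2) close LIMSEQ_Suc[OF lim_1_over_n] this]
  have lim: "L \<longlonglongrightarrow> 0"
    unfolding L_def V'_def by (simp add: pullback_eq)
  have "borel_cut_dist U W \<le> borel_cut_dist U V + borel_cut_dist V W + e + L n" for n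
  proof -
    have "borel_cut_dist U W \<le> borel_cut_metric (pullback U \<phi>\<^sub>1) (W' n)"
      unfolding W'_def using U W mp comp by (intro borel_cut_dist_le)
    also have "\<dots> \<le> borel_cut_metric (pullback U \<phi>\<^sub>1) (pullback V \<psi>\<^sub>1) + borel_cut_metric (pullback V \<psi>\<^sub>1) (W' n)"
      by (intro borel_cut_metric_triangle ker)
    also have "borel_cut_metric (pullback V \<psi>\<^sub>1) (W' n)
        \<le> borel_cut_metric (V' n) (pullback V \<psi>\<^sub>1) + borel_cut_metric (V' n) (W' n)"
      using borel_cut_metric_triangle[OF ker(3) ker(1) ker(2)] by (simp add: borel_cut_metric_commute)
    also have "borel_cut_metric (V' n) (pullback V \<psi>\<^sub>1) \<le> L n"
      unfolding L_def by (intro borel_cut_metric_le_L1 ker)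
    also have "borel_cut_metric (V' n) (W' n) \<le> borel_cut_metric (pullback V \<phi>\<^sub>2) (pullback W \<psi>\<^sub>2)"
      using borel_cut_metric_pullback_le[OF pullback_kernels[OF V mp(3)] pullback_kernels[OF W mp(4)] \<tau>[of n]]
      by (simp add: V'_def W'_def pullback_def case_prod_beta)
    finally show ?thesis
      using UV VW by simp
  qed
  moreover have "(\<lambda>n. borel_cut_dist U V + borel_cut_dist V W + e + L n)
      \<longlonglongrightarrow> borel_cut_dist U V + borel_cut_dist V W + e + 0"
    by (intro tendsto_intros lim)
  ultimately have "borel_cut_dist U W \<le> borel_cut_dist U V + borel_cut_dist V W + e + 0"
    by (intro LIMSEQ_le_const[of _ _ "borel_cut_dist U W"]) auto
  then show "borel_cut_dist U W \<le> borel_cut_dist U V + borel_cut_dist V W + e"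
    by simp
qed

section \<open>Affine minorants of the relative entropy\<close>

lemma rel_entropy_measurable [measurable]: "rel_entropy p \<in> borel_measurable borel"
  unfolding rel_entropy_def[abs_def] by measurable

text \<open>Here \<open>q\<close> stands for a value of \<open>U\<close> and \<open>r\<close> for a
  value of an approximating graphon. The minorants are affine in \<open>r\<close> because weak
  convergence passes only through linear integrals, and Borel and bounded in \<open>q\<close> so
  that both coefficients composed with \<open>U\<close> are integrable test functions. Nonnegativity
  at q = r is what Fatou's lemma asks for when m tends to infinity.\<close>

definition affine_minorants :: "(real \<Rightarrow> ennreal) \<Rightarrow> (nat \<Rightarrow> real \<Rightarrow> real) \<Rightarrow> (nat \<Rightarrow> real \<Rightarrow> real) \<Rightarrow> bool" where
  "affine_minorants H S T \<longleftrightarrow>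
     (\<forall>m. S m \<in> borel_measurable borel \<and> T m \<in> borel_measurable borel) \<and>
     (\<forall>m. \<exists>B. \<forall>q. \<bar>S m q\<bar> \<le> B \<and> \<bar>T m q\<bar> \<le> B) \<and>
     (\<forall>m. \<forall>q\<in>{0..1}. \<forall>r\<in>{0..1}. ennreal (S m q * r + T m q) \<le> H r) \<and>
     (\<forall>m. \<forall>r\<in>{0..1}. 0 \<le> S m r * r + T m r) \<and>
     (\<forall>r\<in>{0..1}. H r \<le> liminf (\<lambda>m. ennreal (S m r * r + T m r)))"

text \<open>The left-hand side is the tangent at \<open>c\<close>. The gap between the two sides is
  the entropy of \<open>r\<close> relative to \<open>c\<close>, hence nonnegative.\<close>

lemma rel_entropy_tangent_le:
  fixes c p r :: real
  assumes "0 < c" "c < 1" "0 < p" "p < 1" "r \<in> {0..1}"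
  shows "r * ln (c / p) + (1 - r) * ln ((1 - c) / (1 - p))
    \<le> r * ln (r / p) + (1 - r) * ln ((1 - r) / (1 - p))"
proof -
  have 1: "r * ln (r / p) - r * ln (c / p) = r * ln (r / c)"
    using assms by (cases "r = 0") (auto simp: ln_div algebra_simps)
  have 2: "(1 - r) * ln ((1 - r) / (1 - p)) - (1 - r) * ln ((1 - c) / (1 - p)) = (1 - r) * ln ((1 - r) / (1 - c))"
  proof (cases "r = 1")
    case False
    then have "0 < 1 - r" "0 < 1 - c" "0 < 1 - p"
      using assms by auto
    then show ?thesis
      by (simp add: ln_div flip: right_diff_distrib)
  qed simp
  show ?thesis
    using rel_entropy_nonneg[of c r] 1 2 assms by auto
qed

lemma affine_minorants_interior:
  assumes p: "0 < p" "p < 1"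
  obtains S T where "affine_minorants (rel_entropy p) S T"
proof -
  \<comment> \<open>The shift by 2 keeps \<open>a m\<close> at most 1/2, so that the interval from
    \<open>a m\<close> to \<open>1 - a m\<close>, into which \<open>c m\<close> truncates, is never
    empty.\<close>
  define a where "a m = 1 / real (m + 2)" for m
  define c where "c m q = max (a m) (min (1 - a m) q)" for m q
  \<comment> \<open>The tangent at \<open>c m q\<close> takes the value \<open>t m q\<close> at r =
    0 and \<open>ln (c m q / p)\<close> at r = 1; the slope \<open>s m q\<close> is the
    difference.\<close>
  define t where "t m q = ln ((1 - c m q) / (1 - p))" for m q
  define s where "s m q = ln (c m q / p) - t m q" for m q
  \<comment> \<open>The truncated tangent may be negative at \<open>q\<close> itself. There it is
    replaced by the zero line, which is also a minorant; \<open>ennreal\<close> sends the negative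
    value to 0, so the limit is unaffected.\<close>
  define S where "S m q = (if 0 \<le> s m q * q + t m q then s m q else 0)" for m q
  define T where "T m q = (if 0 \<le> s m q * q + t m q then t m q else 0)" for m q
  define h where "h r = r * ln (r / p) + (1 - r) * ln ((1 - r) / (1 - p))" for r
  have a: "0 < a m" "a m \<le> 1 / 2" for m
    by (auto simp: a_def field_simps)
  have c: "a m \<le> c m q" "c m q \<le> 1 - a m" "0 < c m q" "c m q < 1" for m q
    using a[of m] by (auto simp: c_def)
  have [measurable]: "c m \<in> borel_measurable borel" for m
    unfolding c_def by measurable
  have [measurable]: "t m \<in> borel_measurable borel" "s m \<in> borel_measurable borel" for m
    unfolding t_def s_def by measurable
  have meas: "S m \<in> borel_measurable borel" "T m \<in> borel_measurable borel" for m
    unfolding S_def T_def by measurable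
  have H: "rel_entropy p r = ennreal (h r)" for r
    using p by (simp add: rel_entropy_def h_def)
  have tangent: "s m q * r + t m q = r * ln (c m q / p) + (1 - r) * ln ((1 - c m q) / (1 - p))" for m q r
    by (simp add: s_def t_def algebra_simps)
  have ln_bound: "\<bar>ln (x / y)\<bar> \<le> \<bar>ln (a m / y)\<bar> + \<bar>ln (1 / y)\<bar>" if "a m \<le> x" "x \<le> 1" "0 < y" for m x y
  proof -
    have "ln (a m / y) \<le> ln (x / y)" "ln (x / y) \<le> ln (1 / y)"
      using that a[of m] by (auto simp: divide_le_cancel intro!: divide_right_mono)
    then show ?thesis by auto
  qed
  have bounded: "\<exists>B. \<forall>q. \<bar>S m q\<bar> \<le> B \<and> \<bar>T m q\<bar> \<le> B" for m
  proof -
    define B where "B = \<bar>ln (a m / p)\<bar> + \<bar>ln (1 / p)\<bar> + \<bar>ln (a m / (1 - p))\<bar> + \<bar>ln (1 / (1 - p))\<bar>"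
    have "\<bar>s m q\<bar> \<le> B \<and> \<bar>t m q\<bar> \<le> B" for q
      using ln_bound[of m "c m q" p] ln_bound[of m "1 - c m q" "1 - p"] c[where m = m and q = q] a[of m] p
      unfolding s_def t_def B_def by linarith
    moreover have "0 \<le> B"
      by (simp add: B_def)
    ultimately show ?thesis
      by (intro exI[of _ B]) (simp add: S_def T_def)
  qed
  have "ennreal (S m q * r + T m q) \<le> rel_entropy p r" if "r \<in> {0..1}" for m q r
    using rel_entropy_tangent_le[OF c(3,4)[where m = m and q = q] p that]
    by (auto simp: S_def T_def H tangent h_def[symmetric] intro!: ennreal_leI)
  moreover have "0 \<le> S m r * r + T m r" for m r
    by (simp add: S_def T_def)
  moreover have "rel_entropy p r \<le> liminf (\<lambda>m. ennreal (S m r * r + T m r))" if r: "r \<in> {0..1}" for r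
  proof -
    have "a \<longlonglongrightarrow> 0"
      unfolding a_def by (rule LIMSEQ_ignore_initial_segment[OF lim_1_over_n])
    then have "(\<lambda>m. c m r) \<longlonglongrightarrow> max 0 (min (1 - 0) r)"
      unfolding c_def by (intro tendsto_intros)
    then have c_lim: "(\<lambda>m. c m r) \<longlonglongrightarrow> r"
      using r by simp
    \<comment> \<open>At r = 0 the logarithm diverges, but its coefficient vanishes for every m. The
      next limit behaves in the same way at r = 1.\<close>
    have "(\<lambda>m. r * ln (c m r / p)) \<longlonglongrightarrow> r * ln (r / p)"
      using r p by (cases "r = 0") (auto intro!: tendsto_intros c_lim)
    moreover have "(\<lambda>m. (1 - r) * ln ((1 - c m r) / (1 - p))) \<longlonglongrightarrow> (1 - r) * ln ((1 - r) / (1 - p))"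
      using r p by (cases "r = 1") (auto intro!: tendsto_intros c_lim)
    ultimately have "(\<lambda>m. s m r * r + t m r) \<longlonglongrightarrow> h r"
      unfolding tangent h_def by (rule tendsto_add)
    then have "(\<lambda>m. ennreal (s m r * r + t m r)) \<longlonglongrightarrow> ennreal (h r)"
      by (rule tendsto_ennrealI)
    moreover have "ennreal (s m r * r + t m r) = ennreal (S m r * r + T m r)" for m
      by (auto simp: S_def T_def ennreal_neg)
    ultimately show ?thesis
      by (simp add: H lim_imp_Liminf)
  qed
  ultimately have "affine_minorants (rel_entropy p) S T"
    using meas bounded unfolding affine_minorants_def by blast
  then show ?thesis
    by (rule that)
qed

lemma liminf_ennreal_linear:
  assumes "0 < r"
  shows "liminf (\<lambda>m. ennreal (real m * r)) = \<infinity>"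
proof -
  have "(\<lambda>m. ennreal r * of_nat m) \<longlonglongrightarrow> ennreal r * \<infinity>"
    using assms by (intro tendsto_mult_ennreal tendsto_const) (auto simp: of_nat_tendsto_top_ennreal)
  then have "(\<lambda>m. ennreal (real m * r)) \<longlonglongrightarrow> \<infinity>"
    using assms by (simp add: ennreal_mult ennreal_of_nat_eq_real_of_nat ennreal_mult_top mult.commute)
  then show ?thesis
    by (rule lim_imp_Liminf[rotated]) simp
qed

text \<open>For p = 0 the entropy is 0 at r = 0 and infinite elsewhere, and the lines
  \<open>m * r\<close> increase to it; for p = 1 the lines \<open>m * (1 - r)\<close> do the same.
  Their coefficients do not depend on the contact point \<open>q\<close>.\<close>

lemma affine_minorants_exist:
  assumes "p \<in> {0..1}"
  obtains S T where "affine_minorants (rel_entropy p) S T"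
proof -
  consider "p = 0" | "p = 1" | "0 < p" "p < 1"
    using assms by fastforce
  then show ?thesis
  proof cases
    case 1
    have "affine_minorants (rel_entropy p) (\<lambda>m q. real m) (\<lambda>m q. 0)"
      unfolding affine_minorants_def
    proof (intro conjI allI ballI)
      fix r :: real assume "r \<in> {0..1}"
      then show "rel_entropy p r \<le> liminf (\<lambda>m. ennreal (real m * r + 0))"
        using liminf_ennreal_linear[of r] 1 by (cases "r = 0") (auto simp: rel_entropy_def)
    next
      fix m
      show "\<exists>B. \<forall>q::real. \<bar>real m\<bar> \<le> B \<and> \<bar>0 :: real\<bar> \<le> B"
        by (rule exI[of _ "real m"]) simp
    qed (auto simp: 1 rel_entropy_def)
    then show ?thesis by (rule that)
  next
    case 2
    have "affine_minorants (rel_entropy p) (\<lambda>m q. - real m) (\<lambda>m q. real m)"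
      unfolding affine_minorants_def
    proof (intro conjI allI ballI)
      fix m
      show "\<exists>B. \<forall>q::real. \<bar>- real m\<bar> \<le> B \<and> \<bar>real m\<bar> \<le> B"
        by (rule exI[of _ "real m"]) simp
    next
      fix r :: real assume r: "r \<in> {0..1}"
      have "- real m * r + real m = real m * (1 - r)" for m
        by (simp add: algebra_simps)
      with r show "rel_entropy p r \<le> liminf (\<lambda>m. ennreal (- real m * r + real m))"
        using liminf_ennreal_linear[of "1 - r"] 2 by (cases "r = 1") (auto simp: rel_entropy_def)
      show "0 \<le> - real m * r + real m" for m
        using r by (simp add: mult_left_le)
    qed (auto simp: 2 rel_entropy_def)
    then show ?thesis by (rule that)
  next
    case 3
    then show ?thesis
      using affine_minorants_interior that by blast
  qed
qed

section \<open>Limits of blockwise couplings\<close>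

text \<open>A form of Helly's selection theorem: a diagonal subsequence converges at all rational
  points, and the uniform Lipschitz bound extends this to every real, with no exceptional points of
  discontinuity.\<close>

lemma convergent_distribution_functions:
  fixes F :: "nat \<Rightarrow> 'i \<Rightarrow> real \<Rightarrow> real"
  assumes K: "finite K"
    and mono: "\<And>n i x y. i \<in> K \<Longrightarrow> x \<le> y \<Longrightarrow> F n i x \<le> F n i y"
    and lip: "\<And>n i x y. i \<in> K \<Longrightarrow> x \<le> y \<Longrightarrow> F n i y \<le> F n i x + (y - x)"
    and bound: "\<And>n i x. i \<in> K \<Longrightarrow> \<bar>F n i x\<bar> \<le> 1"
  obtains s G where "strict_mono (s :: nat \<Rightarrow> nat)"
    "\<And>i x. i \<in> K \<Longrightarrow> (\<lambda>n. F (s n) i x) \<longlonglongrightarrow> G i x"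
proof -
  have "countable (K \<times> \<rat> :: ('i \<times> real) set)"
    using K countable_rat by (intro countable_SIGMA) (auto intro: countable_finite)
  then obtain s where s: "strict_mono (s :: nat \<Rightarrow> nat)"
    and conv: "\<And>iq. iq \<in> K \<times> \<rat> \<Longrightarrow> \<exists>l. (\<lambda>n. F (s n) (fst iq) (snd iq)) \<longlonglongrightarrow> l"
    by (rule function_convergent_subsequence[of _ "\<lambda>n iq. F n (fst iq) (snd iq)" 1]) (use bound in auto)
  have "convergent (\<lambda>n. F (s n) i x)" if i: "i \<in> K" for i x
  proof (rule Cauchy_convergent, rule CauchyI)
    fix e :: real assume "0 < e"
    \<comment> \<open>Moving from x to \<open>q\<close> costs less than e/3, and so does comparing
      the two indices at \<open>q\<close>. Monotonicity makes the return from \<open>q\<close> to x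
      free, so the total stays below e.\<close>
    then obtain q where q: "q \<in> \<rat>" "x < q" "q < x + e / 3"
      using Rats_dense_in_real[of x "x + e / 3"] by auto
    have "Cauchy (\<lambda>n. F (s n) i q)"
      using conv[of "(i, q)"] i q by (auto intro: LIMSEQ_imp_Cauchy)
    then obtain M where M: "\<And>m n. m \<ge> M \<Longrightarrow> n \<ge> M \<Longrightarrow> norm (F (s m) i q - F (s n) i q) < e / 3"
      using CauchyD[of _ "e / 3"] \<open>0 < e\<close> by fastforce
    have "norm (F (s m) i x - F (s n) i x) < e" if "m \<ge> M" "n \<ge> M" for m n
      using M[OF that] mono[OF i, of x q "s m"] mono[OF i, of x q "s n"]
        lip[OF i, of x q "s m"] lip[OF i, of x q "s n"] q
      unfolding real_norm_def abs_less_iff by linarith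
    then show "\<exists>M. \<forall>m\<ge>M. \<forall>n\<ge>M. norm (F (s m) i x - F (s n) i x) < e"
      by blast
  qed
  then have "(\<lambda>n. F (s n) i x) \<longlonglongrightarrow> lim (\<lambda>n. F (s n) i x)" if "i \<in> K" for i x
    using that by (simp add: convergent_LIMSEQ_iff)
  then show ?thesis
    using that[OF s, of "\<lambda>i x. lim (\<lambda>n. F (s n) i x)"] by blast
qed

text \<open>The boundary values of \<open>F n i\<close> and the sum over the blocks are the same for
  every \<open>n\<close>, because \<open>\<phi> n\<close> and \<open>\<psi> n\<close> preserve
  measure and the blocks form a partition. The limits inherit these identities exactly, and they are
  the hypotheses of \<open>quantile_transform_partition\<close>.\<close>

lemma block_limit_coupling:
  assumes K: "finite K" and I: "\<And>i. i \<in> K \<Longrightarrow> I i \<in> sets borel" and disj: "disjoint_family_on I K"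
    and cover: "AE x in unit_leb. x \<in> (\<Union>i\<in>K. I i)"
    and \<phi>: "\<And>n. \<phi> n \<in> mp_maps" and \<psi>: "\<And>n. \<psi> n \<in> mp_maps"
  obtains s \<theta> where "strict_mono (s :: nat \<Rightarrow> nat)" "\<theta> \<in> mp_maps"
    "\<forall>i\<in>K. \<forall>A\<in>insert UNIV (range atMost).
       (\<lambda>n. measure unit_leb (\<phi> (s n) -` I i \<inter> \<psi> (s n) -` A)) \<longlonglongrightarrow> measure unit_leb (I i \<inter> \<theta> -` A)"
proof -
  define F where "F n i x = measure unit_leb (\<phi> n -` I i \<inter> \<psi> n -` {..x})" for n i x
  have \<phi>_meas: "\<phi> n \<in> borel_measurable borel" and \<psi>_meas: "\<psi> n \<in> borel_measurable borel" for n
    using \<phi> \<psi> by (auto simp: mp_maps_def)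
  have \<phi>I: "\<phi> n -` I i \<in> sets borel" if "i \<in> K" for n i
    using vimage_borel[OF \<phi>_meas I[OF that]] .
  have \<phi>I_measure: "measure unit_leb (\<phi> n -` I i) = measure unit_leb (I i)" if "i \<in> K" for n i
    using measure_mp_maps[OF \<phi> I[OF that]] .
  have mono: "F n i x \<le> F n i y" and lip: "F n i y \<le> F n i x + (y - x)" if "i \<in> K" "x \<le> y" for n i x y
    using measure_Int_atMost_lipschitz[OF \<phi>I[OF that(1)] \<psi> that(2)] by (auto simp: F_def)
  have "\<bar>F n i x\<bar> \<le> 1" for n i x
    by (simp add: F_def)
  then obtain s G where s: "strict_mono (s :: nat \<Rightarrow> nat)"
    and lim: "\<And>i x. i \<in> K \<Longrightarrow> (\<lambda>n. F (s n) i x) \<longlonglongrightarrow> G i x"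
    using convergent_distribution_functions[OF K, of F] mono lip by blast
  have G_mono: "G i x \<le> G i y" if "i \<in> K" "x \<le> y" for i x y
    using that by (intro LIMSEQ_le[OF lim lim]) (auto intro: mono)
  have G_lip: "G i y \<le> G i x + (y - x)" if "i \<in> K" "x \<le> y" for i x y
    using that by (intro LIMSEQ_le[OF lim tendsto_add[OF lim tendsto_const]]) (auto intro: lip)
  obtain \<theta> where \<theta>: "\<theta> \<in> mp_maps"
    and \<theta>_eq: "\<And>i x. i \<in> K \<Longrightarrow> measure unit_leb (I i \<inter> \<theta> -` {..x}) = G i x"
  proof (rule quantile_transform_partition[OF K I disj cover, of G])
    fix i x assume i: "i \<in> K"
    show "continuous_on UNIV (G i)"
      using G_mono G_lip i by (intro continuous_on_lipschitz_mono) auto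
    show "G i x = 0" if "x \<le> 0"
    proof -
      have "F n i x \<le> measure unit_leb (\<psi> n -` {..x})" for n
        unfolding F_def by (intro unit_leb.finite_measure_mono) (auto simp: vimage_borel \<psi>_meas)
      moreover have "measure unit_leb (\<psi> n -` {..x}) = 0" for n
        using measure_mp_maps[OF \<psi>[of n], of "{..x}"] that by (simp add: measure_unit_leb_atMost)
      ultimately have "F n i x = 0" for n
        by (simp add: F_def measure_le_0_iff)
      then show ?thesis
        using lim[OF i, of x] by (simp add: LIMSEQ_const_iff)
    qed
    show "G i x = measure unit_leb (I i)" if "1 \<le> x"
    proof -
      have "F n i x = measure unit_leb (I i)" for n
        unfolding F_def \<phi>I_measure[OF i, of n, symmetric]
      proof (rule unit_leb.finite_measure_eq_AE)
        have "\<phi> n -` I i \<inter> \<psi> n -` {..x} \<in> sets borel"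
          by (intro sets.Int \<phi>I i vimage_borel \<psi>_meas) simp
        then show "\<phi> n -` I i \<inter> \<psi> n -` {..x} \<in> sets unit_leb" "\<phi> n -` I i \<in> sets unit_leb"
          using \<phi>I[OF i] by simp_all
        show "AE y in unit_leb. (y \<in> \<phi> n -` I i \<inter> \<psi> n -` {..x}) = (y \<in> \<phi> n -` I i)"
          using AE_mp_maps[OF \<psi>[of n] AE_unit_leb_in] by eventually_elim (use that in auto)
      qed
      then show ?thesis
        using lim[OF i, of x] by (simp add: LIMSEQ_const_iff)
    qed
  next
    fix x
    have "(\<Sum>i\<in>K. F n i x) = measure unit_leb {..x}" for n
    proof -
      have "(\<Sum>i\<in>K. F n i x) = measure unit_leb (\<psi> n -` {..x})"
        unfolding F_def
      proof (rule partition_measure_sum[OF K])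
        show "disjoint_family_on (\<lambda>i. \<phi> n -` I i) K"
          using disj by (auto simp: disjoint_family_on_def)
        show "AE x in unit_leb. x \<in> (\<Union>i\<in>K. \<phi> n -` I i)"
          using AE_mp_maps[OF \<phi>[of n] cover] by eventually_elim auto
      qed (auto simp: \<phi>I vimage_borel \<psi>_meas)
      then show ?thesis
        using measure_mp_maps[OF \<psi>[of n], of "{..x}"] by simp
    qed
    moreover have "(\<lambda>n. \<Sum>i\<in>K. F (s n) i x) \<longlonglongrightarrow> (\<Sum>i\<in>K. G i x)"
      by (intro tendsto_sum lim)
    ultimately show "(\<Sum>i\<in>K. G i x) = measure unit_leb {..x}"
      by (simp add: LIMSEQ_const_iff)
  qed (use G_mono in auto)
  show ?thesis
  proof (rule that[OF s \<theta>], intro ballI)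
    fix i A assume i: "i \<in> K" and A: "A \<in> insert UNIV (range (atMost :: real \<Rightarrow> real set))"
    show "(\<lambda>n. measure unit_leb (\<phi> (s n) -` I i \<inter> \<psi> (s n) -` A)) \<longlonglongrightarrow> measure unit_leb (I i \<inter> \<theta> -` A)"
    proof (cases "A = UNIV")
      case True
      then show ?thesis
        using \<phi>I_measure[OF i] by simp
    next
      case False
      then obtain x where "A = {..x}"
        using A by auto
      then show ?thesis
        using lim[OF i, of x] \<theta>_eq[OF i] by (simp add: F_def)
    qed
  qed
qed

text \<open>The bound involves neither the weight nor \<psi>; it is the uniform domination that the
  density argument demands.\<close>

lemma integrable_weighted_pullback:
  fixes f w :: "real \<times> real \<Rightarrow> real"
  assumes "integrable unit_leb2 f" "\<psi> \<in> mp_maps"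
    and "w \<in> borel_measurable borel" "\<And>z. 0 \<le> w z \<and> w z \<le> 1"
  shows "integrable unit_leb2 (\<lambda>z. w z * f (\<psi> (fst z), \<psi> (snd z)))"
    and "\<bar>\<integral>z. w z * f (\<psi> (fst z), \<psi> (snd z)) \<partial>unit_leb2\<bar> \<le> (\<integral>z. \<bar>f z\<bar> \<partial>unit_leb2)"
proof -
  have f: "f \<in> borel_measurable borel"
    using borel_measurable_integrable[OF assms(1)] measurable_cong_sets[OF sets_unit_leb2 refl] by blast
  have \<psi>: "\<psi> \<in> borel_measurable borel"
    using assms by (auto simp: mp_maps_def)
  have meas: "(\<lambda>z. w z * f (\<psi> (fst z), \<psi> (snd z))) \<in> borel_measurable unit_leb2"
    using assms(3) pullback_measurable[OF f \<psi>] measurable_cong_sets[OF sets_unit_leb2 refl]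
    by (intro borel_measurable_times) blast+
  have le: "\<bar>w z * f (\<psi> (fst z), \<psi> (snd z))\<bar> \<le> \<bar>f (\<psi> (fst z), \<psi> (snd z))\<bar>" for z
    using assms(4)[of z] by (auto simp: abs_mult intro!: mult_left_le_one_le)
  note pull = integrable_mp_maps_pair[OF assms(2,1)]
  show int: "integrable unit_leb2 (\<lambda>z. w z * f (\<psi> (fst z), \<psi> (snd z)))"
    using le by (intro Bochner_Integration.integrable_bound[OF pull meas]) simp
  have "\<bar>\<integral>z. w z * f (\<psi> (fst z), \<psi> (snd z)) \<partial>unit_leb2\<bar> \<le> (\<integral>z. \<bar>f (\<psi> (fst z), \<psi> (snd z))\<bar> \<partial>unit_leb2)"
    using le int pull by (intro integral_abs_bound[THEN order_trans] integral_mono) auto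
  also have "\<dots> = (\<integral>z. \<bar>f z\<bar> \<partial>unit_leb2)"
    using integral_mp_maps_pair[OF assms(2), of "\<lambda>z. \<bar>f z\<bar>"] f by simp
  finally show "\<bar>\<integral>z. w z * f (\<psi> (fst z), \<psi> (snd z)) \<partial>unit_leb2\<bar> \<le> (\<integral>z. \<bar>f z\<bar> \<partial>unit_leb2)" .
qed

text \<open>The weight is left general because it will be either the indicator of a block or this
  indicator times an approximating graphon. The constant 2 adds the bounds of the two functionals
  being compared.\<close>

lemma weighted_pullback_tendsto:
  fixes f :: "real \<times> real \<Rightarrow> real"
  assumes \<psi>: "\<And>n. \<psi> n \<in> mp_maps" and \<theta>: "\<theta> \<in> mp_maps"
    and w: "\<And>n. w n \<in> borel_measurable borel" "\<And>n z. 0 \<le> w n z \<and> w n z \<le> 1"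
    and v: "v \<in> borel_measurable borel" "\<And>z. 0 \<le> v z \<and> v z \<le> 1"
    and basic: "\<And>R. R \<in> quadrants \<Longrightarrow> (\<lambda>n. \<integral>z. w n z * indicator R (\<psi> n (fst z), \<psi> n (snd z)) \<partial>unit_leb2)
      \<longlonglongrightarrow> (\<integral>z. v z * indicator R (\<theta> (fst z), \<theta> (snd z)) \<partial>unit_leb2)"
    and f: "integrable unit_leb2 f"
  shows "(\<lambda>n. \<integral>z. w n z * f (\<psi> n (fst z), \<psi> n (snd z)) \<partial>unit_leb2)
      \<longlonglongrightarrow> (\<integral>z. v z * f (\<theta> (fst z), \<theta> (snd z)) \<partial>unit_leb2)"
proof -
  define L where "L n f = (\<integral>z. w n z * f (\<psi> n (fst z), \<psi> n (snd z)) \<partial>unit_leb2)" for n f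
  define L' where "L' f = (\<integral>z. v z * f (\<theta> (fst z), \<theta> (snd z)) \<partial>unit_leb2)" for f
  note iw = integrable_weighted_pullback[OF _ \<psi> w(1) w(2)]
  note iv = integrable_weighted_pullback[OF _ \<theta> v]
  have add: "L n (\<lambda>z. f z + g z) = L n f + L n g" "L' (\<lambda>z. f z + g z) = L' f + L' g"
    if "integrable unit_leb2 f" "integrable unit_leb2 g" for n f g
    unfolding L_def L'_def using iw(1)[of f n n] iw(1)[of g n n] iv(1)[of f] iv(1)[of g] that
    by (simp_all add: distrib_left)
  have scale: "L n (\<lambda>z. c * f z) = c * L n f" "L' (\<lambda>z. c * f z) = c * L' f" for n c f
    unfolding L_def L'_def by (simp_all add: mult.left_commute[of _ c])
  have "(\<lambda>n. \<bar>L n f - L' f\<bar>) \<longlonglongrightarrow> 0"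
  proof (rule seminorm_tendsto_0_square[where C = 2, OF _ _ _ _ _ f])
    fix n and f g :: "real \<times> real \<Rightarrow> real" and c :: real
    show "0 \<le> \<bar>L n f - L' f\<bar>" by simp
    show "\<bar>L n (\<lambda>x. c * f x) - L' (\<lambda>x. c * f x)\<bar> \<le> \<bar>c\<bar> * \<bar>L n f - L' f\<bar>"
      by (simp add: scale abs_mult flip: right_diff_distrib)
    assume f: "integrable unit_leb2 f"
    show "\<bar>L n f - L' f\<bar> \<le> 2 * (\<integral>z. \<bar>f z\<bar> \<partial>unit_leb2)"
      using iw(2)[OF f, of n n] iv(2)[OF f] unfolding L_def L'_def by linarith
    assume g: "integrable unit_leb2 g"
    show "\<bar>L n (\<lambda>x. f x + g x) - L' (\<lambda>x. f x + g x)\<bar> \<le> \<bar>L n f - L' f\<bar> + \<bar>L n g - L' g\<bar>"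
      by (simp add: add[OF f g])
  next
    fix R assume "R \<in> quadrants"
    from tendsto_rabs[OF LIM_zero[OF basic[OF this]]]
    show "(\<lambda>n. \<bar>L n (indicator R) - L' (indicator R)\<bar>) \<longlonglongrightarrow> 0"
      by (simp add: L_def L'_def)
  qed
  then show ?thesis
    using LIM_zero_cancel tendsto_rabs_zero_iff unfolding L_def L'_def by blast
qed

section \<open>Semicontinuity on one pair of blocks\<close>

lemma ennreal_integral_le_nn_integral:
  fixes f :: "'a \<Rightarrow> real"
  assumes "integrable M f"
  shows "ennreal (\<integral>x. f x \<partial>M) \<le> (\<integral>\<^sup>+x. ennreal (f x) \<partial>M)"
proof -
  have "ennreal (\<integral>x. f x \<partial>M) \<le> ennreal (\<integral>x. max 0 (f x) \<partial>M)"
    using assms by (intro ennreal_leI integral_mono integrable_max) auto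
  also have "\<dots> = (\<integral>\<^sup>+x. ennreal (max 0 (f x)) \<partial>M)"
    using assms by (intro nn_integral_eq_integral[symmetric] integrable_max) auto
  also have "\<dots> = (\<integral>\<^sup>+x. ennreal (f x) \<partial>M)"
    by (intro nn_integral_cong) (auto simp: max_def ennreal_neg)
  finally show ?thesis .
qed

text \<open>A single pair of blocks is fixed: \<open>A n\<close> and \<open>B n\<close> are to be
  their preimages under \<phi>, \<open>A\<^sub>0\<close> and \<open>B\<^sub>0\<close> the blocks
  themselves, and \<open>W n\<close> the pulled-back near-minimiser. The hypotheses on the sets
  speak of one-variable laws only.\<close>

locale converging_blocks =
  fixes \<psi> :: "nat \<Rightarrow> real \<Rightarrow> real" and \<theta> :: "real \<Rightarrow> real" and A B :: "nat \<Rightarrow> real set" and A\<^sub>0 B\<^sub>0 :: "real set"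
    and W :: "nat \<Rightarrow> real \<times> real \<Rightarrow> real" and U :: "real \<times> real \<Rightarrow> real"
  assumes \<psi>: "\<And>n. \<psi> n \<in> mp_maps" and \<theta>: "\<theta> \<in> mp_maps"
    and A: "\<And>n. A n \<in> sets borel" and B: "\<And>n. B n \<in> sets borel"
    and A\<^sub>0: "A\<^sub>0 \<in> sets borel" and B\<^sub>0: "B\<^sub>0 \<in> sets borel"
    and A_lim: "\<And>P. P \<in> insert UNIV (range atMost) \<Longrightarrow>
       (\<lambda>n. measure unit_leb (A n \<inter> \<psi> n -` P)) \<longlonglongrightarrow> measure unit_leb (A\<^sub>0 \<inter> \<theta> -` P)"
    and B_lim: "\<And>P. P \<in> insert UNIV (range atMost) \<Longrightarrow>
       (\<lambda>n. measure unit_leb (B n \<inter> \<psi> n -` P)) \<longlonglongrightarrow> measure unit_leb (B\<^sub>0 \<inter> \<theta> -` P)"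
    and W: "\<And>n. W n \<in> kernels" and U: "U \<in> kernels"
    and cut: "(\<lambda>n. borel_cut_metric (W n) (pullback U (\<psi> n))) \<longlonglongrightarrow> 0"
begin

lemma measurable_maps: "\<psi> n \<in> borel_measurable borel" "\<theta> \<in> borel_measurable borel"
  using \<psi> \<theta> by (auto simp: mp_maps_def)

lemma vimage_maps: "P \<in> sets borel \<Longrightarrow> \<psi> n -` P \<in> sets borel" "P \<in> sets borel \<Longrightarrow> \<theta> -` P \<in> sets borel"
  using measurable_maps by (auto intro: vimage_borel)

lemma block_indicator_measurable:
  "indicator (A n \<times> B n) \<in> borel_measurable (borel :: (real \<times> real) measure)"
  "indicator (A\<^sub>0 \<times> B\<^sub>0) \<in> borel_measurable (borel :: (real \<times> real) measure)"
  using borel_Times[OF A B] borel_Times[OF A\<^sub>0 B\<^sub>0] by auto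

lemma block_indicator_pullback:
  "(indicator (C \<times> D) z * indicator (P \<times> Q) (\<phi> (fst z), \<phi> (snd z)) :: real)
     = indicator ((C \<inter> \<phi> -` P) \<times> (D \<inter> \<phi> -` Q)) z"
  by (cases z) (auto simp: indicator_def)

text \<open>On a quadrant the integral is the measure of a rectangle, hence a product of two
  one-variable masses, each of which converges.\<close>

lemma block_mass_tendsto:
  fixes f :: "real \<times> real \<Rightarrow> real"
  assumes "integrable unit_leb2 f"
  shows "(\<lambda>n. \<integral>z. indicator (A n \<times> B n) z * f (\<psi> n (fst z), \<psi> n (snd z)) \<partial>unit_leb2)
      \<longlonglongrightarrow> (\<integral>z. indicator (A\<^sub>0 \<times> B\<^sub>0) z * f (\<theta> (fst z), \<theta> (snd z)) \<partial>unit_leb2)"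
proof (rule weighted_pullback_tendsto[OF \<psi> \<theta> block_indicator_measurable(1) _ block_indicator_measurable(2) _ _ assms])
  fix R assume "R \<in> quadrants"
  then obtain P Q where R: "R = P \<times> Q" and P: "P \<in> insert UNIV (range atMost)"
    and Q: "Q \<in> insert UNIV (range atMost)"
    by (auto simp: quadrants_def)
  then have PQ: "P \<in> sets borel" "Q \<in> sets borel" by auto
  have "(\<lambda>n. measure unit_leb (A n \<inter> \<psi> n -` P) * measure unit_leb (B n \<inter> \<psi> n -` Q))
      \<longlonglongrightarrow> measure unit_leb (A\<^sub>0 \<inter> \<theta> -` P) * measure unit_leb (B\<^sub>0 \<inter> \<theta> -` Q)"
    by (intro tendsto_mult A_lim B_lim P Q)
  then show "(\<lambda>n. \<integral>z. (indicator (A n \<times> B n) z :: real) * indicator R (\<psi> n (fst z), \<psi> n (snd z)) \<partial>unit_leb2)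
      \<longlonglongrightarrow> (\<integral>z. indicator (A\<^sub>0 \<times> B\<^sub>0) z * indicator R (\<theta> (fst z), \<theta> (snd z)) \<partial>unit_leb2)"
    using PQ A B A\<^sub>0 B\<^sub>0 vimage_maps
    by (simp add: R block_indicator_pullback[of _ _ _ _ _ \<theta>] block_indicator_pullback[of _ _ _ _ _ "\<psi> _"]
          measure_unit_leb2_Times sets.Int)
qed (auto simp: indicator_def)

text \<open>Restricting to the preimage of a quadrant leaves a rectangle, which is exactly what the
  cut metric tests. So \<open>W n\<close> may be replaced by the pullback of \<open>U\<close> at the
  vanishing cost \<open>D n\<close>, and what remains is \<open>block_mass_tendsto\<close> for the
  test function \<open>U\<close> times the indicator of the quadrant.\<close>

lemma block_integral_tendsto:
  fixes f :: "real \<times> real \<Rightarrow> real"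
  assumes f: "integrable unit_leb2 f"
  shows "(\<lambda>n. \<integral>z. indicator (A n \<times> B n) z * W n z * f (\<psi> n (fst z), \<psi> n (snd z)) \<partial>unit_leb2)
      \<longlonglongrightarrow> (\<integral>z. indicator (A\<^sub>0 \<times> B\<^sub>0) z * pullback U \<theta> z * f (\<theta> (fst z), \<theta> (snd z)) \<partial>unit_leb2)"
proof (rule weighted_pullback_tendsto[OF \<psi> \<theta> _ _ _ _ _ f])
  show "(\<lambda>z. indicator (A n \<times> B n) z * W n z) \<in> borel_measurable borel" for n
    using W[of n] by (intro borel_measurable_times block_indicator_measurable) (auto simp: kernels_def)
  show "(\<lambda>z. indicator (A\<^sub>0 \<times> B\<^sub>0) z * pullback U \<theta> z) \<in> borel_measurable borel"
    using pullback_kernels[OF U \<theta>] by (intro borel_measurable_times block_indicator_measurable) (auto simp: kernels_def)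
  show "0 \<le> indicator (A n \<times> B n) z * W n z \<and> indicator (A n \<times> B n) z * W n z \<le> 1" for n z
    using kernelsD[OF W, of n z] by (auto simp: indicator_def)
  show "0 \<le> indicator (A\<^sub>0 \<times> B\<^sub>0) z * pullback U \<theta> z \<and> indicator (A\<^sub>0 \<times> B\<^sub>0) z * pullback U \<theta> z \<le> 1" for z
    using kernelsD[OF pullback_kernels[OF U \<theta>], of z] by (auto simp: indicator_def)
next
  fix R assume "R \<in> quadrants"
  then obtain P Q where R: "R = P \<times> Q" and "P \<in> insert UNIV (range atMost)" "Q \<in> insert UNIV (range atMost)"
    by (auto simp: quadrants_def)
  then have PQ: "P \<in> sets borel" "Q \<in> sets borel" by auto
  define A' B' where "A' n = A n \<inter> \<psi> n -` P" and "B' n = B n \<inter> \<psi> n -` Q" for n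
  have A'B': "A' n \<in> sets borel" "B' n \<in> sets borel" for n
    using A B PQ vimage_maps by (auto simp: A'_def B'_def)
  have U\<psi>: "pullback U (\<psi> n) \<in> kernels" for n
    by (rule pullback_kernels[OF U \<psi>])
  define D where "D n = (\<integral>z. indicator (A' n \<times> B' n) z * (W n z - pullback U (\<psi> n) z) \<partial>unit_leb2)" for n
  have "D \<longlonglongrightarrow> 0"
    using rect_le_borel_cut_metric[OF W U\<psi> A'B']
    by (intro Lim_null_comparison[OF _ cut]) (simp add: D_def)
  define E where "E n = (\<integral>z. indicator (A n \<times> B n) z * (\<lambda>z. U z * indicator R z) (\<psi> n (fst z), \<psi> n (snd z)) \<partial>unit_leb2)" for n
  have "integrable unit_leb2 (\<lambda>z. U z * indicator R z)"
    using U kernelsD[OF U] borel_Times[OF PQ]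
    by (intro integrable_unit_leb2[where B = 1]) (auto simp: kernels_def R indicator_def)
  from block_mass_tendsto[OF this]
  have "E \<longlonglongrightarrow> (\<integral>z. indicator (A\<^sub>0 \<times> B\<^sub>0) z * (pullback U \<theta> z * indicator R (\<theta> (fst z), \<theta> (snd z))) \<partial>unit_leb2)"
    unfolding E_def pullback_eq .
  with \<open>D \<longlonglongrightarrow> 0\<close> have lim: "(\<lambda>n. D n + E n)
      \<longlonglongrightarrow> 0 + (\<integral>z. indicator (A\<^sub>0 \<times> B\<^sub>0) z * (pullback U \<theta> z * indicator R (\<theta> (fst z), \<theta> (snd z))) \<partial>unit_leb2)"
    by (rule tendsto_add)
  have "(\<integral>z. indicator (A n \<times> B n) z * W n z * indicator R (\<psi> n (fst z), \<psi> n (snd z)) \<partial>unit_leb2) = D n + E n" for n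
  proof -
    \<comment> \<open>Subtracting the zero kernel gives the integrand the shape that
      \<open>integrable_rect\<close> expects.\<close>
    have E': "(\<lambda>z. indicator (A n \<times> B n) z * (U (\<psi> n (fst z), \<psi> n (snd z)) * indicator R (\<psi> n (fst z), \<psi> n (snd z))))
        = (\<lambda>z. indicator (A' n \<times> B' n) z * (pullback U (\<psi> n) z - 0))"
      unfolding R A'_def B'_def pullback_eq by (auto simp: indicator_def fun_eq_iff)
    have zero: "(\<lambda>z. 0) \<in> kernels"
      by (simp add: kernels_def)
    have "(\<lambda>z. indicator (A n \<times> B n) z * W n z * indicator R (\<psi> n (fst z), \<psi> n (snd z)))
        = (\<lambda>z. indicator (A' n \<times> B' n) z * (W n z - pullback U (\<psi> n) z)
            + indicator (A' n \<times> B' n) z * (pullback U (\<psi> n) z - 0))"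
      unfolding R A'_def B'_def by (auto simp: indicator_def fun_eq_iff)
    then show ?thesis
      unfolding D_def E_def E'
      using integrable_rect[OF W U\<psi> A'B', of n n n n] integrable_rect[OF U\<psi> zero A'B', of n n n]
      by (simp del: diff_zero)
  qed
  with lim show "(\<lambda>n. \<integral>z. indicator (A n \<times> B n) z * W n z * indicator R (\<psi> n (fst z), \<psi> n (snd z)) \<partial>unit_leb2)
      \<longlonglongrightarrow> (\<integral>z. indicator (A\<^sub>0 \<times> B\<^sub>0) z * pullback U \<theta> z * indicator R (\<theta> (fst z), \<theta> (snd z)) \<partial>unit_leb2)"
    by (simp add: mult.assoc)
qed

text \<open>The order of the limits matters: n tends to infinity for a fixed \<open>m\<close>, while
  the coefficients are bounded, and Fatou's lemma in \<open>m\<close> comes afterwards. At (x, y)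
  the minorant applied to \<open>W n\<close> has its contact point at the value of \<open>U\<close>
  at (\<psi> n x, \<psi> n y), so its coefficients are functions of \<open>\<psi> n\<close> and the
  two preceding limits apply.\<close>

lemma block_lower_semicontinuous:
  assumes "affine_minorants H S T"
  shows "(\<integral>\<^sup>+z. indicator (A\<^sub>0 \<times> B\<^sub>0) z * H (pullback U \<theta> z) \<partial>unit_leb2)
    \<le> liminf (\<lambda>n. \<integral>\<^sup>+z. indicator (A n \<times> B n) z * H (W n z) \<partial>unit_leb2)"
proof -
  let ?C = "liminf (\<lambda>n. \<integral>\<^sup>+z. indicator (A n \<times> B n) z * H (W n z) \<partial>unit_leb2)"
  note minorants = assms[unfolded affine_minorants_def]
  have [measurable]: "S m \<in> borel_measurable borel" "T m \<in> borel_measurable borel" for m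
    using minorants by auto
  have [measurable]: "U \<in> borel_measurable borel"
    using U by (simp add: kernels_def)
  have U01: "pullback U \<phi> z \<in> {0..1}" for \<phi> z
    using kernelsD[OF U] by (simp add: pullback_eq)
  define g where "g m z = indicator (A\<^sub>0 \<times> B\<^sub>0) z * (S m (pullback U \<theta> z) * pullback U \<theta> z + T m (pullback U \<theta> z))" for m z
  have pU\<theta> [measurable]: "pullback U \<theta> \<in> borel_measurable borel"
    using pullback_kernels[OF U \<theta>] by (simp add: kernels_def)
  have g_meas: "g m \<in> borel_measurable borel" for m
    unfolding g_def using block_indicator_measurable(2) by measurable
  have g_nonneg: "0 \<le> g m z" for m z
    using minorants U01 by (auto simp: g_def intro!: mult_nonneg_nonneg)
  have int_ST: "integrable unit_leb2 (\<lambda>z. S m (U z))" "integrable unit_leb2 (\<lambda>z. T m (U z))" for m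
  proof -
    obtain b where "\<And>q. \<bar>S m q\<bar> \<le> b \<and> \<bar>T m q\<bar> \<le> b"
      using minorants by blast
    then show "integrable unit_leb2 (\<lambda>z. S m (U z))" "integrable unit_leb2 (\<lambda>z. T m (U z))"
      by (auto intro!: integrable_unit_leb2[where B = b])
  qed
  have g_split: "g m = (\<lambda>z. indicator (A\<^sub>0 \<times> B\<^sub>0) z * pullback U \<theta> z * S m (U (\<theta> (fst z), \<theta> (snd z)))
      + indicator (A\<^sub>0 \<times> B\<^sub>0) z * T m (U (\<theta> (fst z), \<theta> (snd z))))" for m
    by (auto simp: g_def pullback_eq algebra_simps)
  have wU: "(\<lambda>z. indicator (A\<^sub>0 \<times> B\<^sub>0) z * pullback U \<theta> z) \<in> borel_measurable borel"
      "\<And>z. 0 \<le> indicator (A\<^sub>0 \<times> B\<^sub>0) z * pullback U \<theta> z \<and> indicator (A\<^sub>0 \<times> B\<^sub>0) z * pullback U \<theta> z \<le> 1"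
    by (intro borel_measurable_times block_indicator_measurable pU\<theta>)
       (auto simp: indicator_def kernelsD[OF pullback_kernels[OF U \<theta>]])
  have w1: "\<And>z. 0 \<le> (indicator (A\<^sub>0 \<times> B\<^sub>0) z :: real) \<and> (indicator (A\<^sub>0 \<times> B\<^sub>0) z :: real) \<le> 1"
      "\<And>n z. 0 \<le> (indicator (A n \<times> B n) z :: real) \<and> (indicator (A n \<times> B n) z :: real) \<le> 1"
    by (auto simp: indicator_def)
  note int_g = integrable_weighted_pullback(1)[OF int_ST(1) \<theta> wU]
    integrable_weighted_pullback(1)[OF int_ST(2) \<theta> block_indicator_measurable(2) w1(1)]
  have g_le: "ennreal (\<integral>z. g m z \<partial>unit_leb2) \<le> ?C" for m
  proof -
    define G where "G n z = indicator (A n \<times> B n) z * W n z * S m (U (\<psi> n (fst z), \<psi> n (snd z)))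
        + indicator (A n \<times> B n) z * T m (U (\<psi> n (fst z), \<psi> n (snd z)))" for n z
    have wW: "(\<lambda>z. indicator (A n \<times> B n) z * W n z) \<in> borel_measurable borel"
        "\<And>z. 0 \<le> indicator (A n \<times> B n) z * W n z \<and> indicator (A n \<times> B n) z * W n z \<le> 1" for n
      by (intro borel_measurable_times block_indicator_measurable kernels_measurable W)
         (auto simp: indicator_def kernelsD[OF W])
    note int_G = integrable_weighted_pullback(1)[OF int_ST(1) \<psi> wW]
      integrable_weighted_pullback(1)[OF int_ST(2) \<psi> block_indicator_measurable(1) w1(2)]
    have "(\<lambda>n. \<integral>z. G n z \<partial>unit_leb2) \<longlonglongrightarrow> (\<integral>z. g m z \<partial>unit_leb2)"
      unfolding G_def g_split Bochner_Integration.integral_add[OF int_g] Bochner_Integration.integral_add[OF int_G]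
      by (rule tendsto_add[OF block_integral_tendsto[OF int_ST(1)] block_mass_tendsto[OF int_ST(2)]])
    then have "(\<lambda>n. ennreal (\<integral>z. G n z \<partial>unit_leb2)) \<longlonglongrightarrow> ennreal (\<integral>z. g m z \<partial>unit_leb2)"
      by (rule tendsto_ennrealI)
    then have "ennreal (\<integral>z. g m z \<partial>unit_leb2) = liminf (\<lambda>n. ennreal (\<integral>z. G n z \<partial>unit_leb2))"
      by (intro lim_imp_Liminf[symmetric]) auto
    also have "\<dots> \<le> ?C"
    proof (intro Liminf_mono always_eventually allI)
      fix n
      \<comment> \<open>\<open>G n\<close> may be negative, since nonnegativity of the minorant is
        known only at the contact point; the truncation by \<open>ennreal\<close> can only increase
        the right-hand side.\<close>
      have "ennreal (\<integral>z. G n z \<partial>unit_leb2) \<le> (\<integral>\<^sup>+z. ennreal (G n z) \<partial>unit_leb2)"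
        unfolding G_def by (intro ennreal_integral_le_nn_integral Bochner_Integration.integrable_add int_G)
      also have "\<dots> \<le> (\<integral>\<^sup>+z. indicator (A n \<times> B n) z * H (W n z) \<partial>unit_leb2)"
      proof (rule nn_integral_mono)
        fix z
        have "ennreal (S m (pullback U (\<psi> n) z) * W n z + T m (pullback U (\<psi> n) z)) \<le> H (W n z)"
          using minorants U01[of "\<psi> n" z] kernelsD[OF W, of n z] by auto
        then show "ennreal (G n z) \<le> indicator (A n \<times> B n) z * H (W n z)"
          by (auto simp: G_def pullback_eq indicator_def mult.commute)
      qed
      finally show "ennreal (\<integral>z. G n z \<partial>unit_leb2) \<le> (\<integral>\<^sup>+z. indicator (A n \<times> B n) z * H (W n z) \<partial>unit_leb2)" .
    qed
    finally show ?thesis .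
  qed
  have "(\<integral>\<^sup>+z. indicator (A\<^sub>0 \<times> B\<^sub>0) z * H (pullback U \<theta> z) \<partial>unit_leb2)
      \<le> (\<integral>\<^sup>+z. liminf (\<lambda>m. ennreal (g m z)) \<partial>unit_leb2)"
  proof (rule nn_integral_mono)
    fix z
    have "H (pullback U \<theta> z) \<le> liminf (\<lambda>m. ennreal (S m (pullback U \<theta> z) * pullback U \<theta> z + T m (pullback U \<theta> z)))"
      using minorants U01 by blast
    then show "indicator (A\<^sub>0 \<times> B\<^sub>0) z * H (pullback U \<theta> z) \<le> liminf (\<lambda>m. ennreal (g m z))"
      by (auto simp: g_def indicator_def)
  qed
  also have "\<dots> \<le> liminf (\<lambda>m. \<integral>\<^sup>+z. ennreal (g m z) \<partial>unit_leb2)"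
    using g_meas measurable_cong_sets[OF sets_unit_leb2 refl]
    by (intro nn_integral_liminf measurable_compose[OF _ measurable_ennreal]) blast
  also have "\<dots> = liminf (\<lambda>m. ennreal (\<integral>z. g m z \<partial>unit_leb2))"
    using int_g g_nonneg unfolding g_split
    by (subst nn_integral_eq_integral) auto
  also have "\<dots> \<le> liminf (\<lambda>m. ?C)"
    by (intro Liminf_mono always_eventually allI g_le)
  also have "\<dots> = ?C"
    by (simp add: Liminf_const)
  finally show ?thesis .
qed

end

text \<open>Fatou's lemma for the counting measure on \<open>K\<close>.\<close>

lemma sum_liminf_le:
  fixes f :: "nat \<Rightarrow> 'i \<Rightarrow> ennreal"
  assumes "finite K"
  shows "(\<Sum>i\<in>K. liminf (\<lambda>n. f n i)) \<le> liminf (\<lambda>n. \<Sum>i\<in>K. f n i)"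
  using nn_integral_liminf[of f "count_space K"] assms by (simp add: nn_integral_count_space_finite)

text \<open>One subsequence and one \<theta> serve all pairs of blocks, so the estimates can be
  added. Integrating the entropy of the pullback of \<open>V\<close> over the preimages of two
  blocks is the same as integrating that of \<open>V\<close> over the blocks, so the right-hand side
  is free of \<phi>.\<close>

lemma entropy_lower_semicontinuous:
  fixes p :: "'i \<Rightarrow> 'i \<Rightarrow> real"
  assumes K: "finite K" and I: "\<And>i. i \<in> K \<Longrightarrow> I i \<in> sets borel" and disj: "disjoint_family_on I K"
    and cover: "AE x in unit_leb. x \<in> (\<Union>i\<in>K. I i)"
    and p: "\<And>i j. i \<in> K \<Longrightarrow> j \<in> K \<Longrightarrow> p i j \<in> {0..1}"
    and \<phi>: "\<And>n. \<phi> n \<in> mp_maps" and \<psi>: "\<And>n. \<psi> n \<in> mp_maps"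
    and V: "\<And>n. V n \<in> kernels" and U: "U \<in> kernels"
    and cut: "(\<lambda>n. borel_cut_metric (pullback (V n) (\<phi> n)) (pullback U (\<psi> n))) \<longlonglongrightarrow> 0"
  obtains s \<theta> where "strict_mono (s :: nat \<Rightarrow> nat)" "\<theta> \<in> mp_maps"
    "(\<Sum>i\<in>K. \<Sum>j\<in>K. \<integral>\<^sup>+z. indicator (I i \<times> I j) z * rel_entropy (p i j) (pullback U \<theta> z) \<partial>unit_leb2)
      \<le> liminf (\<lambda>n. \<Sum>i\<in>K. \<Sum>j\<in>K. \<integral>\<^sup>+z. indicator (I i \<times> I j) z * rel_entropy (p i j) (V (s n) z) \<partial>unit_leb2)"
proof (rule block_limit_coupling[where \<phi> = \<phi> and \<psi> = \<psi> and I = I and K = K])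
  fix s \<theta> assume s: "strict_mono (s :: nat \<Rightarrow> nat)" and \<theta>: "\<theta> \<in> mp_maps"
    and lim: "\<forall>i\<in>K. \<forall>A\<in>insert UNIV (range atMost).
       (\<lambda>n. measure unit_leb (\<phi> (s n) -` I i \<inter> \<psi> (s n) -` A)) \<longlonglongrightarrow> measure unit_leb (I i \<inter> \<theta> -` A)"
  have \<phi>I: "\<phi> n -` I i \<in> sets borel" if "i \<in> K" for n i
    using \<phi>[of n] I[OF that] by (intro vimage_borel) (auto simp: mp_maps_def)
  have le: "(\<integral>\<^sup>+z. indicator (I i \<times> I j) z * rel_entropy (p i j) (pullback U \<theta> z) \<partial>unit_leb2)
      \<le> liminf (\<lambda>n. \<integral>\<^sup>+z. indicator (I i \<times> I j) z * rel_entropy (p i j) (V (s n) z) \<partial>unit_leb2)"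
    if ij: "i \<in> K" "j \<in> K" for i j
  proof -
    interpret converging_blocks "\<lambda>n. \<psi> (s n)" \<theta> "\<lambda>n. \<phi> (s n) -` I i" "\<lambda>n. \<phi> (s n) -` I j" "I i" "I j"
        "\<lambda>n. pullback (V (s n)) (\<phi> (s n))" U
      using ij \<phi> \<psi> \<theta> \<phi>I I lim V U LIMSEQ_subseq_LIMSEQ[OF cut s] pullback_kernels
      by unfold_locales (auto simp: comp_def)
    obtain S T where minorants: "affine_minorants (rel_entropy (p i j)) S T"
      using affine_minorants_exist p[OF ij] by blast
    have "(\<integral>\<^sup>+z. indicator (\<phi> (s n) -` I i \<times> \<phi> (s n) -` I j) z * rel_entropy (p i j) (pullback (V (s n)) (\<phi> (s n)) z) \<partial>unit_leb2)
        = (\<integral>\<^sup>+z. indicator (I i \<times> I j) z * rel_entropy (p i j) (V (s n) z) \<partial>unit_leb2)" for n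
    proof -
      have [measurable]: "V (s n) \<in> borel_measurable borel" "I i \<times> I j \<in> sets borel"
        using V[of "s n"] borel_Times[OF I I] ij by (auto simp: kernels_def)
      have "(\<lambda>z. indicator (I i \<times> I j) z * rel_entropy (p i j) (V (s n) z)) \<in> borel_measurable borel"
        by measurable
      from nn_integral_mp_maps_pair[OF \<phi>[of "s n"] this] show ?thesis
        by (simp add: pullback_eq indicator_times indicator_vimage)
    qed
    with block_lower_semicontinuous[OF minorants] show ?thesis
      by simp
  qed
  have "(\<Sum>i\<in>K. \<Sum>j\<in>K. \<integral>\<^sup>+z. indicator (I i \<times> I j) z * rel_entropy (p i j) (pullback U \<theta> z) \<partial>unit_leb2)
      \<le> (\<Sum>i\<in>K. \<Sum>j\<in>K. liminf (\<lambda>n. \<integral>\<^sup>+z. indicator (I i \<times> I j) z * rel_entropy (p i j) (V (s n) z) \<partial>unit_leb2))"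
    by (intro sum_mono le)
  also have "\<dots> \<le> (\<Sum>i\<in>K. liminf (\<lambda>n. \<Sum>j\<in>K. \<integral>\<^sup>+z. indicator (I i \<times> I j) z * rel_entropy (p i j) (V (s n) z) \<partial>unit_leb2))"
    by (intro sum_mono sum_liminf_le K)
  also have "\<dots> \<le> liminf (\<lambda>n. \<Sum>i\<in>K. \<Sum>j\<in>K. \<integral>\<^sup>+z. indicator (I i \<times> I j) z * rel_entropy (p i j) (V (s n) z) \<partial>unit_leb2)"
    by (rule sum_liminf_le[OF K])
  finally show thesis
    by (rule that[OF s \<theta>])
qed (use K I disj cover \<phi> \<psi> in auto)

section \<open>Borel versions of graphons and of measure-preserving maps\<close>

lemma unit_square_borel: "unit_square \<in> sets borel"
  by (intro borel_Times) auto

lemma AE_lebesgue_iff: "(AE x in lebesgue. P x) \<longleftrightarrow> (AE x in lborel. P x)"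
  by (rule AE_completion_iff)

lemma sets_lebesgue_AE:
  fixes A S :: "'a::euclidean_space set"
  assumes "S \<in> sets borel" "AE x in lborel. x \<in> A \<longleftrightarrow> x \<in> S"
  shows "A \<in> sets lebesgue"
proof -
  have "(indicator A :: 'a \<Rightarrow> real) \<in> borel_measurable lebesgue"
  proof (rule borel_measurable_AE)
    have "(indicator S :: 'a \<Rightarrow> real) \<in> borel_measurable lborel"
      using assms by simp
    then show "(indicator S :: 'a \<Rightarrow> real) \<in> borel_measurable lebesgue"
      by (rule measurable_completion)
    show "AE x in lebesgue. indicator S x = (indicator A x :: real)"
      unfolding AE_lebesgue_iff using assms(2) by eventually_elim (auto simp: indicator_def)
  qed
  then show ?thesis
    by (simp add: borel_measurable_indicator_iff)
qed

lemma lebesgue_set_borel_version: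
  assumes "A \<in> sets lebesgue"
  obtains S where "S \<in> sets borel" "AE x in lborel. x \<in> A \<longleftrightarrow> x \<in> S"
proof -
  obtain S N N' where A: "A = S \<union> N" "N \<subseteq> N'" and N': "N' \<in> null_sets lborel" and S: "S \<in> sets lborel"
    using assms by (rule sets_completionE)
  have "AE x in lborel. x \<in> A \<longleftrightarrow> x \<in> S"
    using AE_not_in[OF N'] by eventually_elim (use A in auto)
  then show ?thesis
    using S by (intro that[of S]) auto
qed

lemma graphon_borel_version:
  assumes "U \<in> graphons"
  obtains U' where "U' \<in> kernels" "AE z in unit_leb2. U z = U' z"
proof -
  have "unit_square \<in> sets lebesgue"
    using unit_square_borel by (intro sets_completionI_sets) simp
  then have "(\<lambda>z. indicator unit_square z *\<^sub>R U z) \<in> borel_measurable lebesgue"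
    using assms by (subst borel_measurable_restrict_space_iff[symmetric]) (auto simp: graphons_def)
  then obtain g where g: "g \<in> borel_measurable lborel"
    and eq: "AE z in lborel. indicator unit_square z *\<^sub>R U z = g z"
    using completion_ex_borel_measurable_real by blast
  have "(\<lambda>z. max 0 (min 1 (g z))) \<in> kernels"
    using g by (auto simp: kernels_def)
  moreover have "AE z in unit_leb2. U z = max 0 (min 1 (g z))"
    unfolding AE_unit_leb2_iff using eq
  proof eventually_elim
    case (elim z)
    show ?case
    proof
      assume z: "z \<in> unit_square"
      then have "U z \<in> {0..1}"
        using assms by (auto simp: graphons_def)
      then show "U z = max 0 (min 1 (g z))"
        using elim z by (auto simp: indicator_def)
    qed
  qed
  ultimately show ?thesis by (rule that)
qed

lemma graphonsI:
  assumes "U' \<in> kernels" "AE z in unit_leb2. U z = U' z"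
    and "\<And>z. z \<in> unit_square \<Longrightarrow> U z \<in> unit_interval"
    and "\<And>x y. x \<in> unit_interval \<Longrightarrow> y \<in> unit_interval \<Longrightarrow> U (x, y) = U (y, x)"
  shows "U \<in> graphons"
proof -
  have sq: "unit_square \<in> sets lebesgue"
    using unit_square_borel by (intro sets_completionI_sets) simp
  have "(\<lambda>z. indicator unit_square z *\<^sub>R U z) \<in> borel_measurable lebesgue"
  proof (rule borel_measurable_AE)
    have "(\<lambda>z. indicator unit_square z *\<^sub>R U' z) \<in> borel_measurable lborel"
      using assms(1) unit_square_borel by (auto simp: kernels_def)
    then show "(\<lambda>z. indicator unit_square z *\<^sub>R U' z) \<in> borel_measurable lebesgue"
      by (rule measurable_completion)
    show "AE z in lebesgue. indicator unit_square z *\<^sub>R U' z = indicator unit_square z *\<^sub>R U z"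
      unfolding AE_lebesgue_iff using assms(2)[unfolded AE_unit_leb2_iff]
      by eventually_elim (auto simp: indicator_def)
  qed
  then have "U \<in> borel_measurable (lebesgue_on unit_square)"
    using sq by (subst borel_measurable_restrict_space_iff) auto
  then show ?thesis
    using assms by (auto simp: graphons_def)
qed

lemma measure_preserving_borel_version:
  assumes "\<phi> \<in> measure_preserving_maps"
  obtains \<phi>' where "\<phi>' \<in> mp_maps" "AE x in unit_leb. \<phi> x = \<phi>' x"
proof -
  have I: "{0..1} \<in> sets (lebesgue :: real measure)"
    by (intro sets_completionI_sets) simp
  have meas: "\<phi> \<in> lebesgue_on {0..1} \<rightarrow>\<^sub>M lebesgue" and into: "\<And>x. x \<in> {0..1} \<Longrightarrow> \<phi> x \<in> {0..1}"
    using assms by (auto simp: measure_preserving_maps_def measurable_restrict_space2_iff space_restrict_space)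
  have "\<phi> \<in> borel_measurable (lebesgue_on {0..1})"
  proof (rule measurableI)
    show "\<phi> -` A \<inter> space (lebesgue_on {0..1}) \<in> sets (lebesgue_on {0..1})" if "A \<in> sets borel" for A
      using that by (intro measurable_sets[OF meas] sets_completionI_sets) simp
  qed auto
  then have "(\<lambda>x. indicator {0..1} x *\<^sub>R \<phi> x) \<in> borel_measurable lebesgue"
    using I by (subst borel_measurable_restrict_space_iff[symmetric]) auto
  then obtain \<phi>' where \<phi>': "\<phi>' \<in> borel_measurable lborel"
    and eq: "AE x in lborel. indicator {0..1} x *\<^sub>R \<phi> x = \<phi>' x"
    using completion_ex_borel_measurable_real by blast
  have [measurable]: "\<phi>' \<in> borel_measurable borel"
    using \<phi>' by simp
  have "distr unit_leb borel \<phi>' = unit_leb"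
  proof (rule measure_eqI)
    fix A assume "A \<in> sets (distr unit_leb borel \<phi>')"
    then have A: "A \<in> sets borel" by simp
    have A_I: "A \<inter> {0..1} \<in> sets (lebesgue_on {0..1})"
      using A I by (subst sets_restrict_space_iff) (auto intro!: sets_completionI_sets)
    have pre: "\<phi> -` (A \<inter> {0..1}) \<inter> {0..1} \<in> sets lebesgue"
    proof -
      have "\<phi> -` (A \<inter> {0..1}) \<inter> space (lebesgue_on {0..1}) \<in> sets (lebesgue_on {0..1})"
        using A by (intro measurable_sets[OF meas] sets_completionI_sets) simp
      then show ?thesis
        using I by (subst (asm) sets_restrict_space_iff) (auto simp: space_restrict_space)
    qed
    have pre': "\<phi>' -` A \<inter> {0..1} \<in> sets borel"
      using vimage_borel[OF _ A, of \<phi>'] by auto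
    have "emeasure (distr unit_leb borel \<phi>') A = emeasure unit_leb (\<phi>' -` A)"
      using A by (subst emeasure_distr) auto
    also have "\<dots> = emeasure lborel (\<phi>' -` A \<inter> {0..1})"
      using vimage_borel[OF _ A, of \<phi>'] by (intro emeasure_unit_leb) auto
    also have "\<dots> = emeasure lebesgue (\<phi>' -` A \<inter> {0..1})"
      using pre' by simp
    also have "\<dots> = emeasure lebesgue (\<phi> -` (A \<inter> {0..1}) \<inter> {0..1})"
    proof (rule emeasure_eq_AE[OF _ sets_completionI_sets pre])
      show "AE x in lebesgue. x \<in> \<phi>' -` A \<inter> {0..1} \<longleftrightarrow> x \<in> \<phi> -` (A \<inter> {0..1}) \<inter> {0..1}"
        unfolding AE_lebesgue_iff using eq
      proof eventually_elim
        case (elim x)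
        then show ?case
          using into[of x] by (cases "x \<in> {0..1}") auto
      qed
    qed (use pre' in simp)
    also have "\<dots> = emeasure lebesgue (A \<inter> {0..1})"
      using assms A_I by (auto simp: measure_preserving_maps_def)
    also have "\<dots> = emeasure unit_leb A"
      using A by (simp add: emeasure_unit_leb)
    finally show "emeasure (distr unit_leb borel \<phi>') A = emeasure unit_leb A" .
  qed simp
  then have "\<phi>' \<in> mp_maps"
    by (simp add: mp_maps_def)
  moreover have "AE x in unit_leb. \<phi> x = \<phi>' x"
    unfolding AE_unit_leb_iff using eq by eventually_elim (auto simp: indicator_def)
  ultimately show ?thesis by (rule that)
qed

text \<open>The preimage of a Lebesgue set under a Borel map can fail to be measurable. Here the set
  differs from a Borel set by a null set, and measure preservation pulls null sets back to null
  sets.\<close>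

lemma measure_preserving_lebesgue_version:
  assumes \<phi>': "\<phi>' \<in> mp_maps"
  obtains \<phi> where "\<phi> \<in> measure_preserving_maps" "AE x in unit_leb. \<phi> x = \<phi>' x"
proof -
  \<comment> \<open>The default 0 keeps every value in the unit interval; within that interval it is
    called upon only on a null set.\<close>
  define \<phi> where "\<phi> x = (if \<phi>' x \<in> {0..1} then \<phi>' x else 0)" for x
  have [measurable]: "\<phi>' \<in> borel_measurable borel"
    using \<phi>' by (simp add: mp_maps_def)
  have meas [measurable]: "\<phi> \<in> borel_measurable borel"
    unfolding \<phi>_def by measurable
  have eq: "AE x in unit_leb. \<phi> x = \<phi>' x"
    using AE_mp_maps[OF \<phi>' AE_unit_leb_in] by eventually_elim (simp add: \<phi>_def)
  have I: "{0..1} \<in> sets (lebesgue :: real measure)"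
    by (intro sets_completionI_sets) simp
  have main: "\<phi> -` A \<inter> {0..1} \<in> sets lebesgue \<and> emeasure lebesgue (\<phi> -` A \<inter> {0..1}) = emeasure lebesgue (A \<inter> {0..1})"
    if A: "A \<in> sets lebesgue" for A
  proof -
    obtain S where S: "S \<in> sets borel" and AS: "AE x in lborel. x \<in> A \<longleftrightarrow> x \<in> S"
      using lebesgue_set_borel_version[OF A] .
    have S': "\<phi>' -` S \<inter> {0..1} \<in> sets borel"
      using vimage_borel[OF _ S, of \<phi>'] by auto
    have "AE x in unit_leb. x \<in> A \<longleftrightarrow> x \<in> S"
      unfolding AE_unit_leb_iff using AS by eventually_elim auto
    from AE_mp_maps[OF \<phi>' this] eq have "AE x in unit_leb. \<phi> x \<in> A \<longleftrightarrow> \<phi>' x \<in> S"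
      by eventually_elim auto
    then have pre_eq: "AE x in lborel. x \<in> \<phi> -` A \<inter> {0..1} \<longleftrightarrow> x \<in> \<phi>' -` S \<inter> {0..1}"
      unfolding AE_unit_leb_iff by eventually_elim auto
    then have pre: "\<phi> -` A \<inter> {0..1} \<in> sets lebesgue"
      using S' by (intro sets_lebesgue_AE)
    have "emeasure lebesgue (\<phi> -` A \<inter> {0..1}) = emeasure lebesgue (\<phi>' -` S \<inter> {0..1})"
      using pre_eq pre S' by (intro emeasure_eq_AE) (auto simp: AE_lebesgue_iff)
    also have "\<dots> = emeasure unit_leb (\<phi>' -` S)"
      using S' vimage_borel[OF _ S, of \<phi>'] by (simp add: emeasure_unit_leb)
    also have "\<dots> = emeasure (distr unit_leb borel \<phi>') S"
      using S by (subst emeasure_distr) auto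
    also have "\<dots> = emeasure unit_leb S"
      using \<phi>' by (simp add: mp_maps_def)
    also have "\<dots> = emeasure lebesgue (S \<inter> {0..1})"
      using S by (simp add: emeasure_unit_leb)
    also have "\<dots> = emeasure lebesgue (A \<inter> {0..1})"
    proof (rule emeasure_eq_AE)
      show "AE x in lebesgue. x \<in> S \<inter> {0..1} \<longleftrightarrow> x \<in> A \<inter> {0..1}"
        unfolding AE_lebesgue_iff using AS by eventually_elim auto
      show "S \<inter> {0..1} \<in> sets lebesgue"
        using S by (intro sets_completionI_sets) simp
      show "A \<inter> {0..1} \<in> sets lebesgue"
        using A I by (rule sets.Int)
    qed
    finally show ?thesis
      using pre by blast
  qed
  have "\<phi> \<in> lebesgue_on {0..1} \<rightarrow>\<^sub>M lebesgue_on {0..1}"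
  proof (rule measurable_restrict_space2)
    show "\<phi> \<in> space (lebesgue_on {0..1}) \<rightarrow> {0..1}"
      by (auto simp: \<phi>_def)
    show "\<phi> \<in> lebesgue_on {0..1} \<rightarrow>\<^sub>M lebesgue"
    proof (rule measurableI)
      fix A :: "real set" assume "A \<in> sets lebesgue"
      then show "\<phi> -` A \<inter> space (lebesgue_on {0..1}) \<in> sets (lebesgue_on {0..1})"
        using main[of A] I by (subst sets_restrict_space_iff) (auto simp: space_restrict_space)
    qed auto
  qed
  moreover have "emeasure lebesgue (\<phi> -` A \<inter> {0..1}) = emeasure lebesgue A"
    if "A \<in> sets (lebesgue_on {0..1})" for A
  proof -
    have "A \<subseteq> {0..1}" "A \<in> sets lebesgue"
      using that I by (subst (asm) sets_restrict_space_iff; simp)+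
    then show ?thesis
      using main[of A] by (simp add: Int_absorb2)
  qed
  ultimately have "\<phi> \<in> measure_preserving_maps"
    by (simp add: measure_preserving_maps_def)
  then show ?thesis
    using eq by (rule that)
qed

section \<open>Agreement of the cut distance with its Borel counterpart\<close>

lemma AE_unit_leb2_fst_snd:
  assumes "AE x in unit_leb. P x"
  shows "AE z in unit_leb2. P (fst z) \<and> P (snd z)"
proof -
  have "AE x in distr unit_leb2 unit_leb fst. P x"
    unfolding unit_leb.distr_pair_fst by (rule assms)
  then have 1: "AE z in unit_leb2. P (fst z)"
    by (rule AE_distrD[rotated]) (rule measurable_fst)
  have "distr unit_leb2 unit_leb snd = distr (distr unit_leb2 unit_leb2 (\<lambda>(x, y). (y, x))) unit_leb snd"
    using unit_leb2.distr_pair_swap by simp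
  also have "\<dots> = distr unit_leb2 unit_leb (snd \<circ> (\<lambda>(x, y). (y, x)))"
    by (rule distr_distr) (auto intro: measurable_pair_swap')
  also have "snd \<circ> (\<lambda>(x, y). (y, x)) = (fst :: real \<times> real \<Rightarrow> real)"
    by auto
  finally have distr_snd: "distr unit_leb2 unit_leb snd = unit_leb"
    unfolding unit_leb.distr_pair_fst .
  have "AE x in distr unit_leb2 unit_leb snd. P x"
    unfolding distr_snd by (rule assms)
  then have 2: "AE z in unit_leb2. P (snd z)"
    by (rule AE_distrD[rotated]) (rule measurable_snd)
  from 1 2 show ?thesis
    by eventually_elim simp
qed

text \<open>A null set of the square pulls back to a null set under \<open>\<phi>'\<close> applied
  to both coordinates, and a null set of the line spoils only a null set of the square in each
  coordinate.\<close>

lemma pullback_AE_cong: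
  assumes "AE z in unit_leb2. U z = U' z" "AE x in unit_leb. \<phi> x = \<phi>' x" "\<phi>' \<in> mp_maps"
  shows "AE z in unit_leb2. pullback U \<phi> z = pullback U' \<phi>' z"
  using AE_mp_maps_pair[OF assms(3,1)] AE_unit_leb2_fst_snd[OF assms(2)]
  by eventually_elim (auto simp: pullback_eq)

lemma rect_integral_borel_version:
  assumes U': "U' \<in> kernels" "AE z in unit_leb2. U z = U' z"
    and V': "V' \<in> kernels" "AE z in unit_leb2. V z = V' z"
    and A: "A \<subseteq> {0..1}" "A' \<in> sets borel" "AE x in lborel. x \<in> A \<longleftrightarrow> x \<in> A' \<inter> {0..1}"
    and B: "B \<subseteq> {0..1}" "B' \<in> sets borel" "AE x in lborel. x \<in> B \<longleftrightarrow> x \<in> B' \<inter> {0..1}"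
  shows "(LINT z:A \<times> B|lebesgue. U z - V z)
    = (\<integral>z. indicator (A' \<times> B') z * (U' z - V' z) \<partial>unit_leb2)"
proof -
  define h where "h z = indicator unit_square z * (indicator (A' \<times> B') z * (U' z - V' z))" for z
  have [measurable]: "U' \<in> borel_measurable borel" "V' \<in> borel_measurable borel"
      "A' \<times> B' \<in> sets borel" "unit_square \<in> sets borel"
    using U' V' A B borel_Times[of A' B'] unit_square_borel by (auto simp: kernels_def)
  have h: "h \<in> borel_measurable lborel"
    unfolding h_def by measurable
  have "AE x in unit_leb. (x \<in> A \<longleftrightarrow> x \<in> A') \<and> (x \<in> B \<longleftrightarrow> x \<in> B')"
    unfolding AE_unit_leb_iff using A(3) B(3) by eventually_elim auto
  from AE_unit_leb2_fst_snd[OF this] U'(2) V'(2)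
  have "AE z in unit_leb2. h z = indicator unit_square z * (indicator (A \<times> B) z * (U z - V z))"
    by eventually_elim (auto simp: h_def indicator_def)
  then have ae: "AE z in lebesgue. h z = indicator (A \<times> B) z *\<^sub>R (U z - V z)"
    unfolding AE_lebesgue_iff AE_unit_leb2_iff
  proof eventually_elim
    case (elim z)
    show ?case
    proof (cases "z \<in> unit_square")
      case True
      then show ?thesis
        using elim by simp
    next
      case False
      then have "z \<notin> A \<times> B"
        using A(1) B(1) by auto
      then show ?thesis
        using False by (simp add: h_def)
    qed
  qed
  have "(LINT z:A \<times> B|lebesgue. U z - V z) = (\<integral>z. h z \<partial>lebesgue)"
    unfolding set_lebesgue_integral_def
  proof (rule integral_cong_AE)
    show "h \<in> borel_measurable lebesgue"
      using h by (rule measurable_completion)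
    then show "(\<lambda>z. indicator (A \<times> B) z *\<^sub>R (U z - V z)) \<in> borel_measurable lebesgue"
      using ae by (rule borel_measurable_AE)
    show "AE z in lebesgue. indicator (A \<times> B) z *\<^sub>R (U z - V z) = h z"
      using ae by eventually_elim simp
  qed
  also have "\<dots> = (\<integral>z. h z \<partial>lborel)"
    using h by (rule integral_completion)
  also have "\<dots> = (\<integral>z. indicator (A' \<times> B') z * (U' z - V' z) \<partial>density lborel (\<lambda>z. ennreal (indicator unit_square z)))"
    by (subst integral_density) (auto simp: h_def[abs_def])
  also have "(\<lambda>z. ennreal (indicator unit_square z)) = indicator unit_square"
    by (auto simp: indicator_def fun_eq_iff)
  also have "density lborel \<dots> = unit_leb2"
    by (rule unit_leb2_eq[symmetric])
  finally show ?thesis .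
qed

text \<open>The two suprema are taken over the same set of numbers: a Lebesgue rectangle has a Borel
  version with the same integral, and a Borel rectangle can be cut down to the unit square. Infima
  over maps are compared in the same way in \<open>cut_dist_borel_version\<close>.\<close>

lemma cut_metric_borel_version:
  assumes U': "U' \<in> kernels" "AE z in unit_leb2. U z = U' z"
    and V': "V' \<in> kernels" "AE z in unit_leb2. V z = V' z"
  shows "cut_metric U V = borel_cut_metric U' V'"
proof -
  let ?L = "\<lambda>(A, B). \<bar>LINT z:A \<times> B|lebesgue. U z - V z\<bar>"
  let ?B = "\<lambda>(A, B). \<bar>\<integral>z. indicator (A \<times> B) z * (U' z - V' z) \<partial>unit_leb2\<bar>"
  have I: "{0..1} \<inter> space lebesgue \<in> sets (lebesgue :: real measure)"
    by (auto intro!: sets_completionI_sets)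
  note sets_iff = sets_restrict_space_iff[OF I]
  note eq = rect_integral_borel_version[OF U' V']
  have "?L ` (sets (lebesgue_on unit_interval) \<times> sets (lebesgue_on unit_interval))
      = ?B ` (sets borel \<times> sets borel)"
  proof (intro subset_antisym subsetI)
    fix x assume "x \<in> ?L ` (sets (lebesgue_on unit_interval) \<times> sets (lebesgue_on unit_interval))"
    then obtain A B where AB: "A \<subseteq> {0..1}" "A \<in> sets lebesgue" "B \<subseteq> {0..1}" "B \<in> sets lebesgue"
      and x: "x = ?L (A, B)"
      by (auto simp: sets_iff)
    obtain A' where A': "A' \<in> sets borel" "AE x in lborel. x \<in> A \<longleftrightarrow> x \<in> A'"
      using lebesgue_set_borel_version[OF AB(2)] .
    obtain B' where B': "B' \<in> sets borel" "AE x in lborel. x \<in> B \<longleftrightarrow> x \<in> B'"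
      using lebesgue_set_borel_version[OF AB(4)] .
    have "AE x in lborel. x \<in> A \<longleftrightarrow> x \<in> A' \<inter> {0..1}"
      using A'(2) by eventually_elim (use AB in auto)
    moreover have "AE x in lborel. x \<in> B \<longleftrightarrow> x \<in> B' \<inter> {0..1}"
      using B'(2) by eventually_elim (use AB in auto)
    ultimately have "x = ?B (A', B')"
      using eq[OF AB(1) A'(1) _ AB(3) B'(1)] x by simp
    then show "x \<in> ?B ` (sets borel \<times> sets borel)"
      using A' B' by blast
  next
    fix x assume "x \<in> ?B ` (sets borel \<times> sets borel)"
    then obtain A B where AB: "A \<in> sets borel" "B \<in> sets borel" and x: "x = ?B (A, B)"
      by auto
    have "x = ?L (A \<inter> {0..1}, B \<inter> {0..1})"
      using eq[of "A \<inter> {0..1}" A "B \<inter> {0..1}" B] AB x by simp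
    moreover have "A \<inter> {0..1} \<in> sets (lebesgue_on unit_interval)" "B \<inter> {0..1} \<in> sets (lebesgue_on unit_interval)"
      using AB by (auto simp: sets_iff intro!: sets_completionI_sets)
    ultimately show "x \<in> ?L ` (sets (lebesgue_on unit_interval) \<times> sets (lebesgue_on unit_interval))"
      by blast
  qed
  then show ?thesis
    unfolding cut_metric_def borel_cut_metric_def by simp
qed

lemma cut_dist_borel_version:
  assumes U': "U' \<in> kernels" "AE z in unit_leb2. U z = U' z"
    and V': "V' \<in> kernels" "AE z in unit_leb2. V z = V' z"
  shows "cut_dist U V = borel_cut_dist U' V'"
proof -
  let ?L = "\<lambda>(\<phi>, \<psi>). cut_metric (pullback U \<phi>) (pullback V \<psi>)"
  let ?B = "\<lambda>(\<phi>, \<psi>). borel_cut_metric (pullback U' \<phi>) (pullback V' \<psi>)"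
  have eq: "?L (\<phi>, \<psi>) = ?B (\<phi>', \<psi>')"
    if "\<phi>' \<in> mp_maps" "\<psi>' \<in> mp_maps" "AE x in unit_leb. \<phi> x = \<phi>' x" "AE x in unit_leb. \<psi> x = \<psi>' x"
    for \<phi> \<psi> \<phi>' \<psi>'
    unfolding prod.case using that
    by (intro cut_metric_borel_version pullback_kernels pullback_AE_cong[OF U'(2)] pullback_AE_cong[OF V'(2)] U' V')
  have "?L ` (measure_preserving_maps \<times> measure_preserving_maps) = ?B ` (mp_maps \<times> mp_maps)"
  proof (intro subset_antisym subsetI)
    fix x assume "x \<in> ?L ` (measure_preserving_maps \<times> measure_preserving_maps)"
    then obtain \<phi> \<psi> where "\<phi> \<in> measure_preserving_maps" "\<psi> \<in> measure_preserving_maps" and x: "x = ?L (\<phi>, \<psi>)"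
      by auto
    obtain \<phi>' where \<phi>': "\<phi>' \<in> mp_maps" "AE x in unit_leb. \<phi> x = \<phi>' x"
      using measure_preserving_borel_version[OF \<open>\<phi> \<in> measure_preserving_maps\<close>] .
    obtain \<psi>' where \<psi>': "\<psi>' \<in> mp_maps" "AE x in unit_leb. \<psi> x = \<psi>' x"
      using measure_preserving_borel_version[OF \<open>\<psi> \<in> measure_preserving_maps\<close>] .
    note * = \<phi>'(1) \<psi>'(1) \<phi>'(2) \<psi>'(2)
    then have "x = ?B (\<phi>', \<psi>')"
      using eq x by simp
    with * show "x \<in> ?B ` (mp_maps \<times> mp_maps)" by blast
  next
    fix x assume "x \<in> ?B ` (mp_maps \<times> mp_maps)"
    then obtain \<phi>' \<psi>' where mp: "\<phi>' \<in> mp_maps" "\<psi>' \<in> mp_maps" and x: "x = ?B (\<phi>', \<psi>')"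
      by auto
    obtain \<phi> where \<phi>: "\<phi> \<in> measure_preserving_maps" "AE x in unit_leb. \<phi> x = \<phi>' x"
      using measure_preserving_lebesgue_version[OF mp(1)] .
    obtain \<psi> where \<psi>: "\<psi> \<in> measure_preserving_maps" "AE x in unit_leb. \<psi> x = \<psi>' x"
      using measure_preserving_lebesgue_version[OF mp(2)] .
    note * = \<phi>(1) \<psi>(1) \<phi>(2) \<psi>(2)
    then have "x = ?L (\<phi>, \<psi>)"
      using eq mp x by simp
    with * show "x \<in> ?L ` (measure_preserving_maps \<times> measure_preserving_maps)" by blast
  qed
  then show ?thesis
    unfolding cut_dist_def borel_cut_dist_def by simp
qed

section \<open>The metric on unlabelled graphons\<close>

lemma cut_dist_nonneg:
  assumes "U \<in> graphons" "V \<in> graphons"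
  shows "0 \<le> cut_dist U V"
proof -
  obtain U' where U': "U' \<in> kernels" "AE z in unit_leb2. U z = U' z"
    using graphon_borel_version[OF assms(1)] .
  obtain V' where V': "V' \<in> kernels" "AE z in unit_leb2. V z = V' z"
    using graphon_borel_version[OF assms(2)] .
  show ?thesis
    unfolding cut_dist_borel_version[OF U' V'] by (rule borel_cut_dist_nonneg[OF U'(1) V'(1)])
qed

lemma cut_dist_commute:
  assumes "U \<in> graphons" "V \<in> graphons"
  shows "cut_dist U V = cut_dist V U"
proof -
  obtain U' where U': "U' \<in> kernels" "AE z in unit_leb2. U z = U' z"
    using graphon_borel_version[OF assms(1)] .
  obtain V' where V': "V' \<in> kernels" "AE z in unit_leb2. V z = V' z"
    using graphon_borel_version[OF assms(2)] .
  show ?thesis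
    unfolding cut_dist_borel_version[OF U' V'] cut_dist_borel_version[OF V' U']
    by (rule borel_cut_dist_commute)
qed

lemma cut_dist_refl:
  assumes "U \<in> graphons"
  shows "cut_dist U U = 0"
proof -
  obtain U' where U': "U' \<in> kernels" "AE z in unit_leb2. U z = U' z"
    using graphon_borel_version[OF assms] .
  show ?thesis
    unfolding cut_dist_borel_version[OF U' U'] by (rule borel_cut_dist_refl[OF U'(1)])
qed

lemma cut_dist_triangle:
  assumes "U \<in> graphons" "V \<in> graphons" "W \<in> graphons"
  shows "cut_dist U W \<le> cut_dist U V + cut_dist V W"
proof -
  obtain U' where U': "U' \<in> kernels" "AE z in unit_leb2. U z = U' z"
    using graphon_borel_version[OF assms(1)] .
  obtain V' where V': "V' \<in> kernels" "AE z in unit_leb2. V z = V' z"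
    using graphon_borel_version[OF assms(2)] .
  obtain W' where W': "W' \<in> kernels" "AE z in unit_leb2. W z = W' z"
    using graphon_borel_version[OF assms(3)] .
  show ?thesis
    unfolding cut_dist_borel_version[OF U' V'] cut_dist_borel_version[OF V' W'] cut_dist_borel_version[OF U' W']
    by (rule borel_cut_dist_triangle[OF U'(1) V'(1) W'(1)])
qed

text \<open>The quotient distance is well defined: by the triangle inequality, changing
  representatives within their classes does not change the distance, so \<open>the_elem\<close> acts
  on a singleton.\<close>

lemma unlabelled_dist_eq:
  assumes X: "X \<in> unlabelled_graphons" and Y: "Y \<in> unlabelled_graphons"
    and U: "U \<in> X" and V: "V \<in> Y"
  shows "unlabelled_dist X Y = cut_dist U V"
proof -
  have *: "cut_dist U' V' = cut_dist U V" if "U' \<in> X" "V' \<in> Y" for U' V'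
  proof -
    obtain U\<^sub>0 V\<^sub>0 where UV\<^sub>0: "U\<^sub>0 \<in> graphons" "X = unlabelled U\<^sub>0" "V\<^sub>0 \<in> graphons" "Y = unlabelled V\<^sub>0"
      using X Y by (auto simp: unlabelled_graphons_def)
    have eq: "cut_dist A B = cut_dist U\<^sub>0 V\<^sub>0" if "A \<in> X" "B \<in> Y" for A B
    proof -
      have AB: "A \<in> graphons" "B \<in> graphons" "cut_dist U\<^sub>0 A = 0" "cut_dist V\<^sub>0 B = 0"
        using that UV\<^sub>0 by (auto simp: unlabelled_def)
      then show ?thesis
        using cut_dist_triangle[of A U\<^sub>0 B] cut_dist_triangle[of U\<^sub>0 V\<^sub>0 B]
          cut_dist_triangle[of U\<^sub>0 A V\<^sub>0] cut_dist_triangle[of A B V\<^sub>0]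
          cut_dist_commute[of A U\<^sub>0] cut_dist_commute[of B V\<^sub>0] UV\<^sub>0 by linarith
    qed
    show ?thesis
      using eq[OF that] eq[OF U V] by simp
  qed
  have "{cut_dist U V | U V. U \<in> X \<and> V \<in> Y} = {cut_dist U V}"
  proof (intro equalityI subsetI)
    fix x assume "x \<in> {cut_dist U V | U V. U \<in> X \<and> V \<in> Y}"
    then obtain U' V' where "x = cut_dist U' V'" "U' \<in> X" "V' \<in> Y"
      by blast
    then show "x \<in> {cut_dist U V}"
      using *[of U' V'] by simp
  qed (use U V in blast)
  then show ?thesis
    using X Y by (simp add: unlabelled_dist_def)
qed

lemma unlabelled_self: "U \<in> graphons \<Longrightarrow> U \<in> unlabelled U"
  by (simp add: unlabelled_def cut_dist_refl)

lemma unlabelled_in: "U \<in> graphons \<Longrightarrow> unlabelled U \<in> unlabelled_graphons"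
  by (simp add: unlabelled_graphons_def)

lemma unlabelled_dist_unlabelled:
  assumes "U \<in> graphons" "V \<in> graphons"
  shows "unlabelled_dist (unlabelled U) (unlabelled V) = cut_dist U V"
  using assms by (intro unlabelled_dist_eq unlabelled_self unlabelled_in)

lemma Metric_space_unlabelled: "Metric_space unlabelled_graphons unlabelled_dist"
proof
  have unl: "\<exists>U\<in>graphons. X = unlabelled U" if "X \<in> unlabelled_graphons" for X
    using that by (auto simp: unlabelled_graphons_def)
  fix X Y Z
  show "0 \<le> unlabelled_dist X Y"
  proof (cases "X \<in> unlabelled_graphons \<and> Y \<in> unlabelled_graphons")
    case True
    then obtain U V where "U \<in> graphons" "X = unlabelled U" "V \<in> graphons" "Y = unlabelled V"
      using unl by metis
    then show ?thesis
      by (simp add: unlabelled_dist_unlabelled cut_dist_nonneg)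
  qed (auto simp: unlabelled_dist_def)
  show "unlabelled_dist X Y = unlabelled_dist Y X"
  proof (cases "X \<in> unlabelled_graphons \<and> Y \<in> unlabelled_graphons")
    case True
    then obtain U V where "U \<in> graphons" "X = unlabelled U" "V \<in> graphons" "Y = unlabelled V"
      using unl by metis
    then show ?thesis
      by (simp add: unlabelled_dist_unlabelled cut_dist_commute[of U V])
  qed (auto simp: unlabelled_dist_def)
  assume "X \<in> unlabelled_graphons" "Y \<in> unlabelled_graphons"
  then obtain U V where U: "U \<in> graphons" "X = unlabelled U" and V: "V \<in> graphons" "Y = unlabelled V"
    using unl by metis
  show "unlabelled_dist X Y = 0 \<longleftrightarrow> X = Y"
  proof
    assume "unlabelled_dist X Y = 0"
    then have UV: "cut_dist U V = 0" "cut_dist V U = 0"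
      using U V by (simp_all add: unlabelled_dist_unlabelled cut_dist_commute[of V U])
    have "cut_dist U W = 0 \<longleftrightarrow> cut_dist V W = 0" if "W \<in> graphons" for W
      using UV U V that cut_dist_triangle[of U V W] cut_dist_triangle[of V U W]
        cut_dist_nonneg[of U W] cut_dist_nonneg[of V W] by auto
    then show "X = Y"
      unfolding U V unlabelled_def by auto
  next
    assume "X = Y"
    then show "unlabelled_dist X Y = 0"
      using unlabelled_dist_unlabelled[OF U(1) U(1)] U by (simp add: cut_dist_refl)
  qed
  assume "Z \<in> unlabelled_graphons"
  then obtain W where "W \<in> graphons" "Z = unlabelled W"
    using unl by metis
  then show "unlabelled_dist X Z \<le> unlabelled_dist X Y + unlabelled_dist Y Z"
    using U V by (simp add: unlabelled_dist_unlabelled cut_dist_triangle)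
qed

section \<open>The rate function\<close>

text \<open>The infimum defining the distance admits \<theta> on the side of \<open>U\<close> and
  the identity on the side of its pullback, for which the two functions coincide. Thus \<theta> may
  fail to be invertible and the pullback still stays in the class.\<close>

lemma pullback_in_unlabelled:
  assumes U: "U \<in> graphons" and U': "U' \<in> kernels" "AE z in unit_leb2. U z = U' z" and \<theta>: "\<theta> \<in> mp_maps"
  obtains V where "V \<in> unlabelled U" "AE z in unit_leb2. V z = pullback U' \<theta> z"
proof -
  obtain \<phi> where \<phi>: "\<phi> \<in> measure_preserving_maps" and eq: "AE x in unit_leb. \<phi> x = \<theta> x"
    using measure_preserving_lebesgue_version[OF \<theta>] .
  have into: "\<phi> x \<in> {0..1}" if "x \<in> {0..1}" for x
    using \<phi> that by (auto simp: measure_preserving_maps_def measurable_restrict_space2_iff space_restrict_space)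
  have AE_V: "AE z in unit_leb2. pullback U \<phi> z = pullback U' \<theta> z"
    using U'(2) eq \<theta> by (rule pullback_AE_cong)
  have "pullback U \<phi> \<in> graphons"
  proof (rule graphonsI[OF pullback_kernels[OF U'(1) \<theta>] AE_V])
    show "pullback U \<phi> z \<in> {0..1}" if "z \<in> unit_square" for z
    proof -
      have "(\<phi> (fst z), \<phi> (snd z)) \<in> unit_square"
        using that into by auto
      then show ?thesis
        using U unfolding graphons_def pullback_eq by blast
    qed
    show "pullback U \<phi> (x, y) = pullback U \<phi> (y, x)" if "x \<in> {0..1}" "y \<in> {0..1}" for x y
      using U into[OF that(1)] into[OF that(2)] unfolding graphons_def pullback_def by auto
  qed
  moreover have "cut_dist U (pullback U \<phi>) = 0"
  proof -
    note ker = U'(1) pullback_kernels[OF U'(1) \<theta>]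
    have "borel_cut_dist U' (pullback U' \<theta>)
        \<le> borel_cut_metric (pullback U' \<theta>) (pullback (pullback U' \<theta>) (\<lambda>x. x))"
      by (intro borel_cut_dist_le ker \<theta> id_mp_maps)
    also have "\<dots> \<le> 0"
      by (intro borel_cut_metric_least) (simp add: pullback_eq)
    finally show ?thesis
      using borel_cut_dist_nonneg[OF ker] cut_dist_borel_version[OF U' ker(2) AE_V] by simp
  qed
  ultimately show ?thesis
    using AE_V by (intro that[of "pullback U \<phi>"]) (simp_all add: unlabelled_def)
qed

lemma block_nn_integral_borel_version:
  assumes I: "I \<in> sets borel" "I \<subseteq> {0..1}" and J: "J \<in> sets borel" "J \<subseteq> {0..1}"
    and V': "V' \<in> kernels" "AE z in unit_leb2. V z = V' z" and H [measurable]: "H \<in> borel_measurable borel"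
  shows "(\<integral>\<^sup>+z\<in>I \<times> J. H (V z) \<partial>lebesgue) = (\<integral>\<^sup>+z. indicator (I \<times> J) z * H (V' z) \<partial>unit_leb2)"
proof -
  have [measurable]: "V' \<in> borel_measurable borel" "I \<times> J \<in> sets borel" "unit_square \<in> sets borel"
    using V' I J by (auto simp: kernels_def unit_square_borel borel_Times)
  have "(\<integral>\<^sup>+z\<in>I \<times> J. H (V z) \<partial>lebesgue) = (\<integral>\<^sup>+z\<in>I \<times> J. H (V z) \<partial>lborel)"
    by (rule nn_integral_completion)
  also have "\<dots> = (\<integral>\<^sup>+z. indicator unit_square z * (indicator (I \<times> J) z * H (V' z)) \<partial>lborel)"
  proof (rule nn_integral_cong_AE)
    show "AE z in lborel. H (V z) * indicator (I \<times> J) z = indicator unit_square z * (indicator (I \<times> J) z * H (V' z))"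
      using V'(2)[unfolded AE_unit_leb2_iff] by eventually_elim (use I J in \<open>auto simp: indicator_def\<close>)
  qed
  also have "\<dots> = (\<integral>\<^sup>+z. indicator (I \<times> J) z * H (V' z) \<partial>unit_leb2)"
    unfolding unit_leb2_eq by (subst nn_integral_density) auto
  finally show ?thesis .
qed

lemma ennreal_two_times_half: "2 * ((1 / 2) * x) = (x :: ennreal)" "(1 / 2) * (2 * x) = (x :: ennreal)"
proof -
  have "2 * (1 / 2 :: ennreal) = 1"
    by (simp add: ennreal_times_divide ennreal_divide_self)
  then have *: "2 * (1 / 2 :: ennreal) = 1" "(1 / 2 :: ennreal) * 2 = 1"
    by (simp_all only: mult.commute)
  show "2 * ((1 / 2) * x) = x" "(1 / 2) * (2 * x) = x"
    by (simp_all only: mult.assoc[symmetric] * mult_1)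
qed

section \<open>The partition of the unit interval into blocks\<close>

locale block_partition =
  fixes k :: nat and \<alpha> :: "nat \<Rightarrow> real"
  assumes k: "k \<ge> 1" and \<alpha>: "\<forall>i\<in>{1..k}. \<alpha> i \<ge> 0" and nonzero: "\<exists>i\<in>{1..k}. \<alpha> i \<noteq> 0"
begin

lemma total_pos: "0 < (\<Sum>j\<in>{1..k}. \<alpha> j)"
proof -
  obtain i where "i \<in> {1..k}" "0 < \<alpha> i"
    using nonzero \<alpha> by force
  then show ?thesis
    using \<alpha> by (intro sum_pos2[of _ i]) auto
qed

lemma breakpoint_0: "breakpoint k \<alpha> 0 = 0"
  by (simp add: breakpoint_def)

lemma breakpoint_last: "breakpoint k \<alpha> k = 1"
  using total_pos by (simp add: breakpoint_def)

lemma breakpoint_mono: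
  assumes "i \<le> j" "j \<le> k"
  shows "breakpoint k \<alpha> i \<le> breakpoint k \<alpha> j"
  unfolding breakpoint_def using assms \<alpha> total_pos
  by (intro divide_right_mono sum_mono2) auto

lemma block_borel: "block k \<alpha> i \<in> sets borel"
  by (simp add: block_def)

lemma block_subset:
  assumes "i \<in> {1..k}"
  shows "block k \<alpha> i \<subseteq> {0..1}"
proof -
  have "0 \<le> breakpoint k \<alpha> (i - 1)" "breakpoint k \<alpha> i \<le> 1"
    unfolding breakpoint_0[symmetric] breakpoint_last[symmetric]
    using assms by (auto intro!: breakpoint_mono)
  then show ?thesis
    by (auto simp: block_def)
qed

lemma block_disjoint: "disjoint_family_on (block k \<alpha>) {1..k}"
proof -
  have "block k \<alpha> i \<inter> block k \<alpha> j = {}" if "i < j" "j \<le> k" for i j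
  proof -
    have "breakpoint k \<alpha> i \<le> breakpoint k \<alpha> (j - 1)"
      using that by (intro breakpoint_mono) auto
    then show ?thesis
      using that by (auto simp: block_def)
  qed
  then show ?thesis
    unfolding disjoint_family_on_def by (metis Int_commute atLeastAtMost_iff nat_neq_iff)
qed

lemma block_cover:
  assumes "x \<in> {0..1}"
  shows "x \<in> (\<Union>i\<in>{1..k}. block k \<alpha> i)"
proof (cases "x < 1")
  case True
  \<comment> \<open>Taking the least index skips the empty blocks that arise when an entry of
    \<alpha> vanishes.\<close>
  define i where "i = (LEAST i. x < breakpoint k \<alpha> i)"
  have ex: "x < breakpoint k \<alpha> k"
    using True by (simp add: breakpoint_last)
  have i: "x < breakpoint k \<alpha> i" "i \<le> k"
    unfolding i_def using ex by (auto intro: LeastI Least_le)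
  have "i \<noteq> 0"
    using i(1) assms by (cases i) (auto simp: breakpoint_0)
  then have "\<not> x < breakpoint k \<alpha> (i - 1)"
    using not_less_Least[of "i - 1" "\<lambda>i. x < breakpoint k \<alpha> i"] by (simp add: i_def)
  then have "x \<in> block k \<alpha> i"
    using i by (auto simp: block_def)
  then show ?thesis
    using \<open>i \<noteq> 0\<close> i by (intro UN_I[of i]) auto
next
  case False
  then have "x = 1"
    using assms by simp
  \<comment> \<open>The last block is closed and contains 1 even when \<open>\<alpha> k = 0\<close>,
    in which case it is that single point.\<close>
  then have "x \<in> block k \<alpha> k"
    using breakpoint_mono[of "k - 1" k] by (simp add: block_def breakpoint_last)
  then show ?thesis
    using k by (intro UN_I[of k]) auto
qed

end

section \<open>Closedness of the level sets by sequences\<close>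

theorem theorem1p4:
  fixes k :: nat and p :: "nat \<Rightarrow> nat \<Rightarrow> real" and \<alpha> :: "nat \<Rightarrow> real"
  assumes "k \<ge> 1"
    and "\<forall>i\<in>{1..k}. \<forall>j\<in>{1..k}. p i j \<in> {0..1}"
    and "\<forall>i\<in>{1..k}. \<forall>j\<in>{1..k}. p i j = p j i"
    and "\<forall>i\<in>{1..k}. \<alpha> i \<ge> 0"
    and "\<exists>i\<in>{1..k}. \<alpha> i \<noteq> 0"
  shows "\<forall>r::real. closedin (Metric_space.mtopology unlabelled_graphons unlabelled_dist)
           {X \<in> unlabelled_graphons. enn2ereal (rate_fun k \<alpha> p X) \<le> ereal r}"
proof
  fix r :: real
  interpret Metric_space unlabelled_graphons unlabelled_dist
    by (rule Metric_space_unlabelled)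
  interpret block_partition k \<alpha>
    using assms by unfold_locales
  let ?S = "{X \<in> unlabelled_graphons. enn2ereal (rate_fun k \<alpha> p X) \<le> ereal r}"
  define E where "E V = (\<Sum>i\<in>{1..k}. \<Sum>j\<in>{1..k}.
      \<integral>\<^sup>+z. indicator (block k \<alpha> i \<times> block k \<alpha> j) z * rel_entropy (p i j) (V z) \<partial>unit_leb2)" for V
  define R where "R V = (1 / 2) * (\<Sum>i\<in>{1..k}. \<Sum>j\<in>{1..k}.
        \<integral>\<^sup>+z\<in>block k \<alpha> i \<times> block k \<alpha> j. rel_entropy (p i j) (V z) \<partial>lebesgue)" for V
  have R_eq: "R V = (1 / 2) * E V'" if "V' \<in> kernels" "AE z in unit_leb2. V z = V' z" for V V'
    unfolding R_def E_def using that
    by (intro arg_cong[where f = "\<lambda>x. (1 / 2) * x"] sum.cong refl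
          block_nn_integral_borel_version block_borel block_subset rel_entropy_measurable)
  have rate: "rate_fun k \<alpha> p X = (INF V\<in>X. R V)" for X
    by (simp add: rate_fun_def R_def)
  show "closedin mtopology ?S"
    unfolding metric_closedin_iff_sequentially_closed
  proof (intro conjI allI impI, blast, elim conjE)
    fix \<sigma> X assume \<sigma>: "range \<sigma> \<subseteq> ?S" and lim: "limitin mtopology \<sigma> X sequentially"
    have X: "X \<in> unlabelled_graphons"
      using lim by (rule limitin_mspace)
    then obtain U where U: "U \<in> graphons" "X = unlabelled U"
      by (auto simp: unlabelled_graphons_def)
    obtain U' where U': "U' \<in> kernels" "AE z in unit_leb2. U z = U' z"
      using graphon_borel_version[OF U(1)] .
    have \<sigma>_in: "\<sigma> n \<in> unlabelled_graphons" "enn2ereal (rate_fun k \<alpha> p (\<sigma> n)) \<le> ereal r" for n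
      using \<sigma> by auto
    \<comment> \<open>For negative r the level set is empty; a sequence inside it forces r to be
      nonnegative, so that \<open>ennreal r\<close> does not truncate.\<close>
    have "0 \<le> ereal r"
      using enn2ereal_nonneg \<sigma>_in(2)[of 0] order_trans by blast
    then have r: "0 \<le> r" by simp
    have rate_le: "rate_fun k \<alpha> p (\<sigma> n) \<le> ennreal r" for n
      using \<sigma>_in(2)[of n] r by (simp add: less_eq_ennreal.rep_eq)
    \<comment> \<open>The slack 1 / Suc n makes the inequality strict, so an element of the class
      lies below the bound whether or not the infimum is attained. It vanishes in the limit, like
      the same slack in the choice of the maps further down.\<close>
    have "\<exists>V\<in>\<sigma> n. R V < ennreal (r + 1 / Suc n)" for n
    proof -
      have "rate_fun k \<alpha> p (\<sigma> n) < ennreal (r + 1 / Suc n)"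
        using r by (intro le_less_trans[OF rate_le]) (simp add: ennreal_less_iff)
      then show ?thesis
        by (simp add: rate INF_less_iff)
    qed
    then obtain V where V: "\<And>n. V n \<in> \<sigma> n" and RV: "\<And>n. R (V n) < ennreal (r + 1 / Suc n)"
      by metis
    have V_graphon: "V n \<in> graphons" for n
      using V[of n] \<sigma>_in(1)[of n] by (auto simp: unlabelled_graphons_def unlabelled_def)
    have "\<exists>V'. V' \<in> kernels \<and> (AE z in unit_leb2. V n z = V' z)" for n
      by (rule graphon_borel_version[OF V_graphon[of n]]) blast
    then obtain V' where V': "\<And>n. V' n \<in> kernels" "\<And>n. AE z in unit_leb2. V n z = V' n z"
      by metis
    \<comment> \<open>Because the quotient distance may be computed from any representatives, the
      near-minimiser itself can be compared with \<open>U\<close>.\<close>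
    have dist: "borel_cut_dist (V' n) U' = unlabelled_dist (\<sigma> n) X" for n
      using unlabelled_dist_eq[OF \<sigma>_in(1) X V, of U n] unlabelled_self[OF U(1)] U(2)
        cut_dist_borel_version[OF V' U'] by simp
    have "\<exists>\<phi> \<psi>. \<phi> \<in> mp_maps \<and> \<psi> \<in> mp_maps \<and>
        borel_cut_metric (pullback (V' n) \<phi>) (pullback U' \<psi>) < unlabelled_dist (\<sigma> n) X + 1 / Suc n" for n
    proof -
      have "borel_cut_dist (V' n) U' < unlabelled_dist (\<sigma> n) X + 1 / Suc n"
        by (simp add: dist)
      then show ?thesis
        by (rule borel_cut_dist_less) blast
    qed
    then obtain \<phi> \<psi> where \<phi>: "\<And>n. \<phi> n \<in> mp_maps" and \<psi>: "\<And>n. \<psi> n \<in> mp_maps"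
      and less: "\<And>n. borel_cut_metric (pullback (V' n) (\<phi> n)) (pullback U' (\<psi> n)) < unlabelled_dist (\<sigma> n) X + 1 / Suc n"
      by metis
    have "(\<lambda>n. unlabelled_dist (\<sigma> n) X) \<longlonglongrightarrow> 0"
    proof (rule LIMSEQ_I)
      fix e :: real assume "0 < e"
      then obtain N where "\<forall>n\<ge>N. unlabelled_dist (\<sigma> n) X < e"
        using lim unfolding limit_metric_sequentially by blast
      then show "\<exists>N. \<forall>n\<ge>N. norm (unlabelled_dist (\<sigma> n) X - 0) < e"
        by auto
    qed
    from tendsto_add[OF this LIMSEQ_Suc[OF lim_1_over_n]]
    have bound: "(\<lambda>n. unlabelled_dist (\<sigma> n) X + 1 / Suc n) \<longlonglongrightarrow> 0"
      by simp
    have cut: "(\<lambda>n. borel_cut_metric (pullback (V' n) (\<phi> n)) (pullback U' (\<psi> n))) \<longlonglongrightarrow> 0"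
    proof (rule Lim_null_comparison[OF always_eventually[OF allI] bound])
      fix n
      have "0 \<le> borel_cut_metric (pullback (V' n) (\<phi> n)) (pullback U' (\<psi> n))"
        by (intro borel_cut_metric_nonneg pullback_kernels V' U' \<phi> \<psi>)
      then show "norm (borel_cut_metric (pullback (V' n) (\<phi> n)) (pullback U' (\<psi> n))) \<le> unlabelled_dist (\<sigma> n) X + 1 / Suc n"
        using less[of n] by simp
    qed
    have EV: "E (V' n) \<le> ennreal (2 * (r + 1 / Suc n))" for n
    proof -
      have "E (V' n) = 2 * ((1 / 2) * E (V' n))"
        by (rule ennreal_two_times_half(1)[symmetric])
      also have "\<dots> \<le> 2 * ennreal (r + 1 / Suc n)"
        using RV[of n] R_eq[OF V'(1)[of n] V'(2)[of n]] by (intro mult_left_mono) auto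
      also have "\<dots> = ennreal (2 * (r + 1 / Suc n))"
        using r by (subst ennreal_mult) simp_all
      finally show ?thesis .
    qed
    obtain s \<theta> where s: "strict_mono (s :: nat \<Rightarrow> nat)" and \<theta>: "\<theta> \<in> mp_maps"
      and le: "E (pullback U' \<theta>) \<le> liminf (\<lambda>n. E (V' (s n)))"
    proof (rule entropy_lower_semicontinuous[where K = "{1..k}" and I = "block k \<alpha>" and p = p
          and \<phi> = \<phi> and \<psi> = \<psi> and V = V' and U = U'])
      show "AE x in unit_leb. x \<in> (\<Union>i\<in>{1..k}. block k \<alpha> i)"
        using AE_unit_leb_in by eventually_elim (rule block_cover)
    qed (use block_borel block_disjoint assms(2) \<phi> \<psi> V' U' cut in \<open>auto simp: E_def\<close>)
    have "(\<lambda>n. ennreal (2 * (r + 1 / Suc (s n)))) \<longlonglongrightarrow> ennreal (2 * (r + 0))"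
      using LIMSEQ_subseq_LIMSEQ[OF LIMSEQ_Suc[OF lim_1_over_n] s]
      by (intro tendsto_ennrealI tendsto_intros) (simp add: comp_def)
    then have "liminf (\<lambda>n. ennreal (2 * (r + 1 / Suc (s n)))) = ennreal (2 * r)"
      by (simp add: lim_imp_Liminf)
    moreover have "liminf (\<lambda>n. E (V' (s n))) \<le> liminf (\<lambda>n. ennreal (2 * (r + 1 / Suc (s n))))"
      by (intro Liminf_mono always_eventually allI EV)
    ultimately have E_le: "E (pullback U' \<theta>) \<le> ennreal (2 * r)"
      using le by simp
    obtain W where W: "W \<in> X" "AE z in unit_leb2. W z = pullback U' \<theta> z"
      using pullback_in_unlabelled[OF U(1) U' \<theta>] U(2) by metis
    have "rate_fun k \<alpha> p X \<le> R W"
      unfolding rate using W(1) by (rule INF_lower)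
    also have "\<dots> = (1 / 2) * E (pullback U' \<theta>)"
      by (rule R_eq[OF pullback_kernels[OF U'(1) \<theta>] W(2)])
    also have "\<dots> \<le> (1 / 2) * ennreal (2 * r)"
      using E_le by (rule mult_left_mono) simp
    also have "\<dots> = (1 / 2) * (2 * ennreal r)"
      using r by (simp add: ennreal_mult)
    also have "\<dots> = ennreal r"
      by (rule ennreal_two_times_half)
    finally have "enn2ereal (rate_fun k \<alpha> p X) \<le> ereal r"
      using r by (simp add: less_eq_ennreal.rep_eq)
    with X show "X \<in> ?S" by simp
  qed
qed

end
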